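(* Let $C=11\cdot 195^2$. Let $n\ge 2$ and let $\mathbf G=(G_1,G_2,G_3)$ be a graph triple of order $n$ with $\Delta(G_1),\Delta(G_2)\le n-2$ and $\Delta(G_3)\le n-1$. If $|E_1|+|E_2|+|E_3|+\max\{\Delta(G_1),\Delta(G_2)\}+\Delta(G_3)\le 3n-C$, then $\mathbf G$ packs.
   Context: A graph triple $\mathbf G=(G_1,G_2,G_3)$ of order $n$ consists of two disjoint $n$-vertex graphs $G_1=(V_1,E_1)$, $G_2=(V_2,E_2)$ and a bipartite graph $G_3=(V_1\cup V_2,E_3)$ with parts $V_1,V_2$. $\mathbf G$ packs if there is a bijection $f:V_1\to V_2$ such that $vf(v)\notin E_3$ for every $v\in V_1$, and $uv\in E_1$ implies $f(u)f(v)\notin E_2$. $\Delta(G)$ is the maximum degree of $G$. *)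

theory Defs
  imports Main
begin

definition simple_graph :: "'a set \<Rightarrow> 'a set set \<Rightarrow> bool" where
  "simple_graph V E \<longleftrightarrow> finite V \<and> (\<forall>e\<in>E. e \<subseteq> V \<and> card e = 2)"

definition bipartite_graph :: "'a set \<Rightarrow> 'a set \<Rightarrow> 'a set set \<Rightarrow> bool" where
  "bipartite_graph V1 V2 E \<longleftrightarrow> finite V1 \<and> finite V2 \<and>
     (\<forall>e\<in>E. \<exists>u\<in>V1. \<exists>v\<in>V2. e = {u, v})"

definition degree :: "'a set set \<Rightarrow> 'a \<Rightarrow> nat" where
  "degree E v = card {e \<in> E. v \<in> e}"

definition max_degree :: "'a set \<Rightarrow> 'a set set \<Rightarrow> nat" where
  "max_degree V E = (if V = {} then 0 else Max (degree E ` V))"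

definition graph_triple :: "nat \<Rightarrow> 'a set \<Rightarrow> 'a set set \<Rightarrow> 'a set \<Rightarrow> 'a set set \<Rightarrow> 'a set set \<Rightarrow> bool" where
  "graph_triple n V1 E1 V2 E2 E3 \<longleftrightarrow>
     V1 \<inter> V2 = {} \<and> card V1 = n \<and> card V2 = n \<and>
     simple_graph V1 E1 \<and> simple_graph V2 E2 \<and> bipartite_graph V1 V2 E3"

definition packs :: "'a set \<Rightarrow> 'a set set \<Rightarrow> 'a set \<Rightarrow> 'a set set \<Rightarrow> 'a set set \<Rightarrow> bool" where
  "packs V1 E1 V2 E2 E3 \<longleftrightarrow>
     (\<exists>f. bij_betw f V1 V2 \<and>
          (\<forall>v\<in>V1. {v, f v} \<notin> E3) \<and>
          (\<forall>u\<in>V1. \<forall>v\<in>V1. {u, v} \<in> E1 \<longrightarrow> {f u, f v} \<notin> E2))"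

end

(* A single symmetric relation g on A \<union> B (A = V1, B = V2) encodes all three graphs, and the maximum
   degrees are relaxed to upper bounds M and N. Consider a counterexample of minimal order n.

   Placing a set S \<subseteq> A injectively on h(S) \<subseteq> B and adding to the third graph all pairs x, z with
   x adjacent to some a \<in> S and z adjacent to h(a) gives a smaller triple; if that triple satisfies the
   hypotheses it packs, and so does the original one. With p and q the numbers of unplaced neighbours of a and
   h(a), this costs p q new edges and removes p + q, so it succeeds whenever one placed vertex c has large degree
   and all its unplaced conflicts vanish while the other products p q are small.

   If all degrees are at most n/100, a Sauer-Spencer argument packs the triple after the vertices of constant
   but large degree have been placed greedily; so some vertex c, say in A, has degree at least n/100. Weighting
   a vertex by 2 |N(v) \<inter> Z| + |N(v) - Z| for a small set Z containing the heavy vertices (degree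
   at least n/6000, at most 36000 of them) shows that there are more than n + M + N light vertices (weight
   at most 3), those of weight at most 1 counted twice.
   A light vertex without a heavy neighbour on its own side must be adjacent to every vertex of degree
   at least 13n/6000 on the other side, since otherwise the two could be matched. If no vertex of B has
   that degree, then either c can be placed on a light vertex, or all light vertices of B are adjacent to c and
   A contains enough leaves to absorb the neighbours of the image of c. Otherwise almost every relevant light
   vertex has a unique heavy neighbour on its own side, and c is placed together with at most four further
   heavy vertices in a cyclic pattern in which every heavy vertex lands on a light one. *)

theory Submission
  imports Complex_Main Defs
begin

section \<open>Graphs as relations; partial placements\<close>

text \<open>Write T for n/6000. The thresholds come from three budgets. Putting a vertex on an image
  with at most three neighbours, none heavy, each matched with a vertex of inner degree at most 3,
  costs 9T new edges, 3T for the growth of \<open>N\<close> and a constant. This stays below 13T,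
  the degree from which a vertex is worth placing. If one neighbour of the image may have degree up
  to 13T, the cost rises to at most 42T + 14T = 56T plus a constant, still below 60T = n/100, and
  60T is what the Sauer-Spencer case leaves as lower bound for the largest degree. The constant
  418275 pays for the heavy vertices, each entering the count with a small factor, and keeps all
  degrees more than 209000 below n, so that a bounded number of placements cannot violate the degree
  conditions. \<open>M\<close> and \<open>N\<close> are mere upper bounds because a placement raises
  cross degrees by a controlled amount \<open>G\<close>: the smaller triple is tested with
  \<open>M\<close> and \<open>N + G\<close>, and its true maxima are never computed.\<close>

definition nb :: "('a \<Rightarrow> 'a \<Rightarrow> bool) \<Rightarrow> 'a set \<Rightarrow> 'a \<Rightarrow> 'a set" where
  "nb g S x = {y \<in> S. g x y}"

definition dg :: "('a \<Rightarrow> 'a \<Rightarrow> bool) \<Rightarrow> 'a set \<Rightarrow> 'a \<Rightarrow> real" where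
  "dg g S x = real (card (nb g S x))"

text \<open>Since every edge is counted from both ends, \<open>esum g S\<close> is twice the number of edges inside \<open>S\<close>.\<close>

definition esum :: "('a \<Rightarrow> 'a \<Rightarrow> bool) \<Rightarrow> 'a set \<Rightarrow> real" where
  "esum g S = (\<Sum>x\<in>S. dg g S x)"

definition graph :: "('a \<Rightarrow> 'a \<Rightarrow> bool) \<Rightarrow> bool" where
  "graph g \<longleftrightarrow> (\<forall>x y. g x y \<longrightarrow> g y x) \<and> (\<forall>x. \<not> g x x)"

definition pk :: "'a set \<Rightarrow> 'a set \<Rightarrow> ('a \<Rightarrow> 'a \<Rightarrow> bool) \<Rightarrow> bool" where
  "pk A B g \<longleftrightarrow> (\<exists>f. bij_betw f A B \<and> (\<forall>x\<in>A. \<not> g x (f x)) \<and>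
     (\<forall>x\<in>A. \<forall>y\<in>A. g x y \<longrightarrow> \<not> g (f x) (f y)))"

lemma graphD: "graph g \<Longrightarrow> g x y \<Longrightarrow> g y x" "graph g \<Longrightarrow> \<not> g x x"
  by (auto simp: graph_def)

lemma graph_sym: "graph g \<Longrightarrow> g x y \<longleftrightarrow> g y x"
  by (auto simp: graph_def)

lemma in_nb [simp]: "y \<in> nb g S x \<longleftrightarrow> y \<in> S \<and> g x y"
  by (simp add: nb_def)

lemma nb_subset: "nb g S x \<subseteq> S"
  by auto

lemma finite_nb [simp]: "finite S \<Longrightarrow> finite (nb g S x)"
  using finite_subset[OF nb_subset] .

lemma dg_nonneg [simp]: "0 \<le> dg g S x"
  by (simp add: dg_def)

lemma dg_sum: "finite S \<Longrightarrow> dg g S x = (\<Sum>y\<in>S. if g x y then 1 else 0)"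
  by (simp add: dg_def nb_def sum.If_cases Int_def)

lemma dg_mono: "finite T \<Longrightarrow> S \<subseteq> T \<Longrightarrow> dg g S x \<le> dg g T x"
  unfolding dg_def by (auto intro!: card_mono)

lemma dg_Un: "finite S \<Longrightarrow> finite T \<Longrightarrow> S \<inter> T = {} \<Longrightarrow> dg g (S \<union> T) x = dg g S x + dg g T x"
  by (simp add: dg_sum sum.union_disjoint)

lemma dg_Diff:
  assumes "finite S" "T \<subseteq> S" shows "dg g S x = dg g (S - T) x + dg g T x"
proof -
  have "S = (S - T) \<union> T" using assms(2) by blast
  then show ?thesis using dg_Un[of "S - T" T g x] assms by (metis Diff_disjoint finite_Diff finite_subset inf_commute)
qed

lemma dg_zero_iff: "finite S \<Longrightarrow> dg g S x = 0 \<longleftrightarrow> (\<forall>y\<in>S. \<not> g x y)"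
  by (auto simp: dg_def nb_def)

lemma dg_ge_1: "finite S \<Longrightarrow> y \<in> S \<Longrightarrow> g x y \<Longrightarrow> 1 \<le> dg g S x"
  using dg_mono[of S "{y}" g x] by (auto simp: dg_def nb_def Collect_conv_if)

lemma dg_double_count:
  assumes "graph g" "finite S" "finite T"
  shows "(\<Sum>x\<in>S. dg g T x) = (\<Sum>y\<in>T. dg g S y)"
proof -
  have "(\<Sum>x\<in>S. dg g T x) = (\<Sum>y\<in>T. \<Sum>x\<in>S. if g x y then 1 else 0)"
    using assms by (simp add: dg_sum sum.swap[of _ S T])
  also have "\<dots> = (\<Sum>y\<in>T. \<Sum>x\<in>S. if g y x then 1 else 0)"
    using graph_sym[OF assms(1)] by (intro sum.cong) auto
  finally show ?thesis using assms by (simp add: dg_sum)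
qed

lemma esum_nonneg [simp]: "0 \<le> esum g S"
  by (simp add: esum_def sum_nonneg)

lemma esum_split:
  assumes "graph g" "finite S" "T \<subseteq> S"
  shows "esum g S = esum g (S - T) + 2 * (\<Sum>x\<in>T. dg g (S - T) x) + esum g T"
proof -
  have fT: "finite T" using assms finite_subset by blast
  have "esum g S = (\<Sum>x\<in>S - T. dg g S x) + (\<Sum>x\<in>T. dg g S x)"
    unfolding esum_def using assms by (simp add: sum.subset_diff)
  also have "(\<Sum>x\<in>S - T. dg g S x) = esum g (S - T) + (\<Sum>x\<in>S - T. dg g T x)"
    unfolding esum_def using dg_Diff[OF assms(2,3)] by (simp add: sum.distrib)
  also have "(\<Sum>x\<in>S - T. dg g T x) = (\<Sum>x\<in>T. dg g (S - T) x)"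
    using dg_double_count[OF assms(1) _ fT] assms by blast
  also have "(\<Sum>x\<in>T. dg g S x) = (\<Sum>x\<in>T. dg g (S - T) x) + esum g T"
    unfolding esum_def using dg_Diff[OF assms(2,3)] by (simp add: sum.distrib)
  finally show ?thesis by simp
qed

lemma esum_mono: "graph g \<Longrightarrow> finite S \<Longrightarrow> T \<subseteq> S \<Longrightarrow> esum g T \<le> esum g S"
  using esum_split[of g S T] by (simp add: sum_nonneg)

text \<open>An edge with exactly one end in \<open>Z\<close> is charged 2 to its outer end, an edge
  outside \<open>Z\<close> is charged 1 to each end. So the edges at \<open>Z\<close> are paid for
  by the vertices outside, and only edges inside \<open>Z\<close> are lost.\<close>

lemma weight_sum:
  assumes "graph g" "finite V" "Z \<subseteq> V"
  shows "(\<Sum>v\<in>V - Z. 2 * dg g Z v + dg g (V - Z) v) \<le> esum g V"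
proof -
  have fZ: "finite Z" using assms finite_subset by blast
  have "(\<Sum>v\<in>V - Z. 2 * dg g Z v + dg g (V - Z) v) = 2 * (\<Sum>v\<in>Z. dg g (V - Z) v) + esum g (V - Z)"
    using dg_double_count[OF assms(1) _ fZ, of "V - Z"] assms(2)
    by (simp add: sum.distrib esum_def sum_distrib_left[symmetric])
  also have "\<dots> \<le> esum g V"
    using esum_split[OF assms] by simp
  finally show ?thesis .
qed

lemma pk_swap:
  assumes "graph g" "pk A B g" shows "pk B A g"
proof -
  obtain f where f: "bij_betw f A B" "\<forall>x\<in>A. \<not> g x (f x)"
    "\<forall>x\<in>A. \<forall>y\<in>A. g x y \<longrightarrow> \<not> g (f x) (f y)"
    using assms(2) unfolding pk_def by blast
  let ?h = "inv_into A f"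
  have h: "bij_betw ?h B A" using f(1) by (rule bij_betw_inv_into)
  have fh: "f (?h z) = z" "?h z \<in> A" if "z \<in> B" for z
    using that f(1) h by (auto simp: bij_betw_inv_into_right bij_betwE)
  show ?thesis unfolding pk_def
    by (rule exI[of _ ?h]) (use h f fh graph_sym[OF assms(1)] in metis)
qed

section \<open>Partial placements and the triple that remains\<close>

definition lifted :: "'a set \<Rightarrow> 'a set \<Rightarrow> ('a \<Rightarrow> 'a \<Rightarrow> bool) \<Rightarrow> 'a set \<Rightarrow> ('a \<Rightarrow> 'a) \<Rightarrow> 'a \<Rightarrow> 'a \<Rightarrow> bool" where
  "lifted A B g S h x z \<longleftrightarrow> g x z \<or>
     (x \<in> A - S \<and> z \<in> B - h ` S \<and> (\<exists>a\<in>S. g x a \<and> g z (h a))) \<or>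
     (z \<in> A - S \<and> x \<in> B - h ` S \<and> (\<exists>a\<in>S. g z a \<and> g x (h a)))"

definition valid :: "'a set \<Rightarrow> 'a set \<Rightarrow> ('a \<Rightarrow> 'a \<Rightarrow> bool) \<Rightarrow> 'a set \<Rightarrow> ('a \<Rightarrow> 'a) \<Rightarrow> bool" where
  "valid A B g S h \<longleftrightarrow> finite S \<and> S \<subseteq> A \<and> h ` S \<subseteq> B \<and> inj_on h S \<and> (\<forall>a\<in>S. \<not> g a (h a)) \<and>
     (\<forall>a\<in>S. \<forall>a'\<in>S. g a a' \<longrightarrow> \<not> g (h a) (h a'))"

lemma graph_lifted: "graph g \<Longrightarrow> A \<inter> B = {} \<Longrightarrow> graph (lifted A B g S h)"
  unfolding graph_def lifted_def by blast

text \<open>A neighbour x of a placed \<open>a\<close> must not go to a neighbour of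
  \<open>h a\<close>. This is a condition on the pair x, f x alone, so added cross pairs can express
  it.\<close>

lemma pk_extend:
  assumes gr: "graph g" and v: "valid A B g S h"
    and p: "pk (A - S) (B - h ` S) (lifted A B g S h)"
  shows "pk A B g"
proof -
  let ?g = "lifted A B g S h"
  obtain f where f: "bij_betw f (A - S) (B - h ` S)" "\<forall>x\<in>A - S. \<not> ?g x (f x)"
    "\<forall>x\<in>A - S. \<forall>y\<in>A - S. ?g x y \<longrightarrow> \<not> ?g (f x) (f y)"
    using p unfolding pk_def by blast
  let ?f = "\<lambda>x. if x \<in> S then h x else f x"
  have fB: "f x \<in> B - h ` S" if "x \<in> A - S" for x using f(1) that by (auto simp: bij_betw_def)
  have "bij_betw h S (h ` S)" using v by (simp add: valid_def bij_betw_def)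
  then have "bij_betw ?f (S \<union> (A - S)) (h ` S \<union> (B - h ` S))"
    using f(1) by (intro bij_betw_disjoint_Un) auto
  moreover have "S \<union> (A - S) = A" "h ` S \<union> (B - h ` S) = B" using v by (auto simp: valid_def)
  ultimately have b: "bij_betw ?f A B" by simp
  have 1: "\<not> g x (f x)" if "x \<in> A - S" for x using f(2) that by (auto simp: lifted_def)
  have 2: "\<not> g (f x) (f y)" if "x \<in> A - S" "y \<in> A - S" "g x y" for x y
    using f(3) that by (meson lifted_def)
  have 3: "\<not> g (f x) (h a)" if "x \<in> A - S" "a \<in> S" "g x a" for x a
    using f(2) that fB[of x] unfolding lifted_def by blast
  have 4: "\<not> g (h a) (f x)" if "x \<in> A - S" "a \<in> S" "g a x" for x a
    using 3[of x a] that graph_sym[OF gr] by blast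
  show ?thesis unfolding pk_def
  proof (intro exI[of _ ?f] conjI ballI impI)
    show "bij_betw ?f A B" by (rule b)
    show "\<not> g x (?f x)" if "x \<in> A" for x using that 1 v by (auto simp: valid_def)
    show "\<not> g (?f x) (?f y)" if "x \<in> A" "y \<in> A" "g x y" for x y
      using that 2 3 4 v by (auto simp: valid_def)
  qed
qed

lemma card_UN_filter_le:
  assumes "finite S" "\<And>a. a \<in> S \<Longrightarrow> finite (X a)"
  shows "real (card (\<Union>a\<in>{a\<in>S. P a}. X a)) \<le> (\<Sum>a\<in>{a\<in>S. P a}. real (card (X a)))"
proof -
  have "card (\<Union>a\<in>{a\<in>S. P a}. X a) \<le> (\<Sum>a\<in>{a\<in>S. P a}. card (X a))"
    using assms by (intro card_UN_le) auto
  then show ?thesis by (metis of_nat_le_iff of_nat_sum)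
qed

lemma lifted_dg_same:
  assumes "A \<inter> B = {}"
  shows "x \<in> A - S \<Longrightarrow> dg (lifted A B g S h) (A - S) x = dg g (A - S) x"
    and "x \<in> B - h ` S \<Longrightarrow> dg (lifted A B g S h) (B - h ` S) x = dg g (B - h ` S) x"
proof -
  assume "x \<in> A - S"
  then have "nb (lifted A B g S h) (A - S) x = nb g (A - S) x" using assms by (auto simp: lifted_def)
  then show "dg (lifted A B g S h) (A - S) x = dg g (A - S) x" by (simp add: dg_def)
next
  assume "x \<in> B - h ` S"
  then have "nb (lifted A B g S h) (B - h ` S) x = nb g (B - h ` S) x" using assms by (auto simp: lifted_def)
  then show "dg (lifted A B g S h) (B - h ` S) x = dg g (B - h ` S) x" by (simp add: dg_def)
qed

lemma lifted_dg_cross_A: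
  assumes "graph g" "A \<inter> B = {}" "finite B" "finite S" "x \<in> A - S"
  shows "dg (lifted A B g S h) (B - h ` S) x
          \<le> dg g (B - h ` S) x + (\<Sum>a\<in>{a\<in>S. g x a}. dg g (B - h ` S) (h a))"
proof -
  let ?B = "B - h ` S"
  have "nb (lifted A B g S h) ?B x \<subseteq> nb g ?B x \<union> (\<Union>a\<in>{a\<in>S. g x a}. nb g ?B (h a))"
    using assms(2,5) graph_sym[OF assms(1)] by (auto simp: lifted_def)
  then have "card (nb (lifted A B g S h) ?B x) \<le> card (nb g ?B x \<union> (\<Union>a\<in>{a\<in>S. g x a}. nb g ?B (h a)))"
    using assms by (intro card_mono) auto
  also have "\<dots> \<le> card (nb g ?B x) + card (\<Union>a\<in>{a\<in>S. g x a}. nb g ?B (h a))" by (rule card_Un_le)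
  finally show ?thesis
    using card_UN_filter_le[OF assms(4), of "\<lambda>a. nb g ?B (h a)" "g x"] assms(3)
    unfolding dg_def by simp
qed

lemma lifted_dg_cross_B:
  assumes "graph g" "A \<inter> B = {}" "finite A" "finite S" "x \<in> B - h ` S"
  shows "dg (lifted A B g S h) (A - S) x
          \<le> dg g (A - S) x + (\<Sum>a\<in>{a\<in>S. g x (h a)}. dg g (A - S) a)"
proof -
  let ?A = "A - S"
  have "nb (lifted A B g S h) ?A x \<subseteq> nb g ?A x \<union> (\<Union>a\<in>{a\<in>S. g x (h a)}. nb g ?A a)"
    using assms(2,5) graph_sym[OF assms(1)] by (auto simp: lifted_def)
  then have "card (nb (lifted A B g S h) ?A x) \<le> card (nb g ?A x \<union> (\<Union>a\<in>{a\<in>S. g x (h a)}. nb g ?A a))"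
    using assms by (intro card_mono) auto
  also have "\<dots> \<le> card (nb g ?A x) + card (\<Union>a\<in>{a\<in>S. g x (h a)}. nb g ?A a)" by (rule card_Un_le)
  finally show ?thesis
    using card_UN_filter_le[OF assms(4), of "\<lambda>a. nb g ?A a" "\<lambda>a. g x (h a)"] assms(3)
    unfolding dg_def by simp
qed

text \<open>Weighted double counting, used with \<open>k\<close> the identity for the placed
  vertices themselves and with \<open>k = h\<close> for their images.\<close>

lemma sum_filter_double:
  assumes "graph g" "finite S" "finite X"
  shows "(\<Sum>x\<in>X. \<Sum>a\<in>{a\<in>S. g x (k a)}. w a) = (\<Sum>a\<in>S. dg g X (k a) * (w a :: real))"
proof -
  have "(\<Sum>x\<in>X. \<Sum>a\<in>{a\<in>S. g x (k a)}. w a) = (\<Sum>x\<in>X. \<Sum>a\<in>S. if g x (k a) then w a else 0)"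
    by (rule sum.cong[OF refl], rule sum.inter_filter[OF assms(2)])
  also have "\<dots> = (\<Sum>a\<in>S. \<Sum>x\<in>X. if g (k a) x then w a else 0)"
    using graph_sym[OF assms(1)] by (subst sum.swap) (intro sum.cong, auto)
  also have "\<dots> = (\<Sum>a\<in>S. dg g X (k a) * w a)"
    using assms(3) by (simp add: dg_sum sum_distrib_right if_distrib[of "\<lambda>t. t * _"] cong: if_cong)
  finally show ?thesis .
qed

text \<open>A placed \<open>a\<close> joins its p remaining neighbours to the q remaining neighbours
  of \<open>h a\<close>: at most p q new edges, each seen twice by \<open>esum\<close>.\<close>

lemma lifted_esum:
  assumes "graph g" "A \<inter> B = {}" "finite A" "finite B" "finite S"
  shows "esum (lifted A B g S h) ((A - S) \<union> (B - h ` S))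
      \<le> esum g ((A - S) \<union> (B - h ` S)) + 2 * (\<Sum>a\<in>S. dg g (A - S) a * dg g (B - h ` S) (h a))"
proof -
  let ?g = "lifted A B g S h" and ?A = "A - S" and ?B = "B - h ` S"
  have dj: "?A \<inter> ?B = {}" using assms by blast
  have U: "esum g' (?A \<union> ?B) = (\<Sum>x\<in>?A. dg g' ?A x + dg g' ?B x) + (\<Sum>x\<in>?B. dg g' ?B x + dg g' ?A x)" for g'
    unfolding esum_def using assms dj by (simp add: sum.union_disjoint dg_Un add.commute)
  have "(\<Sum>x\<in>?A. dg ?g ?A x + dg ?g ?B x)
      \<le> (\<Sum>x\<in>?A. dg g ?A x + dg g ?B x + (\<Sum>a\<in>{a\<in>S. g x a}. dg g ?B (h a)))"
  proof (rule sum_mono)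
    fix x assume x: "x \<in> ?A"
    show "dg ?g ?A x + dg ?g ?B x \<le> dg g ?A x + dg g ?B x + (\<Sum>a\<in>{a\<in>S. g x a}. dg g ?B (h a))"
      using lifted_dg_cross_A[OF assms(1,2,4,5) x, of h] lifted_dg_same(1)[OF assms(2) x, of g h] by linarith
  qed
  also have "\<dots> = (\<Sum>x\<in>?A. dg g ?A x + dg g ?B x) + (\<Sum>a\<in>S. dg g ?A a * dg g ?B (h a))"
    using sum_filter_double[OF assms(1,5), where X = ?A and k = "\<lambda>a. a" and w = "\<lambda>a. dg g ?B (h a)"] assms by (simp add: sum.distrib)
  finally have 1: "(\<Sum>x\<in>?A. dg ?g ?A x + dg ?g ?B x) \<le> \<dots>" .
  have "(\<Sum>x\<in>?B. dg ?g ?B x + dg ?g ?A x)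
      \<le> (\<Sum>x\<in>?B. dg g ?B x + dg g ?A x + (\<Sum>a\<in>{a\<in>S. g x (h a)}. dg g ?A a))"
  proof (rule sum_mono)
    fix x assume x: "x \<in> ?B"
    show "dg ?g ?B x + dg ?g ?A x \<le> dg g ?B x + dg g ?A x + (\<Sum>a\<in>{a\<in>S. g x (h a)}. dg g ?A a)"
      using lifted_dg_cross_B[OF assms(1,2,3,5) x] lifted_dg_same(2)[OF assms(2) x, of g] by linarith
  qed
  also have "\<dots> = (\<Sum>x\<in>?B. dg g ?B x + dg g ?A x) + (\<Sum>a\<in>S. dg g ?A a * dg g ?B (h a))"
    using sum_filter_double[OF assms(1,5), where X = ?B and k = h and w = "\<lambda>a. dg g ?A a"] assms by (simp add: sum.distrib mult.commute)
  finally have 2: "(\<Sum>x\<in>?B. dg ?g ?B x + dg ?g ?A x) \<le> \<dots>" .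
  show ?thesis unfolding U using 1 2 by simp
qed

section \<open>The Sauer-Spencer argument and greedy assignment\<close>

lemma card_bij_filter:
  assumes "bij_betw f A B" shows "card {x\<in>A. P (f x)} = card {z\<in>B. P z}"
proof -
  have "f ` {x\<in>A. P (f x)} = {z\<in>B. P z}" using assms by (auto simp: bij_betw_def)
  moreover have "inj_on f {x\<in>A. P (f x)}" using assms by (auto simp: bij_betw_def inj_on_def)
  ultimately show ?thesis by (metis card_image)
qed

lemma card_UN_le_mult:
  assumes "finite I" "\<And>i. i \<in> I \<Longrightarrow> real (card (X i)) \<le> k" "real (card I) \<le> m" "0 \<le> k"
  shows "real (card (\<Union>i\<in>I. X i)) \<le> m * k"
proof -
  have "real (card (\<Union>i\<in>I. X i)) \<le> (\<Sum>i\<in>I. real (card (X i)))"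
    using card_UN_le[OF assms(1), of X] by (metis of_nat_le_iff of_nat_sum)
  also have "\<dots> \<le> card I * k" using sum_bounded_above[of I "\<lambda>i. real (card (X i))" k] assms(2) by simp
  also have "\<dots> \<le> m * k" using assms by (simp add: mult_right_mono)
  finally show ?thesis .
qed

text \<open>A bijection with fewest conflicts has none: otherwise some vertex in a conflict can be
  exchanged with one that is neither forbidden by a list nor at distance two through the two graphs.\<close>

lemma sauer_spencer_list:
  fixes K L L' :: real
  assumes gr: "graph g" and AB: "finite A" "finite B" "card A = card B"
    and K: "\<And>x. x \<in> A \<Longrightarrow> dg g A x \<le> K" "\<And>z. z \<in> B \<Longrightarrow> dg g B z \<le> K"
    and L: "\<And>x. x \<in> A \<Longrightarrow> dg g B x \<le> L" "\<And>z. z \<in> B \<Longrightarrow> dg g A z \<le> L'"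
    and big: "2 * K * K + K + 1 + L + L' < card A"
  shows "pk A B g"
proof -
  \<comment> \<open>A diagonal pair records a forbidden match x, f x, so both kinds of conflict are
    minimised together.\<close>
  define C where "C f = {(x,y) \<in> A \<times> A. (x = y \<and> g x (f x)) \<or> (g x y \<and> g (f x) (f y))}" for f
  have fC: "finite (C f)" for f
    by (rule finite_subset[of _ "A \<times> A"]) (use AB in \<open>auto simp: C_def\<close>)
  have "\<exists>f. bij_betw f A B" using AB by (simp add: finite_same_card_bij)
  then obtain f where f: "bij_betw f A B" and min: "\<And>f'. bij_betw f' A B \<Longrightarrow> card (C f) \<le> card (C f')"
    using ex_has_least_nat[of "\<lambda>f. bij_betw f A B" _ "\<lambda>f. card (C f)"] by auto
  have fB: "f x \<in> B" if "x \<in> A" for x using f that by (auto simp: bij_betw_def)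
  have finj: "f x = f y \<Longrightarrow> x = y" if "x \<in> A" "y \<in> A" for x y
    using f that by (auto simp: bij_betw_def inj_on_def)
  have "C f = {}"
  proof (rule ccontr)
    assume "C f \<noteq> {}"
    then obtain u v where uv: "(u, v) \<in> C f" by auto
    have uA: "u \<in> A" using uv by (auto simp: C_def)
    \<comment> \<open>\<open>B1\<close> and \<open>B2\<close> stop u from taking \<open>f w\<close>
      and w from taking \<open>f u\<close>; \<open>B3\<close> and \<open>B4\<close> are the two ways
      of being at distance two through both graphs; \<open>B5\<close> removes the neighbours of u,
      so that u w is not itself an edge.\<close>
    define B1 where "B1 = {x\<in>A. g u (f x)}"
    define B2 where "B2 = nb g A (f u)"
    define B3 where "B3 = (\<Union>x\<in>nb g A u. {w\<in>A. g (f x) (f w)})"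
    define B4 where "B4 = (\<Union>x\<in>{x\<in>A. g (f u) (f x)}. nb g A x)"
    define B5 where "B5 = nb g A u"
    have K0: "0 \<le> K" using K(1)[OF uA] dg_nonneg[of g A u] by linarith
    have c1: "card B1 \<le> L" unfolding B1_def card_bij_filter[OF f, of "g u"]
      using L(1)[OF uA] by (simp add: dg_def nb_def)
    have c2: "card B2 \<le> L'" using L(2)[OF fB[OF uA]] by (simp add: B2_def dg_def)
    have c3: "card B3 \<le> K * K" unfolding B3_def
    proof (rule card_UN_le_mult)
      fix x assume "x \<in> nb g A u"
      then show "card {w\<in>A. g (f x) (f w)} \<le> K"
        using K(2)[OF fB, of x] card_bij_filter[OF f, of "g (f x)"] by (simp add: dg_def nb_def)
    qed (use AB K0 K(1)[OF uA] in \<open>auto simp: dg_def\<close>)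
    have c4: "card B4 \<le> K * K" unfolding B4_def
    proof (rule card_UN_le_mult)
      show "card {x\<in>A. g (f u) (f x)} \<le> K"
        using K(2)[OF fB[OF uA]] card_bij_filter[OF f, of "g (f u)"] by (simp add: dg_def nb_def)
    qed (use AB K0 K(1) in \<open>auto simp: dg_def\<close>)
    have c5: "card B5 \<le> K" using K(1)[OF uA] by (simp add: B5_def dg_def)
    have "card (B1 \<union> B2 \<union> B3 \<union> B4 \<union> B5 \<union> {u}) \<le> card B1 + card B2 + card B3 + card B4 + card B5 + 1"
      by (rule order_trans[OF card_Un_le] add_mono order_refl | simp)+
    then have "real (card (B1 \<union> B2 \<union> B3 \<union> B4 \<union> B5 \<union> {u})) < card A"
      using c1 c2 c3 c4 c5 big by linarith
    then have "\<not> A \<subseteq> B1 \<union> B2 \<union> B3 \<union> B4 \<union> B5 \<union> {u}"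
      using card_mono[of "B1 \<union> B2 \<union> B3 \<union> B4 \<union> B5 \<union> {u}" A] AB
      by (auto simp: B1_def B2_def B3_def B4_def B5_def)
    then obtain w where wA: "w \<in> A" and wn: "w \<notin> B1" "w \<notin> B2" "w \<notin> B3" "w \<notin> B4" "w \<notin> B5" "w \<noteq> u" by auto
    have n1: "\<not> g u (f w)" using wn(1) wA by (simp add: B1_def)
    have n2: "\<not> g w (f u)" using wn(2) wA graphD[OF gr] by (auto simp: B2_def)
    have n3: "\<not> g (f w) (f x)" if "x \<in> A" "g u x" for x using wn(3) wA that graphD(1)[OF gr, of "f w" "f x"] by (auto simp: B3_def)
    have n4: "\<not> g (f u) (f x)" if "x \<in> A" "g w x" for x using wn(4) wA that graphD(1)[OF gr, of w x] by (auto simp: B4_def)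
    have n5: "\<not> g u w" "\<not> g w u" using wn(5) wA graphD[OF gr] by (auto simp: B5_def)
    define f' where "f' = f(u := f w, w := f u)"
    have b': "bij_betw f' A B"
    proof -
      have inj: "inj_on f' A" using finj uA wA by (auto simp: inj_on_def f'_def split: if_splits)
      have "f' ` A \<subseteq> B" using fB uA wA by (auto simp: f'_def)
      then have "f' ` A = B" using card_subset_eq[OF AB(2)] card_image[OF inj] AB(3) by simp
      then show ?thesis using inj by (simp add: bij_betw_def)
    qed
    \<comment> \<open>After the exchange no conflict begins at u or w and, by symmetry, none ends
      there. Every remaining conflict is an old one, and (u, v) has disappeared.\<close>
    have key: "x \<noteq> u \<and> x \<noteq> w" if "(x, y) \<in> C f'" for x y
      using that n1 n2 n3 n4 n5 wn(6) graphD(2)[OF gr] by (auto simp: C_def f'_def split: if_splits)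
    have sym: "(y, x) \<in> C f'" if "(x, y) \<in> C f'" for x y
      using that graphD[OF gr] by (auto simp: C_def)
    have "C f' \<subseteq> C f - {(u, v)}"
    proof
      fix p assume p: "p \<in> C f'"
      obtain x y where xy: "p = (x, y)" by force
      have "x \<noteq> u \<and> x \<noteq> w" "y \<noteq> u \<and> y \<noteq> w" using key sym p xy by blast+
      then show "p \<in> C f - {(u, v)}" using p xy by (auto simp: C_def f'_def)
    qed
    then have "card (C f') \<le> card (C f - {(u, v)})" by (intro card_mono) (simp_all add: fC)
    also have "\<dots> < card (C f)" using uv fC by (intro psubset_card_mono) auto
    finally show False using min[OF b'] by simp
  qed
  then show ?thesis unfolding pk_def C_def using f by (intro exI[of _ f]) auto
qed

text \<open>Markov's inequality for a nonnegative weight.\<close>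

lemma markov_card:
  assumes "finite X" "0 < t" "(\<Sum>x\<in>X. w x) \<le> s" "\<And>x. x \<in> X \<Longrightarrow> 0 \<le> w x" "Y \<subseteq> X" "\<And>x. x \<in> Y \<Longrightarrow> t \<le> w x"
  shows "real (card Y) \<le> s / (t :: real)"
proof -
  have "card Y * t = (\<Sum>x\<in>Y. t)" by simp
  also have "\<dots> \<le> (\<Sum>x\<in>Y. w x)" using assms(6) by (rule sum_mono)
  also have "\<dots> \<le> (\<Sum>x\<in>X. w x)" using assms by (intro sum_mono2) auto
  finally show ?thesis using assms by (simp add: field_simps)
qed

lemma load_sum:
  assumes gr: "graph g" and fin: "finite H" "finite X" and q: "\<And>y. y \<in> H \<Longrightarrow> 0 \<le> (q y :: real)"
    and s: "\<And>y. y \<in> H \<Longrightarrow> dg g X (u y) \<le> s" and Q: "(\<Sum>y\<in>H. q y) \<le> Q" "0 \<le> s"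
  shows "(\<Sum>x\<in>X. \<Sum>y\<in>{y\<in>H. g x (u y)}. q y) \<le> s * Q"
proof -
  have "(\<Sum>x\<in>X. \<Sum>y\<in>{y\<in>H. g x (u y)}. q y) = (\<Sum>y\<in>H. dg g X (u y) * q y)"
    by (rule sum_filter_double[OF gr fin])
  also have "\<dots> \<le> (\<Sum>y\<in>H. s * q y)" using s q by (intro sum_mono mult_right_mono) auto
  also have "\<dots> \<le> s * Q" using Q by (simp add: sum_distrib_left[symmetric] mult_left_mono)
  finally show ?thesis .
qed

text \<open>Greedy assignment of the vertices of \<open>H\<close> to candidates in \<open>G\<close>: a vertex \<open>x\<close> of \<open>X\<^sub>i\<close> is called
  saturated once the total weight assigned to its neighbours exceeds \<open>\<lambda>\<^sub>i\<close>; there are few saturated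
  vertices, and their neighbours are avoided from then on.\<close>

lemma greedy_assign:
  fixes q :: "'a \<Rightarrow> real" and t1 t2 s1 s2 s3 l1 l2 qm Q \<phi> \<psi> :: real
  assumes gr: "graph g" and fin: "finite H0" "finite G" "finite X1" "finite X2"
    and s: "\<And>u. u \<in> G \<Longrightarrow> dg g X1 u \<le> s1" "\<And>u. u \<in> G \<Longrightarrow> dg g X2 u \<le> s2" "\<And>u. u \<in> G \<Longrightarrow> dg g G u \<le> s3"
    and t: "\<And>x. x \<in> X1 \<Longrightarrow> dg g G x \<le> t1" "\<And>x. x \<in> X2 \<Longrightarrow> dg g G x \<le> t2"
    and F: "\<And>y. y \<in> H0 \<Longrightarrow> finite (F y)" "\<And>y. y \<in> H0 \<Longrightarrow> card (F y) \<le> \<phi>"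
    and psi: "\<And>y. y \<in> H0 \<Longrightarrow> dg g H0 y \<le> \<psi>"
    and q: "\<And>y. y \<in> H0 \<Longrightarrow> 0 \<le> q y" "\<And>y. y \<in> H0 \<Longrightarrow> q y \<le> qm" "(\<Sum>y\<in>H0. q y) \<le> Q"
    and pos: "0 < l1" "0 < l2" "0 \<le> s1" "0 \<le> s2" "0 \<le> s3" "0 \<le> t1" "0 \<le> t2" "0 \<le> qm"
    and big: "\<phi> + \<psi> * s3 + card H0 + s1 * Q / l1 * t1 + s2 * Q / l2 * t2 < card G"
  shows "\<exists>u. inj_on u H0 \<and> u ` H0 \<subseteq> G \<and> (\<forall>y\<in>H0. u y \<notin> F y) \<and> (\<forall>y\<in>H0. \<forall>y'\<in>H0. g y y' \<longrightarrow> \<not> g (u y) (u y'))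
     \<and> (\<forall>x\<in>X1. (\<Sum>y\<in>{y\<in>H0. g x (u y)}. q y) \<le> l1 + qm) \<and> (\<forall>x\<in>X2. (\<Sum>y\<in>{y\<in>H0. g x (u y)}. q y) \<le> l2 + qm)"
proof -
  let ?P = "\<lambda>H u. inj_on u H \<and> u ` H \<subseteq> G \<and> (\<forall>y\<in>H. u y \<notin> F y) \<and> (\<forall>y\<in>H. \<forall>y'\<in>H. g y y' \<longrightarrow> \<not> g (u y) (u y'))
     \<and> (\<forall>x\<in>X1. (\<Sum>y\<in>{y\<in>H. g x (u y)}. q y) \<le> l1 + qm) \<and> (\<forall>x\<in>X2. (\<Sum>y\<in>{y\<in>H. g x (u y)}. q y) \<le> l2 + qm)"
  have "\<exists>u. ?P H u" if "finite H" "H \<subseteq> H0" for H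
    using that
  proof (induction H rule: finite_induct)
    case empty
    then show ?case using pos by auto
  next
    case (insert y H)
    then obtain u where u: "?P H u" by auto
    have yH: "y \<in> H0" "H \<subseteq> H0" using insert by auto
    define ld where "ld x = (\<Sum>y\<in>{y\<in>H. g x (u y)}. q y)" for x
    define S1 where "S1 = {x\<in>X1. l1 < ld x}"
    define S2 where "S2 = {x\<in>X2. l2 < ld x}"
    have ld0: "0 \<le> ld x" for x unfolding ld_def using q(1) yH by (intro sum_nonneg) auto
    have QH: "(\<Sum>y\<in>H. q y) \<le> Q" using q yH fin(1) sum_mono2[of H0 H q] by fastforce
    have uG: "u y' \<in> G" if "y' \<in> H" for y' using u that by blast
    have "(\<Sum>x\<in>X1. ld x) \<le> s1 * Q" unfolding ld_def
      by (rule load_sum[OF gr insert(1) fin(3) _ _ QH pos(3)]) (use q(1) yH s(1) uG in auto)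
    then have c1: "card S1 \<le> s1 * Q / l1"
      by (intro markov_card[OF fin(3) pos(1)]) (use ld0 in \<open>auto simp: S1_def\<close>)
    have "(\<Sum>x\<in>X2. ld x) \<le> s2 * Q" unfolding ld_def
      by (rule load_sum[OF gr insert(1) fin(4) _ _ QH pos(4)]) (use q(1) yH s(2) uG in auto)
    then have c2: "card S2 \<le> s2 * Q / l2"
      by (intro markov_card[OF fin(4) pos(2)]) (use ld0 in \<open>auto simp: S2_def\<close>)
    \<comment> \<open>The next image avoids the neighbours of saturated vertices (\<open>N1\<close>,
      \<open>N2\<close>) and the neighbours of the images of those neighbours of y that are already
      assigned (\<open>N3\<close>).\<close>
    define N1 where "N1 = (\<Union>x\<in>S1. nb g G x)"
    define N2 where "N2 = (\<Union>x\<in>S2. nb g G x)"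
    define N3 where "N3 = (\<Union>y'\<in>nb g H y. nb g G (u y'))"
    have d1: "card N1 \<le> s1 * Q / l1 * t1" unfolding N1_def
      by (rule card_UN_le_mult) (use c1 pos t(1) fin in \<open>auto simp: S1_def dg_def\<close>)
    have d2: "card N2 \<le> s2 * Q / l2 * t2" unfolding N2_def
      by (rule card_UN_le_mult) (use c2 pos t(2) fin in \<open>auto simp: S2_def dg_def\<close>)
    have d3: "card N3 \<le> \<psi> * s3" unfolding N3_def
    proof (rule card_UN_le_mult)
      show "card (nb g H y) \<le> \<psi>"
        using psi[OF yH(1)] dg_mono[OF fin(1) yH(2), of g y] by (simp add: dg_def)
    qed (use insert(1) pos s(3) uG in \<open>auto simp: dg_def\<close>)
    have d4: "card (u ` H) \<le> card H0"
      using card_image_le[OF insert(1), of u] card_mono[OF fin(1) yH(2)] by linarith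
    have "card (F y \<union> N3 \<union> u ` H \<union> N1 \<union> N2) \<le> card (F y) + card N3 + card (u ` H) + card N1 + card N2"
      by (rule order_trans[OF card_Un_le] add_mono order_refl | simp)+
    then have "real (card (F y \<union> N3 \<union> u ` H \<union> N1 \<union> N2)) < card G"
      using d1 d2 d3 d4 F(2)[OF yH(1)] big by linarith
    moreover have "finite (F y \<union> N3 \<union> u ` H \<union> N1 \<union> N2)"
      using F(1)[OF yH(1)] insert(1) fin by (auto simp: N1_def N2_def N3_def S1_def S2_def)
    ultimately have "\<not> G \<subseteq> F y \<union> N3 \<union> u ` H \<union> N1 \<union> N2"
      using card_mono[of "F y \<union> N3 \<union> u ` H \<union> N1 \<union> N2" G] by auto
    then obtain w where w: "w \<in> G" "w \<notin> F y" "w \<notin> N3" "w \<notin> u ` H" "w \<notin> N1" "w \<notin> N2" by auto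
    define u' where "u' = u(y := w)"
    have u'H: "u' y' = u y'" if "y' \<in> H" for y' using that insert(2) by (auto simp: u'_def)
    have u'y: "u' y = w" by (simp add: u'_def)
    \<comment> \<open>Only neighbours of w gain, and at most \<open>qm\<close> each. They were not
      saturated, hence the extra \<open>qm\<close> in the claimed bounds.\<close>
    have ld': "(\<Sum>y'\<in>{y'\<in>insert y H. g x (u' y')}. q y') \<le> (if g x w then ld x + qm else ld x)" for x
    proof -
      have "{y'\<in>insert y H. g x (u' y')} = (if g x w then insert y {y'\<in>H. g x (u y')} else {y'\<in>H. g x (u y')})"
        using u'H u'y insert(2) by auto
      then show ?thesis using insert(1,2) q(2)[OF yH(1)] by (auto simp: ld_def)
    qed
    have L1: "(\<Sum>y'\<in>{y'\<in>insert y H. g x (u' y')}. q y') \<le> l1 + qm" if "x \<in> X1" for x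
    proof (cases "g x w")
      case True
      then have "x \<notin> S1" using w by (auto simp: N1_def)
      then have "ld x \<le> l1" using that by (auto simp: S1_def)
      then show ?thesis using ld'[of x] True by simp
    next
      case False
      have "ld x \<le> l1 + qm" using u that by (simp add: ld_def)
      then show ?thesis using ld'[of x] False by simp
    qed
    have L2: "(\<Sum>y'\<in>{y'\<in>insert y H. g x (u' y')}. q y') \<le> l2 + qm" if "x \<in> X2" for x
    proof (cases "g x w")
      case True
      then have "x \<notin> S2" using w by (auto simp: N2_def)
      then have "ld x \<le> l2" using that by (auto simp: S2_def)
      then show ?thesis using ld'[of x] True by simp
    next
      case False
      have "ld x \<le> l2 + qm" using u that by (simp add: ld_def)
      then show ?thesis using ld'[of x] False by simp
    qed
    have "inj_on u' (insert y H)"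
      using u w(4) insert(2) u'H u'y by (auto simp: inj_on_def image_iff)
    moreover have "u' ` insert y H \<subseteq> G" using u u'H u'y w(1) by auto
    moreover have "\<forall>y'\<in>insert y H. u' y' \<notin> F y'" using u u'H u'y w(2) by auto
    moreover have "\<not> g (u' a) (u' b)" if ab: "a \<in> insert y H" "b \<in> insert y H" "g a b" for a b
    proof -
      have N: "\<not> g (u c) w" if "c \<in> H" "g y c" for c using w(1,3) that by (auto simp: N3_def)
      consider "a = y" "b = y" | "a = y" "b \<in> H" | "a \<in> H" "b = y" | "a \<in> H" "b \<in> H" using ab by auto
      then show ?thesis
      proof cases
        case 1 then show ?thesis using ab graphD[OF gr] by auto
      next
        case 2 then show ?thesis using ab N u'H u'y graphD[OF gr] by metis
      next
        case 3 then show ?thesis using ab N u'H u'y graphD[OF gr] by metis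
      next
        case 4 then show ?thesis using ab u u'H by auto
      qed
    qed
    ultimately show ?case using L1 L2 by (intro exI[of _ u']) auto
  qed
  then show ?thesis using fin(1) by auto
qed

section \<open>Triples of small maximum degree\<close>

lemma dg_ge_card:
  assumes "finite S" "T \<subseteq> S" "\<And>y. y \<in> T \<Longrightarrow> g x y" shows "real (card T) \<le> dg g S x"
  unfolding dg_def using assms by (intro of_nat_mono card_mono) auto

lemma dg_empty [simp]: "dg g {} x = 0"
  by (simp add: dg_def nb_def)

text \<open>Inner degrees above 100 are removed first: \<open>H2\<close> receives preimages among
  light vertices of the sparser side A, then \<open>H1\<close> is placed in B, and the exchange
  argument handles the rest. The weights of the assignments are degrees of placed vertices, so a
  small load means few new cross edges at an unplaced vertex.\<close>

lemma low_degree_packs_aux: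
  fixes n :: real
  assumes gr: "graph g" and AB: "finite A" "finite B" "A \<inter> B = {}" "real (card A) = n" "real (card B) = n"
    and n: "139425 \<le> n"
    and dA: "\<And>x. x \<in> A \<Longrightarrow> dg g A x \<le> n/100" "\<And>x. x \<in> A \<Longrightarrow> dg g B x \<le> n/100"
    and dB: "\<And>x. x \<in> B \<Longrightarrow> dg g B x \<le> n/100" "\<And>x. x \<in> B \<Longrightarrow> dg g A x \<le> n/100"
    and e: "esum g A + esum g B \<le> 6 * n" "esum g A \<le> esum g B"
  shows "pk A B g"
proof -
  define a where "a = esum g A / n"
  define b where "b = esum g B / n"
  have n0: "0 < n" using n by simp
  have ea: "esum g A = a * n" "esum g B = b * n" using n0 by (auto simp: a_def b_def)
  have "(a + b) * n \<le> 6 * n" "a * n \<le> b * n" using e ea by (simp_all add: algebra_simps)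
  then have ab: "a + b \<le> 6" "a \<le> b" using n0 by simp_all
  have a0: "0 \<le> a" "0 \<le> b" using n0 by (auto simp: a_def b_def)
  have a3: "a \<le> 3" using ab by simp
  define H1 where "H1 = {x\<in>A. 100 < dg g A x}"
  define H2 where "H2 = {x\<in>B. 100 < dg g B x}"
  have H: "H1 \<subseteq> A" "H2 \<subseteq> B" "finite H1" "finite H2" using AB by (auto simp: H1_def H2_def)
  have cH1: "card H1 \<le> a * n / 100"
    by (rule markov_card[of A 100 "dg g A"]) (use AB ea in \<open>auto simp: H1_def esum_def\<close>)
  have cH2: "card H2 \<le> b * n / 100"
    by (rule markov_card[of B 100 "dg g B"]) (use AB ea in \<open>auto simp: H2_def esum_def\<close>)
  define wt where "wt V Z v = 2 * dg g Z v + dg g (V - Z) v" for V Z v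
  have wt0: "0 \<le> wt V Z v" for V Z v by (simp add: wt_def)
  \<comment> \<open>By Markov at most half of A exceeds 2a + 1 and at most a quarter of B exceeds 4b
    + 1. The threshold for B is looser because the bounds for the second assignment ask for more
    than half of B as candidates.\<close>
  define G1 where "G1 = {u\<in>A - H1. wt A H1 u \<le> 2 * a + 1}"
  define G2 where "G2 = {u\<in>B - H2. wt B H2 u \<le> 4 * b + 1}"
  have fG: "finite G1" "finite G2" using AB by (auto simp: G1_def G2_def)
  have "card {u\<in>A - H1. 2 * a + 1 < wt A H1 u} \<le> a * n / (2 * a + 1)"
    by (rule markov_card[of "A - H1" _ "wt A H1"])
      (use AB a0 wt0 weight_sum[OF gr AB(1) H(1)] in \<open>auto simp: ea wt_def\<close>)
  also have "\<dots> \<le> n / 2" using a0 n0 by (simp add: field_simps)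
  finally have bad1: "card {u\<in>A - H1. 2 * a + 1 < wt A H1 u} \<le> n / 2" .
  have "card {u\<in>B - H2. 4 * b + 1 < wt B H2 u} \<le> b * n / (4 * b + 1)"
    by (rule markov_card[of "B - H2" _ "wt B H2"])
      (use AB a0 wt0 weight_sum[OF gr AB(2) H(2)] in \<open>auto simp: ea wt_def\<close>)
  also have "\<dots> \<le> n / 4" using a0 n0 by (simp add: field_simps)
  finally have bad2: "card {u\<in>B - H2. 4 * b + 1 < wt B H2 u} \<le> n / 4" .
  have split: "real (card X) = card {u\<in>X. P u} + card {u\<in>X. \<not> P u}" if "finite X" for X :: "'a set" and P
  proof -
    have "X = {u\<in>X. P u} \<union> {u\<in>X. \<not> P u}" by auto
    then show ?thesis using card_Un_disjoint[of "{u\<in>X. P u}" "{u\<in>X. \<not> P u}"] that by fastforce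
  qed
  have cAH: "real (card (A - H1)) = n - card H1" "real (card (B - H2)) = n - card H2"
    using AB H card_mono[OF AB(1) H(1)] card_mono[OF AB(2) H(2)] by (simp_all add: card_Diff_subset of_nat_diff)
  have cG1: "n - card H1 - n/2 \<le> card G1"
    using split[of "A - H1" "\<lambda>u. wt A H1 u \<le> 2 * a + 1"] bad1 cAH AB(1) by (simp add: G1_def not_le)
  have cG2: "n - card H2 - n/4 \<le> card G2"
    using split[of "B - H2" "\<lambda>u. wt B H2 u \<le> 4 * b + 1"] bad2 cAH AB(2) by (simp add: G2_def not_le)
  have G1d: "dg g H1 u \<le> a + 1/2" "dg g (A - H1) u \<le> 2 * a + 1" "u \<in> A" "u \<notin> H1" if "u \<in> G1" for u
  proof -
    have "u \<in> A" "u \<notin> H1" and w: "2 * dg g H1 u + dg g (A - H1) u \<le> 2 * a + 1" using that by (auto simp: G1_def wt_def)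
    then show "u \<in> A" "u \<notin> H1" by auto
    show "dg g H1 u \<le> a + 1/2" "dg g (A - H1) u \<le> 2 * a + 1"
      using w dg_nonneg[of g H1 u] dg_nonneg[of g "A - H1" u] by linarith+
  qed
  have G2d: "dg g (B - H2) u \<le> 4 * b + 1" "u \<in> B" "u \<notin> H2" if "u \<in> G2" for u
  proof -
    have "u \<in> B" "u \<notin> H2" and w: "2 * dg g H2 u + dg g (B - H2) u \<le> 4 * b + 1" using that by (auto simp: G2_def wt_def)
    then show "u \<in> B" "u \<notin> H2" by auto
    show "dg g (B - H2) u \<le> 4 * b + 1"
      using w dg_nonneg[of g H2 u] dg_nonneg[of g "B - H2" u] by linarith
  qed
  have Q1: "(\<Sum>y\<in>H2. dg g (B - H2) y) \<le> b * n / 2"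
    using esum_split[OF gr AB(2) H(2)] esum_nonneg[of g "B - H2"] esum_nonneg[of g H2] ea by linarith
  have Q2: "(\<Sum>y\<in>H1. dg g (A - H1) y) \<le> a * n / 2"
    using esum_split[OF gr AB(1) H(1)] esum_nonneg[of g "A - H1"] esum_nonneg[of g H1] ea by linarith
  have G1A: "G1 \<subseteq> A - H1" and G2B: "G2 \<subseteq> B - H2" by (auto simp: G1_def G2_def)
  have cH12: "card H1 + card H2 \<le> 6/100 * n"
  proof -
    have "(a + b) * n \<le> 6 * n" using ab(1) n0 by simp
    then show ?thesis using cH1 cH2 by (simp add: field_simps)
  qed
  have "\<exists>u. inj_on u H2 \<and> u ` H2 \<subseteq> G1 \<and> (\<forall>y\<in>H2. u y \<notin> nb g A y) \<and>
      (\<forall>y\<in>H2. \<forall>y'\<in>H2. g y y' \<longrightarrow> \<not> g (u y) (u y')) \<and>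
      (\<forall>x\<in>H1. (\<Sum>y\<in>{y\<in>H2. g x (u y)}. dg g (B - H2) y) \<le> n/5 + n/100) \<and>
      (\<forall>x\<in>A - H1. (\<Sum>y\<in>{y\<in>H2. g x (u y)}. dg g (B - H2) y) \<le> n/5 + n/100)"
  proof (rule greedy_assign[where ?s1.0 = "a + 1/2" and ?s2.0 = "2*a+1" and ?s3.0 = "2*a+1" and ?t1.0 = "n/100" and ?t2.0 = 100
        and \<phi> = "n/100" and \<psi> = "n/100" and Q = "b*n/2" and ?l1.0 = "n/5" and ?l2.0 = "n/5"])
    show "dg g G1 u \<le> 2 * a + 1" if "u \<in> G1" for u
      using G1d(2)[OF that] dg_mono[OF _ G1A, of g u] AB by force
    show "dg g G1 x \<le> n/100" if "x \<in> H1" for x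
      using dA(1)[of x] that H dg_mono[of A G1 g x] G1A AB by force
    show "dg g G1 x \<le> 100" if "x \<in> A - H1" for x
      using that dg_mono[of A G1 g x] G1A AB by (force simp: H1_def)
    show "real (card (nb g A y)) \<le> n/100" if "y \<in> H2" for y
      using dB(2)[of y] that H by (auto simp: dg_def)
    show "dg g H2 y \<le> n/100" if "y \<in> H2" for y
      using dB(1)[of y] that H dg_mono[OF AB(2) H(2), of g y] by force
    show "dg g (B - H2) y \<le> n/100" if "y \<in> H2" for y
      using dB(1)[of y] that H dg_mono[OF AB(2), of "B - H2" g y] by force
    show "n/100 + n/100 * (2*a+1) + card H2 + (a+1/2) * (b*n/2) / (n/5) * (n/100) + (2*a+1) * (b*n/2) / (n/5) * 100 < card G1"
    proof -
      \<comment> \<open>The parabola (a + 1/2)(6 - a) has its maximum 169/16 at a = 11/4, just below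
        10.57.\<close>
      have "(a + 1/2) * b \<le> (a + 1/2) * (6 - a)" using ab a0 by (intro mult_left_mono) auto
      also have "\<dots> \<le> (1057/100)" using sum_squares_ge_zero[of "a - 11/4" 0] by (simp add: algebra_simps power2_eq_square)
      finally have 1: "(a + 1/2) * b \<le> (1057/100)" .
      have aux: "p * 500 \<le> 5285" if "p \<le> (1057/100)" for p :: real using that by simp
      have "(a+1/2) * (b*n/2) / (n/5) * (n/100) = ((a+1/2)*b) * (n/40)" using n0 by (simp add: field_simps)
      then have 2: "(a+1/2) * (b*n/2) / (n/5) * (n/100) \<le> (1057/100) * (n/40)" using 1 n0 by (metis mult_right_mono divide_nonneg_pos less_eq_real_def zero_less_numeral)
      have e3: "(2*a+1) * (b*n/2) / (n/5) * 100 = ((a+1/2)*b) * 500" using n0 by (simp add: field_simps)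
      have 3: "(2*a+1) * (b*n/2) / (n/5) * 100 \<le> 5285" unfolding e3 by (rule aux[OF 1])
      have 4: "n/100 * (2*a+1) \<le> n/100 * 7" using a3 n0 by simp
      have fin: "n/100 + q + c2 + r + s < k" if "q \<le> n/100 * 7" "r \<le> (1057/100) * (n/40)" "s \<le> 5285"
        "n - c1 - n/2 \<le> k" "c1 + c2 \<le> 6/100 * n" for q r s k c1 c2 :: real using that n by linarith
      show ?thesis by (rule fin[OF 4 2 3 cG1 cH12[unfolded of_nat_add]])
    qed
  qed (use gr AB H fG G1d(1,2) Q1 a0 n0 in auto)
  then obtain u where u: "inj_on u H2" "u ` H2 \<subseteq> G1" "\<forall>y\<in>H2. u y \<notin> nb g A y"
    "\<forall>y\<in>H2. \<forall>y'\<in>H2. g y y' \<longrightarrow> \<not> g (u y) (u y')"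
    "\<forall>x\<in>H1. (\<Sum>y\<in>{y\<in>H2. g x (u y)}. dg g (B - H2) y) \<le> n/5 + n/100"
    "\<forall>x\<in>A - H1. (\<Sum>y\<in>{y\<in>H2. g x (u y)}. dg g (B - H2) y) \<le> n/5 + n/100" by blast
  \<comment> \<open>If c is adjacent to the preimage \<open>u y\<close>, then \<open>w c\<close>
    must not be adjacent to y. The load bound on \<open>H1\<close> from the first assignment keeps
    this part of the list below n/5 + n/100.\<close>
  define F where "F c = nb g B c \<union> (\<Union>y\<in>{y\<in>H2. g c (u y)}. nb g (B - H2) y)" for c
  have "\<exists>w. inj_on w H1 \<and> w ` H1 \<subseteq> G2 \<and> (\<forall>c\<in>H1. w c \<notin> F c) \<and>
      (\<forall>y\<in>H1. \<forall>y'\<in>H1. g y y' \<longrightarrow> \<not> g (w y) (w y')) \<and>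
      (\<forall>x\<in>{}. (\<Sum>y\<in>{y\<in>H1. g x (w y)}. dg g (A - H1) y) \<le> 1 + n/100) \<and>
      (\<forall>x\<in>B - H2. (\<Sum>y\<in>{y\<in>H1. g x (w y)}. dg g (A - H1) y) \<le> n/5 + n/100)"
  proof (rule greedy_assign[where ?s1.0 = 0 and ?s2.0 = "4*b+1" and ?s3.0 = "4*b+1" and ?t1.0 = 0 and ?t2.0 = 100
        and \<phi> = "22*n/100" and \<psi> = "n/100" and Q = "a*n/2" and ?l1.0 = "1" and ?l2.0 = "n/5"])
    show "dg g G2 u \<le> 4 * b + 1" if "u \<in> G2" for u
      using G2d(1)[OF that] dg_mono[OF _ G2B, of g u] AB by force
    show "dg g G2 x \<le> 100" if "x \<in> B - H2" for x
      using that dg_mono[of B G2 g x] G2B AB by (force simp: H2_def)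
    show "finite (F y)" for y using AB H by (auto simp: F_def)
    show "real (card (F c)) \<le> 22*n/100" if "c \<in> H1" for c
    proof -
      have "card (F c) \<le> card (nb g B c) + card (\<Union>y\<in>{y\<in>H2. g c (u y)}. nb g (B - H2) y)"
        unfolding F_def by (rule card_Un_le)
      moreover have "card (nb g B c) \<le> n/100" using dA(2)[of c] that H by (auto simp: dg_def)
      moreover have "card (\<Union>y\<in>{y\<in>H2. g c (u y)}. nb g (B - H2) y) \<le> n/5 + n/100"
        using card_UN_filter_le[OF H(4), of "\<lambda>y. nb g (B - H2) y" "\<lambda>y. g c (u y)"] u(5) that AB
        by (auto simp: dg_def)
      ultimately show ?thesis by linarith
    qed
    show "dg g H1 y \<le> n/100" if "y \<in> H1" for y
      using dA(1)[of y] that H dg_mono[OF AB(1) H(1), of g y] by force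
    show "dg g (A - H1) y \<le> n/100" if "y \<in> H1" for y
      using dA(1)[of y] that H dg_mono[OF AB(1), of "A - H1" g y] by force
    show "22*n/100 + n/100 * (4*b+1) + card H1 + 0 * (a*n/2) / 1 * 0 + (4*b+1) * (a*n/2) / (n/5) * 100 < card G2"
    proof -
      \<comment> \<open>25a - 4a^2 peaks at 625/16 < 40, for a = 25/8.\<close>
      have "(4 * b + 1) * a \<le> (4 * (6 - a) + 1) * a" using ab a0 by (intro mult_right_mono) auto
      also have "\<dots> \<le> 40" using sum_squares_ge_zero[of "2 * a - 25/4" 0] by (simp add: algebra_simps power2_eq_square)
      finally have 1: "(4 * b + 1) * a \<le> 40" .
      have aux: "p * 250 \<le> 10000" if "p \<le> 40" for p :: real using that by simp
      have e3: "(4*b+1) * (a*n/2) / (n/5) * 100 = ((4*b+1)*a) * 250" using n0 by (simp add: field_simps)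
      have 2: "(4*b+1) * (a*n/2) / (n/5) * 100 \<le> 10000" unfolding e3 by (rule aux[OF 1])
      have "b \<le> 6" using ab a0 by simp
      then have 4: "n/100 * (4*b+1) \<le> n/100 * 25" using n0 by simp
      have fin: "22*n/100 + q + c1 + 0 + s < k" if "q \<le> n/100 * 25" "s \<le> 10000"
        "n - c2 - n/4 \<le> k" "c1 + c2 \<le> 6/100 * n" "0 \<le> c2" for q s k c1 c2 :: real using that n by linarith
      show ?thesis using fin[OF 4 2 cG2 cH12[unfolded of_nat_add]] by simp
    qed
  qed (use gr AB H fG G2d(1) Q2 a0 n0 in auto)
  then obtain w where w: "inj_on w H1" "w ` H1 \<subseteq> G2" "\<forall>c\<in>H1. w c \<notin> F c"
    "\<forall>y\<in>H1. \<forall>y'\<in>H1. g y y' \<longrightarrow> \<not> g (w y) (w y')"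
    "\<forall>x\<in>B - H2. (\<Sum>y\<in>{y\<in>H1. g x (w y)}. dg g (A - H1) y) \<le> n/5 + n/100" by blast
  define S where "S = H1 \<union> u ` H2"
  define h where "h x = (if x \<in> H1 then w x else inv_into H2 u x)" for x
  have hH1: "h c = w c" if "c \<in> H1" for c using that by (simp add: h_def)
  have uH1: "u y \<notin> H1" "u y \<in> A" "u y \<in> G1" if "y \<in> H2" for y using u(2) that G1d by auto
  have hu: "h (u y) = y" if "y \<in> H2" for y using that uH1 u(1) by (simp add: h_def)
  have wB: "w c \<in> B" "w c \<notin> H2" "w c \<in> G2" if "c \<in> H1" for c using w(2) that G2d by auto
  have hS: "h ` S = w ` H1 \<union> H2" unfolding S_def image_Un using hH1 hu by (auto simp: image_image)
  have uA: "\<not> g (u y) y" if "y \<in> H2" for y using u(3) uH1 that graphD[OF gr] by auto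
  have wF: "\<not> g c (w c)" if "c \<in> H1" for c using w(3) wB that by (auto simp: F_def)
  have cu: "\<not> g (w c) y" if "c \<in> H1" "y \<in> H2" "g c (u y)" for c y
    using w(3) wB[OF that(1)] that graph_sym[OF gr] by (auto simp: F_def)
  have val: "valid A B g S h"
    unfolding valid_def
  proof (intro conjI ballI impI)
    show "finite S" using H by (simp add: S_def)
    show "S \<subseteq> A" using H uH1 by (auto simp: S_def)
    show "h ` S \<subseteq> B" unfolding hS using wB H by auto
    show "inj_on h S"
    proof (rule inj_on_inverseI[where g = "\<lambda>z. if z \<in> H2 then u z else inv_into H1 w z"])
      fix x assume "x \<in> S"
      then consider "x \<in> H1" | y where "y \<in> H2" "x = u y" by (auto simp: S_def)
      then show "(if h x \<in> H2 then u (h x) else inv_into H1 w (h x)) = x"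
        by cases (use hH1 hu wB w(1) in auto)
    qed
    show "\<not> g x (h x)" if "x \<in> S" for x
    proof -
      consider "x \<in> H1" | y where "y \<in> H2" "x = u y" using \<open>x \<in> S\<close> by (auto simp: S_def)
      then show ?thesis by cases (use uA wF hH1 hu in auto)
    qed
    show "\<not> g (h x) (h y)" if xy: "x \<in> S" "y \<in> S" "g x y" for x y
    proof -
      consider "x \<in> H1" "y \<in> H1" | y' where "x \<in> H1" "y = u y'" "y' \<in> H2"
        | x' where "y \<in> H1" "x = u x'" "x' \<in> H2" | x' y' where "x = u x'" "x' \<in> H2" "y = u y'" "y' \<in> H2"
        using xy(1,2) by (auto simp: S_def)
      then show ?thesis
      proof cases
        case 1 then show ?thesis using w(4) hH1 that by auto
      next
        case 2 then show ?thesis using cu hH1 hu that by auto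
      next
        case 3 then show ?thesis using cu hH1 hu that graphD(1)[OF gr] by metis
      next
        case 4 then show ?thesis using u(4) hu that graphD(1)[OF gr] by metis
      qed
    qed
  qed
  let ?A = "A - S" and ?B = "B - h ` S" and ?g = "lifted A B g S h"
  have fS: "finite S" using val by (simp add: valid_def)
  have BH: "?B \<subseteq> B - H2" "?A \<subseteq> A - H1" unfolding hS by (auto simp: S_def)
  have cS: "card S = card H1 + card H2"
    unfolding S_def using card_Un_disjoint[of H1 "u ` H2"] H uH1 card_image[OF u(1)] by auto
  have cardA': "real (card ?A) = n - card H1 - card H2"
    using val cS AB card_mono[of A S] by (simp add: valid_def card_Diff_subset of_nat_diff)
  have cardB': "card ?A = card ?B"
    using val AB by (simp add: valid_def card_Diff_subset card_image)
  have sumS: "(\<Sum>x\<in>{x\<in>S. P x}. f x) = (\<Sum>c\<in>{c\<in>H1. P c}. f c) + (\<Sum>y\<in>{y\<in>H2. P (u y)}. f (u y))" for P and f :: "'a \<Rightarrow> real"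
  proof -
    have "{x\<in>S. P x} = {c\<in>H1. P c} \<union> u ` {y\<in>H2. P (u y)}" by (auto simp: S_def)
    moreover have "{c\<in>H1. P c} \<inter> u ` {y\<in>H2. P (u y)} = {}" using uH1 by auto
    moreover have "inj_on u {y\<in>H2. P (u y)}" using u(1) by (auto simp: inj_on_def)
    ultimately show ?thesis using H by (simp add: sum.union_disjoint sum.reindex)
  qed
  have small: "(\<Sum>c\<in>{c\<in>H. g x c}. f c) \<le> 100 * k"
    if "finite X" "H \<subseteq> X" "dg g X x \<le> 100" "\<And>c. c \<in> H \<Longrightarrow> f c \<le> k" "0 \<le> k" for H X x and f :: "'a \<Rightarrow> real" and k
  proof -
    have "(\<Sum>c\<in>{c\<in>H. g x c}. f c) \<le> (\<Sum>c\<in>{c\<in>H. g x c}. k)" by (rule sum_mono) (simp add: that(4))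
    also have "\<dots> = card {c\<in>H. g x c} * k" by simp
    also have "\<dots> \<le> 100 * k"
    proof (rule mult_right_mono)
      have "{c\<in>H. g x c} \<subseteq> X" using that(2) by blast
      then have "real (card {c\<in>H. g x c}) \<le> dg g X x" by (rule dg_ge_card[OF that(1)]) simp
      then show "real (card {c\<in>H. g x c}) \<le> 100" using that(3) by linarith
    qed (rule that(5))
    finally show ?thesis .
  qed
  have "pk ?A ?B ?g"
  \<comment> \<open>An unplaced vertex has at most 100 neighbours on its own side. Partners of
    vertices of \<open>H1\<close> have degree at most 4b + 1 \<le> 25 and partners of vertices of
    \<open>H2\<close> at most 2a + 1 \<le> 7, which gives 2500 and 700.\<close>
  proof (rule sauer_spencer_list[where K = 100 and L = "n/100 + 2500 + (n/5+n/100)" and L' = "n/100 + (n/5+n/100) + 700"])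
    show "graph ?g" using graph_lifted[OF gr AB(3)] .
    show "dg ?g ?A x \<le> 100" if x: "x \<in> ?A" for x
      using lifted_dg_same(1)[OF AB(3) x] dg_mono[OF AB(1), of ?A g x] x by (auto simp: S_def H1_def)
    show "dg ?g ?B x \<le> 100" if x: "x \<in> ?B" for x
      using lifted_dg_same(2)[OF AB(3) x, of g] dg_mono[OF AB(2), of ?B g x] x by (auto simp: hS H2_def)
    show "dg ?g ?B x \<le> n/100 + 2500 + (n/5+n/100)" if x: "x \<in> ?A" for x
    proof -
      have xH: "x \<in> A - H1" using x by (auto simp: S_def)
      have 1: "dg g ?B x \<le> n/100" using dA(2)[of x] x dg_mono[OF AB(2), of ?B g x] by force
      have 2: "(\<Sum>c\<in>{c\<in>H1. g x c}. dg g ?B (h c)) \<le> 100 * 25"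
      proof (rule small[OF AB(1) H(1)])
        show "dg g A x \<le> 100" using xH by (auto simp: H1_def)
        show "dg g ?B (h c) \<le> 25" if "c \<in> H1" for c
          using G2d(1)[OF wB(3)[OF that]] dg_mono[OF _ BH(1), of g "w c"] AB hH1[OF that] ab a0 by force
      qed simp
      have 3: "(\<Sum>y\<in>{y\<in>H2. g x (u y)}. dg g ?B (h (u y))) \<le> n/5 + n/100"
      proof -
        have "(\<Sum>y\<in>{y\<in>H2. g x (u y)}. dg g ?B (h (u y))) \<le> (\<Sum>y\<in>{y\<in>H2. g x (u y)}. dg g (B - H2) y)"
          using hu dg_mono[OF _ BH(1)] AB by (intro sum_mono) auto
        then show ?thesis using bspec[OF u(6) xH] by linarith
      qed
      show ?thesis
        using lifted_dg_cross_A[OF gr AB(3,2) fS x, of h] 1 2 3 sumS[where P = "g x" and f = "\<lambda>a. dg g ?B (h a)"] by linarith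
    qed
    show "dg ?g ?A x \<le> n/100 + (n/5+n/100) + 700" if x: "x \<in> ?B" for x
    proof -
      have xH: "x \<in> B - H2" using x by (auto simp: hS)
      have 1: "dg g ?A x \<le> n/100" using dB(2)[of x] x dg_mono[OF AB(1), of ?A g x] by force
      have 2: "(\<Sum>y\<in>{y\<in>H2. g x y}. dg g ?A (u y)) \<le> 100 * 7"
      proof (rule small[OF AB(2) H(2)])
        show "dg g B x \<le> 100" using xH by (auto simp: H2_def)
        show "dg g ?A (u y) \<le> 7" if "y \<in> H2" for y
          using G1d(2)[OF uH1(3)[OF that]] dg_mono[OF _ BH(2), of g "u y"] AB a3 by force
      qed simp
      have 3: "(\<Sum>c\<in>{c\<in>H1. g x (h c)}. dg g ?A c) \<le> n/5 + n/100"
      proof -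
        have "(\<Sum>c\<in>{c\<in>H1. g x (h c)}. dg g ?A c) = (\<Sum>c\<in>{c\<in>H1. g x (w c)}. dg g ?A c)"
          using hH1 by (intro sum.cong) auto
        also have "\<dots> \<le> (\<Sum>c\<in>{c\<in>H1. g x (w c)}. dg g (A - H1) c)"
          using dg_mono[OF _ BH(2)] AB by (intro sum_mono) auto
        finally show ?thesis using bspec[OF w(5) xH] by linarith
      qed
      have 4: "(\<Sum>y\<in>{y\<in>H2. g x (h (u y))}. dg g ?A (u y)) = (\<Sum>y\<in>{y\<in>H2. g x y}. dg g ?A (u y))"
        using hu by (intro sum.cong) auto
      show ?thesis
        using lifted_dg_cross_B[OF gr AB(3,1) fS x] 1 2 3 4 sumS[where P = "\<lambda>a. g x (h a)" and f = "\<lambda>a. dg g ?A a"] by linarith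
    qed
    show "2 * 100 * 100 + 100 + 1 + (n/100 + 2500 + (n/5+n/100)) + (n/100 + (n/5+n/100) + 700) < real (card ?A)"
      using cardA' cH12 n by linarith
  qed (use AB cardB' in auto)
  then show ?thesis by (rule pk_extend[OF gr val])
qed

lemma low_degree_packs:
  fixes n :: real
  assumes gr: "graph g" and AB: "finite A" "finite B" "A \<inter> B = {}" "real (card A) = n" "real (card B) = n"
    and n: "139425 \<le> n"
    and d: "\<And>x. x \<in> A \<union> B \<Longrightarrow> dg g (A \<union> B) x \<le> n/100" and e: "esum g (A \<union> B) \<le> 6 * n"
  shows "pk A B g"
proof -
  have d': "dg g A x \<le> n/100" "dg g B x \<le> n/100" if "x \<in> A \<union> B" for x
    using d[OF that] dg_Un[OF AB(1,2,3), of g x] dg_nonneg[of g A x] dg_nonneg[of g B x] by linarith+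
  have "A \<union> B - B = A" using AB by blast
  then have "esum g A + esum g B \<le> esum g (A \<union> B)"
    using esum_split[OF gr, of "A \<union> B" B] AB by (simp add: sum_nonneg)
  then have s: "esum g A + esum g B \<le> 6 * n" using e by simp
  show ?thesis
  proof (cases "esum g A \<le> esum g B")
    case True
    show ?thesis by (rule low_degree_packs_aux[OF gr AB n]) (use d' s True in auto)
  next
    case False
    have "pk B A g" by (rule low_degree_packs_aux[OF gr AB(2,1) _ AB(5,4) n]) (use d' s False AB in auto)
    then show ?thesis by (rule pk_swap[OF gr])
  qed
qed

section \<open>Minimal counterexamples\<close>

definition pk_forced :: "'a set \<Rightarrow> 'a set \<Rightarrow> ('a \<Rightarrow> 'a \<Rightarrow> bool) \<Rightarrow> 'a \<Rightarrow> 'a \<Rightarrow> bool" where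
  "pk_forced A B g u v \<longleftrightarrow> (\<exists>f. bij_betw f A B \<and> f u = v \<and> (\<forall>x\<in>A. \<not> g x (f x)) \<and>
     (\<forall>x\<in>A. \<forall>y\<in>A. g x y \<longrightarrow> \<not> g (f x) (f y)))"

lemma pk_forced_swap:
  assumes "graph g" "pk_forced A B g u v" "u \<in> A" shows "pk_forced B A g v u"
proof -
  obtain f where f: "bij_betw f A B" "\<forall>x\<in>A. \<not> g x (f x)" "f u = v"
    "\<forall>x\<in>A. \<forall>y\<in>A. g x y \<longrightarrow> \<not> g (f x) (f y)"
    using assms(2) unfolding pk_forced_def by blast
  let ?h = "inv_into A f"
  have h: "bij_betw ?h B A" using f(1) by (rule bij_betw_inv_into)
  have fh: "f (?h z) = z" "?h z \<in> A" if "z \<in> B" for z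
    using that f(1) h by (auto simp: bij_betw_inv_into_right bij_betwE)
  have "?h v = u" using f(1,3) assms(3) by (auto simp: bij_betw_def)
  then show ?thesis unfolding pk_forced_def
    by (intro exI[of _ ?h]) (use h f fh graph_sym[OF assms(1)] in metis)
qed

lemma pk_forced_pk: "pk_forced A B g u v \<Longrightarrow> pk A B g"
  unfolding pk_forced_def pk_def by blast

lemma esum_remove:
  assumes "graph g" "finite S" "q \<in> S"
  shows "esum g S = esum g (S - {q}) + 2 * dg g S q"
proof -
  have z: "dg g {q} q = 0" using graphD(2)[OF assms(1)] by (simp add: dg_zero_iff)
  then have "esum g {q} = 0" by (simp add: esum_def)
  moreover have "dg g S q = dg g (S - {q}) q" using dg_Diff[OF assms(2), of "{q}" g q] assms z by simp
  ultimately show ?thesis using esum_split[OF assms(1,2), of "{q}"] assms(3) by simp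
qed

lemma esum_Un:
  assumes "graph g" "finite A" "finite B" "A \<inter> B = {}"
  shows "esum g (A \<union> B) = esum g A + esum g B + 2 * (\<Sum>x\<in>A. dg g B x)"
proof -
  have "A \<union> B - A = B" using assms by blast
  then show ?thesis using esum_split[OF assms(1), of "A \<union> B" A] assms by simp
qed

lemma dg_pos_ge_1: "dg g S x \<noteq> 0 \<Longrightarrow> 1 \<le> dg g S x"
  by (cases "card (nb g S x)") (auto simp: dg_def)

lemma exists_not_adjacent:
  assumes "finite S" "dg g S x < card S" shows "\<exists>y\<in>S. \<not> g x y"
proof (rule ccontr)
  assume "\<not> (\<exists>y\<in>S. \<not> g x y)"
  then have "nb g S x = S" by auto
  then show False using assms by (simp add: dg_def)
qed

text \<open>Induction: a vertex isolated on the sparser side is matched with a vertex of the other side such that the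
  pair meets an edge.\<close>

lemma sparse_forced:
  assumes "graph g" "finite A" "finite B" "A \<inter> B = {}" "card A = n" "card B = n" "u \<in> A" "v \<in> B" "\<not> g u v"
    "esum g A + esum g B + 2 * (\<Sum>x\<in>A - {u}. dg g (B - {v}) x) \<le> 2 * (real n - 2)"
  shows "pk_forced A B g u v"
  using assms(2-)
proof (induction n arbitrary: A B u v rule: less_induct)
  case (less n)
  note gr = assms(1)
  \<comment> \<open>Cross edges at u or v stay out of the count, as these two are matched with each
    other. Each further matched pair lowers the right-hand side by 2, so it has to destroy an
    edge.\<close>
  have step: "pk_forced A B g u v"
    if P: "finite A" "finite B" "A \<inter> B = {}" "card A = n" "card B = n" "u \<in> A" "v \<in> B" "\<not> g u v"
      "esum g A + esum g B + 2 * (\<Sum>x\<in>A - {u}. dg g (B - {v}) x) \<le> 2 * (real n - 2)"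
      and le: "esum g A \<le> esum g B" for A B u v
  proof -
    let ?c = "\<Sum>x\<in>A - {u}. dg g (B - {v}) x"
    have c0: "0 \<le> ?c" by (simp add: sum_nonneg)
    have "2 \<le> real n" using P(9) c0 esum_nonneg[of g A] esum_nonneg[of g B] by argo
    then have n2: "2 \<le> n" by simp
    \<comment> \<open>The sparser side has degree sum at most n - 2, so at least two vertices are
      isolated in A, and one of them differs from u.\<close>
    have "card {x\<in>A. 1 \<le> dg g A x} \<le> (real n - 2) / 1"
      by (rule markov_card[OF P(1), of 1 "dg g A"]) (use P(9) c0 le in \<open>auto simp: esum_def\<close>)
    then have "real (card {x\<in>A. 1 \<le> dg g A x} + 2) \<le> real n" using n2 by simp
    then have "card {x\<in>A. 1 \<le> dg g A x} + 2 \<le> n" by (simp only: of_nat_le_iff)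
    moreover have "card A \<le> card {x\<in>A. 1 \<le> dg g A x} + card {u} + card {x\<in>A. dg g A x = 0 \<and> x \<noteq> u}"
    proof -
      have "A \<subseteq> {x\<in>A. 1 \<le> dg g A x} \<union> {u} \<union> {x\<in>A. dg g A x = 0 \<and> x \<noteq> u}"
        using dg_pos_ge_1[of g A] by auto
      then have "card A \<le> card ({x\<in>A. 1 \<le> dg g A x} \<union> {u} \<union> {x\<in>A. dg g A x = 0 \<and> x \<noteq> u})"
        using P(1) by (intro card_mono) auto
      then show ?thesis by (meson card_Un_le order_trans add_le_mono order_refl)
    qed
    ultimately have "card {x\<in>A. dg g A x = 0 \<and> x \<noteq> u} \<noteq> 0" using P(4) by simp
    then obtain p where p: "p \<in> A" "dg g A p = 0" "p \<noteq> u" by (auto simp: card_eq_0_iff)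
    have pn: "\<not> g p x" "\<not> g x p" if "x \<in> A" for x
      using p(2) P(1) that dg_zero_iff[of A g p] graphD[OF gr] by auto
    have csplit: "?c = dg g (B - {v}) p + (\<Sum>x\<in>A - {u} - {p}. dg g (B - {v}) x)"
      using p P(1) by (subst sum.remove[of _ p]) auto
    show ?thesis
    proof (cases "\<exists>q\<in>B - {v}. \<not> g p q \<and> 1 \<le> dg g B q + dg g (A - {u}) q + dg g (B - {v}) p")
      case True
      then obtain q where q: "q \<in> B" "q \<noteq> v" "\<not> g p q" "1 \<le> dg g B q + dg g (A - {u}) q + dg g (B - {v}) p" by auto
      have "(\<Sum>x\<in>A - {u} - {p}. dg g (B - {v}) x) = (\<Sum>x\<in>A - {u} - {p}. dg g (B - {v} - {q}) x + dg g {q} x)"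
        using P(2) q by (intro sum.cong refl dg_Diff) auto
      also have "\<dots> = (\<Sum>x\<in>A - {u} - {p}. dg g (B - {v} - {q}) x) + dg g (A - {u} - {p}) q"
        using dg_double_count[OF gr, of "A - {u} - {p}" "{q}"] P(1) by (simp add: sum.distrib)
      finally have c2: "?c = dg g (B - {v}) p + (\<Sum>x\<in>A - {u} - {p}. dg g (B - {v} - {q}) x) + dg g (A - {u} - {p}) q"
        using csplit by simp
      have "nb g {p} q = {}" using q(3) graphD(1)[OF gr] by auto
      then have "dg g (A - {u}) q = dg g (A - {u} - {p}) q"
        using dg_Diff[of "A - {u}" "{p}" g q] P(1) p by (simp add: dg_def)
      moreover have "A - {p} - {u} = A - {u} - {p}" "B - {q} - {v} = B - {v} - {q}" by auto
      moreover have "esum g A = esum g (A - {p}) + 2 * dg g A p" using esum_remove[OF gr P(1) p(1)] .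
      moreover have "esum g B = esum g (B - {q}) + 2 * dg g B q" using esum_remove[OF gr P(2) q(1)] .
      ultimately have "esum g (A - {p}) + esum g (B - {q}) + 2 * (\<Sum>x\<in>A - {p} - {u}. dg g (B - {q} - {v}) x) \<le> 2 * (real (n - 1) - 2)"
        using P(9) c2 q(4) p(2) n2 by (simp add: of_nat_diff)
      then have "pk_forced (A - {p}) (B - {q}) g u v"
        using less.IH[of "n - 1" "A - {p}" "B - {q}" u v] P n2 p q by auto
      then obtain f where f: "bij_betw f (A - {p}) (B - {q})" "f u = v" "\<forall>x\<in>A - {p}. \<not> g x (f x)"
        "\<forall>x\<in>A - {p}. \<forall>y\<in>A - {p}. g x y \<longrightarrow> \<not> g (f x) (f y)" unfolding pk_forced_def by blast
      have "bij_betw (f(p := q)) (insert p (A - {p})) (insert q (B - {q}))"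
        using bij_betw_combine[of "f(p := q)" "A - {p}" "B - {q}" "{p}" "{q}"] f(1)
          bij_betw_cong[of "A - {p}" f "f(p := q)" "B - {q}"] by (simp add: bij_betw_def)
      then have "bij_betw (f(p := q)) A B" using p(1) q(1) by (simp add: insert_absorb)
      then show ?thesis unfolding pk_forced_def using f p q pn by (intro exI[of _ "f(p := q)"]) auto
    next
      case False
      \<comment> \<open>When p has no useful partner, every vertex of B other than v turns out to be
        isolated in B and without cross neighbours except possibly u. Then any bijection sending u
        to v works.\<close>
      have "dg g (B - {v}) p \<le> ?c" using csplit by (simp add: sum_nonneg)
      also have "\<dots> < real n - 1" using P(9) esum_nonneg[of g A] esum_nonneg[of g B] by argo
      finally have "\<exists>q\<in>B - {v}. \<not> g p q"
        using P n2 by (intro exists_not_adjacent) (auto simp: of_nat_diff)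
      then have "\<not> 1 \<le> dg g (B - {v}) p" using False dg_nonneg[of g B] dg_nonneg[of g "A - {u}"] by smt
      then have "dg g (B - {v}) p = 0" using dg_pos_ge_1[of g "B - {v}" p] by blast
      then have "\<not> g p q" if "q \<in> B - {v}" for q using that P(2) dg_zero_iff[of "B - {v}" g p] by blast
      then have z: "dg g B q = 0" "dg g (A - {u}) q = 0" if "q \<in> B - {v}" for q
        using False that dg_nonneg[of g B q] dg_nonneg[of g "A - {u}" q] dg_nonneg[of g "B - {v}" p]
          dg_pos_ge_1[of g B q] dg_pos_ge_1[of g "A - {u}" q] by smt+
      have nz: "\<not> g q x" if "q \<in> B - {v}" "x \<in> B \<or> x \<in> A - {u}" for q x
        using z[OF that(1)] that(2) P(1,2) dg_zero_iff[of B g q] dg_zero_iff[of "A - {u}" g q] by blast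
      have nz': "\<not> g x q" if "q \<in> B - {v}" "x \<in> B \<or> x \<in> A - {u}" for q x
        using nz[OF that] graphD(1)[OF gr] by blast
      have "card (A - {u}) = card (B - {v})" using P by simp
      then obtain f where f: "bij_betw f (A - {u}) (B - {v})" using P(1,2) by (metis finite_Diff finite_same_card_bij)
      have "bij_betw (f(u := v)) (insert u (A - {u})) (insert v (B - {v}))"
        using bij_betw_combine[of "f(u := v)" "A - {u}" "B - {v}" "{u}" "{v}"] f
          bij_betw_cong[of "A - {u}" f "f(u := v)" "B - {v}"] by (simp add: bij_betw_def)
      then have b: "bij_betw (f(u := v)) A B" using P(6,7) by (simp add: insert_absorb)
      have fB: "f x \<in> B - {v}" if "x \<in> A" "x \<noteq> u" for x using f that by (auto simp: bij_betw_def)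
      show ?thesis unfolding pk_forced_def
        using b nz nz' fB P(6-8) graphD(2)[OF gr] by (intro exI[of _ "f(u := v)"]) auto
    qed
  qed
  show ?case
  proof (cases "esum g A \<le> esum g B")
    case True
    then show ?thesis using step[of A B u v] less.prems by blast
  next
    case False
    have "(\<Sum>x\<in>B - {v}. dg g (A - {u}) x) = (\<Sum>x\<in>A - {u}. dg g (B - {v}) x)"
      using less.prems by (intro dg_double_count[OF gr]) auto
    then have "pk_forced B A g v u"
      using step[of B A v u] less.prems False graphD(1)[OF gr] by (auto simp: Int_commute)
    then show ?thesis using pk_forced_swap[OF gr] less.prems by blast
  qed
qed

text \<open>\<open>M\<close> and \<open>N\<close> bound the maximum degrees but need not attain them; \<open>418275 = 11 * 195\<^sup>2\<close>, and all edge counts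
  are doubled.\<close>

definition good :: "nat \<Rightarrow> 'a set \<Rightarrow> 'a set \<Rightarrow> ('a \<Rightarrow> 'a \<Rightarrow> bool) \<Rightarrow> real \<Rightarrow> real \<Rightarrow> bool" where
  "good n A B g M N \<longleftrightarrow> graph g \<and> finite A \<and> finite B \<and> A \<inter> B = {} \<and> card A = n \<and> card B = n \<and>
     (\<forall>x\<in>A. dg g A x \<le> M \<and> dg g A x \<le> real n - 2 \<and> dg g B x \<le> N \<and> dg g B x \<le> real n - 1) \<and>
     (\<forall>x\<in>B. dg g B x \<le> M \<and> dg g B x \<le> real n - 2 \<and> dg g A x \<le> N \<and> dg g A x \<le> real n - 1) \<and>
     esum g (A \<union> B) + 2 * M + 2 * N \<le> 6 * real n - 2 * 418275"

lemma good_swap: "good n A B g M N \<Longrightarrow> good n B A g M N"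
  unfolding good_def by (auto simp: Int_commute Un_commute)

section \<open>The minimal counterexample and its degree bounds\<close>

locale counterexample =
  fixes n :: nat and A B :: "'a set" and g :: "'a \<Rightarrow> 'a \<Rightarrow> bool" and M N :: real
  assumes good: "good n A B g M N" and npk: "\<not> pk A B g"
    and IH: "\<And>n' A' B' g' M' N'. n' < n \<Longrightarrow> good n' A' B' g' M' N' \<Longrightarrow> pk (A' :: 'a set) B' g'"
begin

lemma gr: "graph g" and fin: "finite A" "finite B" and dj: "A \<inter> B = {}" and cards: "card A = n" "card B = n"
  and dA: "\<And>x. x \<in> A \<Longrightarrow> dg g A x \<le> M" "\<And>x. x \<in> A \<Longrightarrow> dg g A x \<le> real n - 2"
    "\<And>x. x \<in> A \<Longrightarrow> dg g B x \<le> N" "\<And>x. x \<in> A \<Longrightarrow> dg g B x \<le> real n - 1"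
  and dB: "\<And>x. x \<in> B \<Longrightarrow> dg g B x \<le> M" "\<And>x. x \<in> B \<Longrightarrow> dg g B x \<le> real n - 2"
    "\<And>x. x \<in> B \<Longrightarrow> dg g A x \<le> N" "\<And>x. x \<in> B \<Longrightarrow> dg g A x \<le> real n - 1"
  and Fle: "esum g (A \<union> B) + 2 * M + 2 * N \<le> 6 * real n - 2 * 418275"
  using good unfolding good_def by auto

lemma gs: "g x y \<longleftrightarrow> g y x" and gi: "\<not> g x x"
  using gr by (auto simp: graph_def)

lemma swap: "counterexample n B A g M N"
  using good_swap[OF good] npk pk_swap[OF gr] IH by unfold_locales blast+

lemma n_pos: "0 < n"
proof (rule ccontr)
  assume "\<not> 0 < n"
  then have "A = {}" "B = {}" using cards fin by auto
  then show False using npk by (auto simp: pk_def bij_betw_def)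
qed

lemma MN0: "0 \<le> M" "0 \<le> N"
proof -
  obtain x where "x \<in> A" using n_pos cards by fastforce
  then show "0 \<le> M" "0 \<le> N" using dA(1,3)[of x] dg_nonneg[of g A x] dg_nonneg[of g B x] by linarith+
qed

lemma n_ge: "139425 \<le> n"
  using Fle MN0 esum_nonneg[of g "A \<union> B"] by linarith

text \<open>A vertex u of large cross degree is matched with a nonneighbour. Its cross edges then
  leave the budget, their number is saved once more through \<open>N\<close>, and the rest is sparse
  enough for \<open>sparse_forced\<close>. Here 418273 is 418275 - 2.\<close>

lemma cross_bound_A:
  assumes u: "u \<in> A" shows "2 * dg g B u + M < 2 * real n - 418273"
proof (rule ccontr)
  assume c: "\<not> ?thesis"
  obtain v where v: "v \<in> B" "\<not> g u v"
    using exists_not_adjacent[OF fin(2), of g u] dA(4)[OF u] cards n_pos by auto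
  have "(\<Sum>x\<in>A - {u}. dg g (B - {v}) x) \<le> (\<Sum>x\<in>A - {u}. dg g B x)"
    using fin by (intro sum_mono dg_mono) auto
  then have "dg g B u + (\<Sum>x\<in>A - {u}. dg g (B - {v}) x) \<le> (\<Sum>x\<in>A. dg g B x)"
    using sum.remove[OF fin(1) u, of "dg g B"] by simp
  then have "esum g A + esum g B + 2 * (\<Sum>x\<in>A - {u}. dg g (B - {v}) x) \<le> 2 * (real n - 2)"
    using esum_Un[OF gr fin dj] Fle c dA(3)[OF u] by argo
  then show False
    using sparse_forced[OF gr fin dj cards u v] pk_forced_pk[of A B g u v] npk by blast
qed

text \<open>c goes to a nonneighbour w with at most one neighbour v in B, and v is made the image of
  a nonneighbour u of c. No conflict at c is left, and without c the triple is sparse enough to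
  force u to v.\<close>

lemma inner_bound_A:
  assumes c: "c \<in> A" shows "2 * dg g A c + N < 2 * real n - 418265"
proof (rule ccontr)
  assume "\<not> ?thesis"
  then have big: "2 * real n - 418265 \<le> 2 * dg g A c + N" by simp
  let ?X = "\<Sum>x\<in>A. dg g B x"
  have eA: "esum g A = esum g (A - {c}) + 2 * dg g A c" by (rule esum_remove[OF gr fin(1) c])
  \<comment> \<open>The final application needs 2n - 6, that is 2((n - 1) - 2); the surplus serves
    to find w.\<close>
  have R: "esum g (A - {c}) + esum g B + 2 * ?X \<le> 2 * real n - 20"
    using esum_Un[OF gr fin dj] Fle big dA(1)[OF c] eA by linarith
  have X0: "0 \<le> ?X" by (simp add: sum_nonneg)
  define U where "U = A - nb g A c - {c}"
  have "real (card (insert c (nb g A c))) \<le> real n - 1"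
    using dA(2)[OF c] fin gi by (simp add: dg_def)
  then have "\<not> A \<subseteq> insert c (nb g A c)" using card_mono[of "insert c (nb g A c)" A] cards fin by force
  then obtain u1 where "u1 \<in> A" "u1 \<notin> insert c (nb g A c)" by blast
  then have u1: "u1 \<in> U" by (simp add: U_def)
  define W where "W = B - nb g B c"
  \<comment> \<open>No member of \<open>Bs\<close> can be the image of a nonneighbour of c other
    than c itself.\<close>
  define Bs where "Bs = {v\<in>B. \<forall>u\<in>U. g u v}"
  have "\<exists>w\<in>W. \<exists>v\<in>B - {w}. \<exists>u\<in>A - {c}. \<not> g u v \<and> (\<forall>z\<in>B. g w z \<longrightarrow> z = v \<and> \<not> g c u)"
  proof (rule ccontr)
    assume no: "\<not> ?thesis"
    have d0: "dg g B w \<noteq> 0" if w: "w \<in> W" for w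
    proof
      assume "dg g B w = 0"
      then have iso: "\<not> g w z" if "z \<in> B" for z using that fin by (simp add: dg_zero_iff)
      have "\<exists>v\<in>B - {w}. dg g A v = 0"
      proof (rule ccontr)
        assume "\<not> ?thesis"
        then have "real (card (B - {w})) \<le> (\<Sum>v\<in>B - {w}. dg g A v)"
          using sum_mono[of "B - {w}" "\<lambda>_. 1" "dg g A"] dg_pos_ge_1 by fastforce
        also have "\<dots> \<le> (\<Sum>v\<in>B. dg g A v)" using fin by (intro sum_mono2) auto
        also have "\<dots> = ?X" using dg_double_count[OF gr fin] by simp
        finally have "real (card (B - {w})) \<le> ?X" .
        moreover have "real (card (B - {w})) = real n - 1" using w cards n_pos fin by (auto simp: W_def of_nat_diff)
        ultimately show False using R n_ge esum_nonneg[of g "A - {c}"] esum_nonneg[of g B] by linarith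
      qed
      then obtain v where v: "v \<in> B" "v \<noteq> w" "dg g A v = 0" by auto
      have "u1 \<in> A - {c}" "\<not> g u1 v" using v u1 fin gs by (auto simp: dg_zero_iff U_def)
      moreover have "\<forall>z\<in>B. g w z \<longrightarrow> z = v \<and> \<not> g c u1" using iso by blast
      moreover have "v \<in> B - {w}" using v by simp
      ultimately show False using no w by (auto simp only: bex_simps ball_simps)
    qed
    \<comment> \<open>A w whose single neighbour lies outside \<open>Bs\<close> would do, so a w of
      degree one has its neighbour in \<open>Bs\<close>, where it is counted a second time.\<close>
    have d1: "2 \<le> dg g B w + dg g Bs w" if w: "w \<in> W" for w
    proof (cases "dg g B w \<le> 1")
      case True
      then have "card (nb g B w) = 1" using d0[OF w] dg_pos_ge_1[of g B w] by (simp add: dg_def)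
      then obtain v where v: "nb g B w = {v}" by (auto simp: card_1_singleton_iff)
      then have vB: "v \<in> B" "g w v" by auto
      have "v \<in> Bs"
      proof (rule ccontr)
        assume "v \<notin> Bs"
        then obtain u where u: "u \<in> U" "\<not> g u v" using vB by (auto simp: Bs_def)
        moreover have "\<forall>z\<in>B. g w z \<longrightarrow> z = v" using v by (auto simp: set_eq_iff)
        moreover have "v \<in> B - {w}" "u \<in> A - {c}" "\<not> g c u" using vB gi u(1) by (auto simp: U_def)
        moreover have "\<not> (\<not> g u v \<and> (\<forall>z\<in>B. g w z \<longrightarrow> z = v \<and> \<not> g c u))" if "v \<in> B - {w}" "u \<in> A - {c}" for v u
          using no w that by (simp only: bex_simps not_False_eq_True)
        ultimately show False by blast
      qed
      then have "1 \<le> dg g Bs w" using vB fin by (intro dg_ge_1) (auto simp: Bs_def)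
      then show ?thesis using dg_pos_ge_1[OF d0[OF w]] by linarith
    next
      case False
      then have "2 \<le> dg g B w" by (simp add: dg_def)
      then show ?thesis using dg_nonneg[of g Bs w] by linarith
    qed
    have fBs: "finite Bs" "Bs \<subseteq> B" "finite W" "W \<subseteq> B" using fin by (auto simp: Bs_def W_def)
    have "2 * real (card (W - Bs)) = (\<Sum>w\<in>W - Bs. 2)" by simp
    also have "\<dots> \<le> (\<Sum>w\<in>W - Bs. dg g B w + dg g Bs w)" by (intro sum_mono d1) auto
    also have "\<dots> = (\<Sum>w\<in>W - Bs. dg g B w) + (\<Sum>v\<in>Bs. dg g (W - Bs) v)"
      using dg_double_count[OF gr, of "W - Bs" Bs] fBs by (simp add: sum.distrib)
    also have "(\<Sum>w\<in>W - Bs. dg g B w) \<le> (\<Sum>w\<in>B - Bs. dg g B w)"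
      using fBs fin by (intro sum_mono2) auto
    also have "(\<Sum>v\<in>Bs. dg g (W - Bs) v) \<le> (\<Sum>v\<in>Bs. dg g B v)"
      using fBs fin by (intro sum_mono dg_mono) auto
    also have "(\<Sum>w\<in>B - Bs. dg g B w) + (\<Sum>v\<in>Bs. dg g B v) = esum g B"
      unfolding esum_def using sum.subset_diff[OF fBs(2) fin(2), of "dg g B"] by simp
    finally have E: "2 * real (card (W - Bs)) \<le> esum g B" by simp
    \<comment> \<open>\<open>Bs\<close> lies in the cross neighbourhood of \<open>u1\<close>. Hence
      n is at most half of \<open>esum g B\<close> plus the number of cross edges, which
      \<open>R\<close> excludes.\<close>
    have "B \<subseteq> (W - Bs) \<union> nb g B c \<union> Bs" by (auto simp: W_def)
    then have "card B \<le> card ((W - Bs) \<union> nb g B c \<union> Bs)" using fBs fin by (intro card_mono) auto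
    also have "\<dots> \<le> card (W - Bs) + card (nb g B c) + card Bs"
      by (meson card_Un_le order_trans add_le_mono order_refl)
    finally have n1: "real n \<le> real (card (W - Bs)) + dg g B c + card Bs" using cards by (simp add: dg_def)
    have "real (card Bs) \<le> dg g B u1" using u1 fin by (intro dg_ge_card) (auto simp: Bs_def)
    moreover have "dg g B c + dg g B u1 \<le> ?X"
    proof -
      have "dg g B c + dg g B u1 = sum (dg g B) {c, u1}" using u1 by (auto simp: U_def)
      also have "\<dots> \<le> ?X" using fin c u1 by (intro sum_mono2) (auto simp: U_def)
      finally show ?thesis .
    qed
    ultimately show False using n1 E R esum_nonneg[of g "A - {c}"] by linarith
  qed
  then obtain w v u where wvu: "w \<in> W" "v \<in> B" "v \<noteq> w" "u \<in> A" "u \<noteq> c" "\<not> g u v"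
    "\<forall>z\<in>B. g w z \<longrightarrow> z = v \<and> \<not> g c u" by auto
  have wB: "w \<in> B" "\<not> g c w" using wvu(1) by (auto simp: W_def)
  let ?A = "A - {c}" and ?B = "B - {w}"
  have "(\<Sum>x\<in>?A - {u}. dg g (?B - {v}) x) \<le> (\<Sum>x\<in>?A - {u}. dg g B x)"
    using fin by (intro sum_mono dg_mono) auto
  also have "\<dots> \<le> ?X" using fin by (intro sum_mono2) auto
  finally have "(\<Sum>x\<in>?A - {u}. dg g (?B - {v}) x) \<le> ?X" .
  moreover have "esum g ?B \<le> esum g B" by (rule esum_mono[OF gr fin(2)]) auto
  ultimately have "esum g ?A + esum g ?B + 2 * (\<Sum>x\<in>?A - {u}. dg g (?B - {v}) x) \<le> 2 * (real (n - 1) - 2)"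
    using R n_pos by (simp add: of_nat_diff)
  then have "pk_forced ?A ?B g u v"
    using sparse_forced[OF gr, of ?A ?B "n - 1" u v] fin dj cards c wB wvu by auto
  then obtain f where f: "bij_betw f ?A ?B" "f u = v" "\<forall>x\<in>?A. \<not> g x (f x)"
    "\<forall>x\<in>?A. \<forall>y\<in>?A. g x y \<longrightarrow> \<not> g (f x) (f y)" unfolding pk_forced_def by blast
  have "bij_betw (f(c := w)) (insert c ?A) (insert w ?B)"
    using bij_betw_combine[of "f(c := w)" ?A ?B "{c}" "{w}"] f(1)
      bij_betw_cong[of ?A f "f(c := w)" ?B] by (simp add: bij_betw_def)
  then have b: "bij_betw (f(c := w)) A B" using c wB by (simp add: insert_absorb)
  have fB: "f x \<in> B" if "x \<in> A" "x \<noteq> c" for x using f(1) that by (auto simp: bij_betw_def)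
  have key: "\<not> g w (f x)" if "x \<in> A" "g c x" for x
  proof
    assume a: "g w (f x)"
    have xc: "x \<noteq> c" using that gi by auto
    then have "f x = v" "\<not> g c u" using wvu(7) fB[OF that(1)] a by auto
    then have "x = u" using f(1,2) that xc wvu(4,5) by (auto simp: bij_betw_def inj_on_def)
    then show False using that \<open>\<not> g c u\<close> by simp
  qed
  have 1: "\<not> g x ((f(c := w)) x)" if "x \<in> A" for x using that f(3) wB by auto
  have 2: "\<not> g ((f(c := w)) x) ((f(c := w)) y)" if "x \<in> A" "y \<in> A" "g x y" for x y
  proof -
    consider "x = c" | "x \<noteq> c" "y = c" | "x \<noteq> c" "y \<noteq> c" by blast
    then show ?thesis
    proof cases
      case 1
      then have "y \<noteq> c" using that(3) gi by auto
      then show ?thesis using key[of y] that 1 by simp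
    next
      case 2
      then show ?thesis using key[of x] that gs[of x c] gs[of w "f x"] by simp
    next
      case 3
      then show ?thesis using f(4) that by simp
    qed
  qed
  have "pk A B g" unfolding pk_def using b 1 2 by blast
  then show False using npk by simp
qed

lemma cross_bound: "u \<in> A \<Longrightarrow> dg g B u \<le> real n - 209136" "u \<in> B \<Longrightarrow> dg g A u \<le> real n - 209136"
  using cross_bound_A[of u] counterexample.cross_bound_A[OF swap, of u] MN0 by linarith+

lemma inner_bound: "u \<in> A \<Longrightarrow> dg g A u \<le> real n - 209132" "u \<in> B \<Longrightarrow> dg g B u \<le> real n - 209132"
  using inner_bound_A[of u] counterexample.inner_bound_A[OF swap, of u] MN0 by linarith+

text \<open>Minimality in doubled edge counts: placing |S| pairs lowers the bound by 6|S|, and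
  replacing \<open>N\<close> by \<open>N + G\<close> costs 2G. \<open>M\<close> survives because
  inner degrees do not grow.\<close>

lemma reduction:
  assumes v: "valid A B g S h" and S: "S \<noteq> {}"
    and E: "esum g ((A - S) \<union> (B - h ` S)) + 2 * (\<Sum>a\<in>S. dg g (A - S) a * dg g (B - h ` S) (h a)) + 2 * G + 6 * real (card S)
        \<le> esum g (A \<union> B)"
    and G: "0 \<le> G" "\<And>x. x \<in> A - S \<Longrightarrow> (\<Sum>a\<in>{a\<in>S. g x a}. dg g (B - h ` S) (h a)) \<le> G"
      "\<And>x. x \<in> B - h ` S \<Longrightarrow> (\<Sum>a\<in>{a\<in>S. g x (h a)}. dg g (A - S) a) \<le> G"
    and I: "\<And>x. x \<in> A - S \<Longrightarrow> dg g A x \<le> real n - card S - 2" "\<And>x. x \<in> B - h ` S \<Longrightarrow> dg g B x \<le> real n - card S - 2"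
    and D: "\<And>x. x \<in> A - S \<Longrightarrow> dg g B x + (\<Sum>a\<in>{a\<in>S. g x a}. dg g (B - h ` S) (h a)) \<le> real n - card S - 1"
      "\<And>x. x \<in> B - h ` S \<Longrightarrow> dg g A x + (\<Sum>a\<in>{a\<in>S. g x (h a)}. dg g (A - S) a) \<le> real n - card S - 1"
  shows False
proof -
  let ?A = "A - S" and ?B = "B - h ` S" and ?g = "lifted A B g S h"
  have fS: "finite S" and SA: "S \<subseteq> A" "h ` S \<subseteq> B" and ij: "inj_on h S" using v by (auto simp: valid_def)
  have kn: "card S \<le> n" using card_mono[OF fin(1) SA(1)] cards by simp
  have k0: "0 < card S" using S fS by (simp add: card_gt_0_iff)
  have cS: "card ?A = n - card S" "card ?B = n - card S"
    using SA fS cards card_image[OF ij] by (simp_all add: card_Diff_subset)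
  have rn: "real (n - card S) = real n - real (card S)" using kn by (simp add: of_nat_diff)
  have "good (n - card S) ?A ?B ?g M (N + G)"
    unfolding good_def
  proof (intro conjI ballI)
    show "graph ?g" by (rule graph_lifted[OF gr dj])
    show "esum ?g (?A \<union> ?B) + 2 * M + 2 * (N + G) \<le> 6 * real (n - card S) - 2 * 418275"
      using lifted_esum[OF gr dj fin fS, of h] E Fle rn by argo
    show "card ?A = n - card S" "card ?B = n - card S" by (rule cS)+
    fix x assume x: "x \<in> ?A"
    have 1: "dg ?g ?A x \<le> dg g A x" using lifted_dg_same(1)[OF dj x] dg_mono[OF fin(1), of ?A g x] by simp
    show "dg ?g ?A x \<le> M" using 1 dA(1)[of x] x by simp
    show "dg ?g ?A x \<le> real (n - card S) - 2" using 1 I(1)[OF x] rn by simp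
    have 2: "dg ?g ?B x \<le> dg g B x + (\<Sum>a\<in>{a\<in>S. g x a}. dg g ?B (h a))"
      using lifted_dg_cross_A[OF gr dj fin(2) fS x, of h] dg_mono[OF fin(2), of ?B g x] by simp
    show "dg ?g ?B x \<le> N + G" using 2 G(2)[OF x] dA(3)[of x] x by simp
    show "dg ?g ?B x \<le> real (n - card S) - 1" using 2 D(1)[OF x] rn by simp
  next
    fix x assume x: "x \<in> ?B"
    have 1: "dg ?g ?B x \<le> dg g B x" using lifted_dg_same(2)[OF dj x, of g] dg_mono[OF fin(2), of ?B g x] by simp
    show "dg ?g ?B x \<le> M" using 1 dB(1)[of x] x by simp
    show "dg ?g ?B x \<le> real (n - card S) - 2" using 1 I(2)[OF x] rn by simp
    have 2: "dg ?g ?A x \<le> dg g A x + (\<Sum>a\<in>{a\<in>S. g x (h a)}. dg g ?A a)"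
      using lifted_dg_cross_B[OF gr dj fin(1) fS x] dg_mono[OF fin(1), of ?A g x] by simp
    show "dg ?g ?A x \<le> N + G" using 2 G(3)[OF x] dB(3)[of x] x by simp
    show "dg ?g ?A x \<le> real (n - card S) - 1" using 2 D(2)[OF x] rn by simp
  qed (use fin dj in auto)
  then have "pk ?A ?B ?g" using IH[of "n - card S"] k0 kn by simp
  then show False using pk_extend[OF gr v] npk by simp
qed

end

section \<open>Placing a heavy vertex; the weight count\<close>

definition heavy :: "nat \<Rightarrow> ('a \<Rightarrow> 'a \<Rightarrow> bool) \<Rightarrow> 'a set \<Rightarrow> 'a set" where
  "heavy n g V = {v\<in>V. real n / 6000 \<le> dg g V v}"

definition wt :: "('a \<Rightarrow> 'a \<Rightarrow> bool) \<Rightarrow> 'a set \<Rightarrow> 'a set \<Rightarrow> 'a \<Rightarrow> real" where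
  "wt g V Z v = 2 * dg g Z v + dg g (V - Z) v"

lemma wt_int: "wt g V Z v < real (k + 1) \<Longrightarrow> wt g V Z v \<le> real k"
proof -
  have "wt g V Z v = real (2 * card (nb g Z v) + card (nb g (V - Z) v))" by (simp add: wt_def dg_def)
  then show "wt g V Z v < real (k + 1) \<Longrightarrow> wt g V Z v \<le> real k" by (simp only: of_nat_less_iff of_nat_le_iff)
qed

lemma wt_eq:
  assumes "finite V" "Z \<subseteq> V" shows "wt g V Z v = dg g Z v + dg g V v"
  using dg_Diff[OF assms] by (simp add: wt_def)

context counterexample begin

abbreviation V where "V \<equiv> A \<union> B"
abbreviation D where "D \<equiv> dg g (A \<union> B)"
abbreviation Big where "Big \<equiv> heavy n g (A \<union> B)"

lemma finV: "finite V" using fin by simp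

lemma cardV: "card V = 2 * n" using card_Un_disjoint[OF fin dj] cards by simp

lemma dg_V: "D x = dg g A x + dg g B x" using dg_Un[OF fin dj] by simp

lemma n_big: "209136 \<le> n"
proof -
  obtain x where "x \<in> A" using n_pos cards by fastforce
  then have "209136 \<le> real n" using cross_bound(1)[of x] dg_nonneg[of g B x] by linarith
  then show ?thesis by simp
qed

text \<open>The image of c has no unplaced neighbour, so c creates nothing and all of
  \<open>D c\<close> is gained. Every other a frees p + q edges and costs p q, whence the summand p
  q - p - q.\<close>

lemma reduction_heavy:
  assumes v: "valid A B g S h" and c: "c \<in> S" and q0: "dg g (B - h ` S) (h c) = 0"
    and K: "(\<Sum>a\<in>S - {c}. dg g (A - S) a * dg g (B - h ` S) (h a) - dg g (A - S) a - dg g (B - h ` S) (h a)) \<le> K"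
    and G: "0 \<le> G" "\<And>x. x \<in> A - S \<Longrightarrow> (\<Sum>a\<in>{a\<in>S. g x a}. dg g (B - h ` S) (h a)) \<le> G"
      "\<And>x. x \<in> B - h ` S \<Longrightarrow> (\<Sum>a\<in>{a\<in>S. g x (h a)}. dg g (A - S) a) \<le> G"
    and I: "\<And>x. x \<in> A - S \<Longrightarrow> dg g A x \<le> real n - card S - 2" "\<And>x. x \<in> B - h ` S \<Longrightarrow> dg g B x \<le> real n - card S - 2"
    and DD: "\<And>x. x \<in> A - S \<Longrightarrow> dg g B x + (\<Sum>a\<in>{a\<in>S. g x a}. dg g (B - h ` S) (h a)) \<le> real n - card S - 1"
      "\<And>x. x \<in> B - h ` S \<Longrightarrow> dg g A x + (\<Sum>a\<in>{a\<in>S. g x (h a)}. dg g (A - S) a) \<le> real n - card S - 1"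
    and big: "3 * real (card S) + K + G \<le> D c"
  shows False
proof (rule reduction[OF v _ _ G I DD])
  show "S \<noteq> {}" using c by auto
  have fS: "finite S" and SA: "S \<subseteq> A" "h ` S \<subseteq> B" and ij: "inj_on h S" using v by (auto simp: valid_def)
  let ?W = "S \<union> h ` S" and ?p = "\<lambda>a. dg g (A - S) a" and ?q = "\<lambda>a. dg g (B - h ` S) (h a)"
  have WV: "?W \<subseteq> V" and fW: "finite ?W" using SA fS by auto
  have dS: "S \<inter> h ` S = {}" using SA dj by blast
  have VW: "V - ?W = (A - S) \<union> (B - h ` S)" using SA dj by blast
  have s: "esum g V = esum g (V - ?W) + 2 * (\<Sum>x\<in>?W. dg g (V - ?W) x) + esum g ?W"
    by (rule esum_split[OF gr finV WV])
  have "(\<Sum>x\<in>?W. dg g (V - ?W) x) = (\<Sum>a\<in>S. dg g (V - ?W) a) + (\<Sum>a\<in>S. dg g (V - ?W) (h a))"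
    using fS dS ij by (simp add: sum.union_disjoint sum.reindex)
  also have "(\<Sum>a\<in>S. dg g (V - ?W) a) = dg g (V - ?W) c + (\<Sum>a\<in>S - {c}. dg g (V - ?W) a)"
    using sum.remove[OF fS c] by simp
  finally have s1: "(\<Sum>x\<in>?W. dg g (V - ?W) x) = dg g (V - ?W) c + (\<Sum>a\<in>S - {c}. dg g (V - ?W) a) + (\<Sum>a\<in>S. dg g (V - ?W) (h a))" .
  have p1: "(\<Sum>a\<in>S - {c}. ?p a) \<le> (\<Sum>a\<in>S - {c}. dg g (V - ?W) a)"
    using fin VW by (intro sum_mono dg_mono) auto
  have "(\<Sum>a\<in>S - {c}. ?q a) = (\<Sum>a\<in>S. ?q a)" using sum.remove[OF fS c, of ?q] q0 by simp
  also have "\<dots> \<le> (\<Sum>a\<in>S. dg g (V - ?W) (h a))"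
    using fin VW by (intro sum_mono dg_mono) auto
  finally have q1: "(\<Sum>a\<in>S - {c}. ?q a) \<le> (\<Sum>a\<in>S. dg g (V - ?W) (h a))" .
  have e: "2 * dg g ?W c \<le> esum g ?W" using esum_remove[OF gr fW, of c] c esum_nonneg[of g "?W - {c}"] by auto
  have Dc: "D c = dg g (V - ?W) c + dg g ?W c" by (rule dg_Diff[OF finV WV])
  have "(\<Sum>a\<in>S. ?p a * ?q a) = (\<Sum>a\<in>S - {c}. ?p a * ?q a)" using sum.remove[OF fS c, of "\<lambda>a. ?p a * ?q a"] q0 by simp
  also have "\<dots> = (\<Sum>a\<in>S - {c}. ?p a * ?q a - ?p a - ?q a) + (\<Sum>a\<in>S - {c}. ?p a) + (\<Sum>a\<in>S - {c}. ?q a)"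
    by (simp add: sum_subtractf)
  finally have "(\<Sum>a\<in>S. ?p a * ?q a) \<le> K + (\<Sum>a\<in>S - {c}. ?p a) + (\<Sum>a\<in>S - {c}. ?q a)" using K by linarith
  then show "esum g ((A - S) \<union> (B - h ` S)) + 2 * (\<Sum>a\<in>S. ?p a * ?q a) + 2 * G + 6 * real (card S) \<le> esum g V"
    using s s1 p1 q1 e Dc big arg_cong[OF VW, of "esum g"] by argo
qed

text \<open>Only vertices of \<open>H\<close> may keep unplaced neighbours on both sides of the
  pair; all others create nothing. A vertex of cross degree above 9n/10 has just the slack 209136 of
  \<open>cross_bound\<close> and may gain at most 100000; for the others a gain of n/40 is
  harmless.\<close>

lemma reduction_heavy_bounded:
  assumes v: "valid A B g S h" and c: "c \<in> S" "card S \<le> 1000" and q0: "dg g (B - h ` S) (h c) = 0"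
    and H: "H \<subseteq> S" "c \<notin> H" "\<And>a. a \<in> S - H \<Longrightarrow> dg g (A - S) a = 0 \<or> dg g (B - h ` S) (h a) = 0"
    and p: "\<And>a. a \<in> H \<Longrightarrow> dg g (A - S) a \<le> p a" and q: "\<And>a. a \<in> H \<Longrightarrow> dg g (B - h ` S) (h a) \<le> q a"
    and K: "(\<Sum>a\<in>H. p a * q a) \<le> K" and P: "(\<Sum>a\<in>H. p a) \<le> G" and Q: "(\<Sum>a\<in>H. q a) \<le> G"
    and G: "G \<le> real n / 40"
    and sA: "\<And>x. x \<in> A - S \<Longrightarrow> 9/10 * real n < dg g B x \<Longrightarrow> (\<Sum>a\<in>{a\<in>H. g x a}. q a) \<le> 100000"
    and sB: "\<And>x. x \<in> B - h ` S \<Longrightarrow> 9/10 * real n < dg g A x \<Longrightarrow> (\<Sum>a\<in>{a\<in>H. g x (h a)}. p a) \<le> 100000"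
    and big: "3 * real (card S) + K + G \<le> D c"
  shows False
proof -
  have fS: "finite S" and SA: "S \<subseteq> A" "h ` S \<subseteq> B" using v by (auto simp: valid_def)
  have fH: "finite H" using finite_subset[OF H(1) fS] .
  let ?p = "\<lambda>a. dg g (A - S) a" and ?q = "\<lambda>a. dg g (B - h ` S) (h a)"
  have p0: "0 \<le> p a" if "a \<in> H" for a using p[OF that] dg_nonneg[of g "A - S" a] by linarith
  have q0': "0 \<le> q a" if "a \<in> H" for a using q[OF that] dg_nonneg[of g "B - h ` S" "h a"] by linarith
  have gA: "(\<Sum>a\<in>{a\<in>S. g x a}. ?q a) \<le> (\<Sum>a\<in>{a\<in>H. g x a}. q a)" if x: "x \<in> A - S" for x
  proof -
    have "?q a = 0" if a: "a \<in> S - H" "g x a" for a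
    proof -
      have "g a x" using a(2) gs[of x a] by simp
      then have "?p a \<noteq> 0" using dg_zero_iff[of "A - S" g a] fin x by blast
      then show ?thesis using H(3)[OF a(1)] by simp
    qed
    then have "(\<Sum>a\<in>{a\<in>S. g x a}. ?q a) = (\<Sum>a\<in>{a\<in>H. g x a}. ?q a)"
      using fS H(1) by (intro sum.mono_neutral_right) auto
    also have "\<dots> \<le> (\<Sum>a\<in>{a\<in>H. g x a}. q a)" using q by (intro sum_mono) auto
    finally show ?thesis .
  qed
  have gB: "(\<Sum>a\<in>{a\<in>S. g x (h a)}. ?p a) \<le> (\<Sum>a\<in>{a\<in>H. g x (h a)}. p a)" if x: "x \<in> B - h ` S" for x
  proof -
    have "?p a = 0" if a: "a \<in> S - H" "g x (h a)" for a
    proof -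
      have "g (h a) x" using a(2) gs[of x "h a"] by simp
      then have "?q a \<noteq> 0" using dg_zero_iff[of "B - h ` S" g "h a"] fin x by blast
      then show ?thesis using H(3)[OF a(1)] by simp
    qed
    then have "(\<Sum>a\<in>{a\<in>S. g x (h a)}. ?p a) = (\<Sum>a\<in>{a\<in>H. g x (h a)}. ?p a)"
      using fS H(1) by (intro sum.mono_neutral_right) auto
    also have "\<dots> \<le> (\<Sum>a\<in>{a\<in>H. g x (h a)}. p a)" using p by (intro sum_mono) auto
    finally show ?thesis .
  qed
  have gA': "(\<Sum>a\<in>{a\<in>H. g x a}. q a) \<le> G" for x
    using sum_mono2[of H "{a\<in>H. g x a}" q] fH q0' Q by force
  have gB': "(\<Sum>a\<in>{a\<in>H. g x (h a)}. p a) \<le> G" for x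
    using sum_mono2[of H "{a\<in>H. g x (h a)}" p] fH p0 P by force
  have G0: "0 \<le> G" using P sum_nonneg[of H p] p0 by force
  have k: "real (card S) \<le> 1000" using c by simp
  have nb: "209136 \<le> real n" using n_big by simp
  show False
  proof (rule reduction_heavy[OF v c(1) q0 _ G0])
    show "(\<Sum>a\<in>S - {c}. ?p a * ?q a - ?p a - ?q a) \<le> K"
    proof -
      have "(\<Sum>a\<in>S - {c}. ?p a * ?q a - ?p a - ?q a) \<le> (\<Sum>a\<in>S - {c}. if a \<in> H then p a * q a else 0)"
      proof (rule sum_mono)
        fix a assume a: "a \<in> S - {c}"
        show "?p a * ?q a - ?p a - ?q a \<le> (if a \<in> H then p a * q a else 0)"
        proof (cases "a \<in> H")
          case True
          have "?p a * ?q a \<le> p a * q a" using p[OF True] q[OF True] p0[OF True] by (intro mult_mono) auto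
          then have "?p a * ?q a - ?p a - ?q a \<le> p a * q a"
            using dg_nonneg[of g "A - S" a] dg_nonneg[of g "B - h ` S" "h a"] by linarith
          then show ?thesis using True by simp
        next
          case False
          then have "?p a * ?q a = 0" using H(3)[of a] a by auto
          then have "?p a * ?q a - ?p a - ?q a \<le> 0"
            using dg_nonneg[of g "A - S" a] dg_nonneg[of g "B - h ` S" "h a"] by linarith
          then show ?thesis using False by simp
        qed
      qed
      also have "\<dots> = (\<Sum>a\<in>{a\<in>S - {c}. a \<in> H}. p a * q a)" using fS by (intro sum.inter_filter[symmetric]) simp
      also have "{a\<in>S - {c}. a \<in> H} = H" using H(1,2) by blast
      finally show ?thesis using K by linarith
    qed
    show "3 * real (card S) + K + G \<le> D c" by (rule big)
    fix x
    show "(\<Sum>a\<in>{a\<in>S. g x a}. ?q a) \<le> G" if "x \<in> A - S" using gA[OF that] gA'[of x] by linarith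
    show "(\<Sum>a\<in>{a\<in>S. g x (h a)}. ?p a) \<le> G" if "x \<in> B - h ` S" using gB[OF that] gB'[of x] by linarith
    show "dg g A x \<le> real n - card S - 2" if "x \<in> A - S" using inner_bound(1)[of x] that k by simp
    show "dg g B x \<le> real n - card S - 2" if "x \<in> B - h ` S" using inner_bound(2)[of x] that k by simp
    show "dg g B x + (\<Sum>a\<in>{a\<in>S. g x a}. ?q a) \<le> real n - card S - 1" if x: "x \<in> A - S"
    proof (cases "9/10 * real n < dg g B x")
      case True
      then show ?thesis using gA[OF x] sA[OF x True] cross_bound(1)[of x] x k by force
    next
      case False
      then show ?thesis using gA[OF x] gA'[of x] G k nb by linarith
    qed
    show "dg g A x + (\<Sum>a\<in>{a\<in>S. g x (h a)}. ?p a) \<le> real n - card S - 1" if x: "x \<in> B - h ` S"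
    proof (cases "9/10 * real n < dg g A x")
      case True
      then show ?thesis using gB[OF x] sB[OF x True] cross_bound(2)[of x] x k by force
    next
      case False
      then show ?thesis using gB[OF x] gB'[of x] G k nb by linarith
    qed
  qed
qed

text \<open>Since u has no neighbour on its own side, matching it with y creates no edge and frees D
  y + D u edges; three are enough to pass to n - 1.\<close>

lemma isolated_pair:
  assumes u: "u \<in> A" "dg g A u = 0" and y: "y \<in> B" "\<not> g u y" shows "D y + D u < 3"
proof (rule ccontr)
  assume c: "\<not> ?thesis"
  let ?h = "\<lambda>_. y" and ?S = "{u}"
  have 0: "dg g (A - {u}) u = 0" using u(2) dg_mono[of A "A - {u}" g u] fin dg_nonneg[of g "A - {u}" u] by auto
  have un: "\<not> g x u" if "x \<in> A" for x using u fin that gs[of x u] by (auto simp: dg_zero_iff)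
  have v: "valid A B g ?S ?h" using u y gi by (auto simp: valid_def)
  have eq: "V - {u, y} = (A - {u}) \<union> (B - {y})" using u y dj by blast
  have s: "esum g V = esum g (V - {u, y}) + 2 * (\<Sum>x\<in>{u, y}. dg g (V - {u, y}) x) + esum g {u, y}"
    using u y by (intro esum_split[OF gr finV]) auto
  have z: "dg g {u, y} u = 0" "dg g {u, y} y = 0" using y(2) gi gs[of y u] by (auto simp: dg_zero_iff)
  have d: "D u = dg g (V - {u, y}) u" "D y = dg g (V - {u, y}) y"
    using dg_Diff[OF finV, of "{u, y}" g] u y z by auto
  have uy: "u \<noteq> y" using u y dj by blast
  have "esum g V = esum g (V - {u, y}) + 2 * (D u + D y) + esum g {u, y}" using s uy d by simp
  then have k: "esum g (V - {u, y}) + 6 \<le> esum g V" using c esum_nonneg[of g "{u, y}"] by argo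
  show False
  proof (rule reduction[OF v, of 0])
    show "esum g (A - {u} \<union> (B - ?h ` {u})) + 2 * (\<Sum>a\<in>{u}. dg g (A - {u}) a * dg g (B - ?h ` {u}) (?h a)) + 2 * 0 + 6 * real (card {u}) \<le> esum g V"
      using k 0 eq by simp
    fix x
    show "dg g A x \<le> real n - real (card {u}) - 2" if "x \<in> A - {u}" using inner_bound(1)[of x] that by simp
    show "dg g B x \<le> real n - real (card {u}) - 2" if "x \<in> B - ?h ` {u}" using inner_bound(2)[of x] that by simp
    have e: "{a \<in> {u}. g x a} = {}" if "x \<in> A - {u}" using un[of x] that by auto
    have f: "(\<Sum>a\<in>{a \<in> {u}. P a}. dg g (A - {u}) a) = 0" for P using 0 by (intro sum.neutral) auto
    show "(\<Sum>a\<in>{a \<in> {u}. g x a}. dg g (B - ?h ` {u}) (?h a)) \<le> 0" if "x \<in> A - {u}" unfolding e[OF that] by simp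
    show "dg g B x + (\<Sum>a\<in>{a \<in> {u}. g x a}. dg g (B - ?h ` {u}) (?h a)) \<le> real n - real (card {u}) - 1" if "x \<in> A - {u}"
      unfolding e[OF that] using cross_bound(1)[of x] that by simp
    show "(\<Sum>a\<in>{a \<in> {u}. g x (?h a)}. dg g (A - {u}) a) \<le> 0" if "x \<in> B - ?h ` {u}" using f by simp
    show "dg g A x + (\<Sum>a\<in>{a \<in> {u}. g x (?h a)}. dg g (A - {u}) a) \<le> real n - real (card {u}) - 1" if "x \<in> B - ?h ` {u}"
      using f cross_bound(2)[of x] that by simp
  qed auto
qed

lemma isolated_pair_B:
  assumes "u \<in> B" "dg g B u = 0" "y \<in> A" "\<not> g u y" shows "D y + D u < 3"
  using counterexample.isolated_pair[OF swap assms] by (simp add: Un_commute)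

section \<open>The weight count\<close>

lemma wt_total:
  assumes "Z \<subseteq> V" shows "(\<Sum>v\<in>V - Z. wt g V Z v) \<le> 6 * real n - 2 * 418275 - 2 * M - 2 * N"
  using weight_sum[OF gr finV assms] Fle by (simp add: wt_def)

text \<open>For an integer w \<ge> 0, the number 4 - w is at most 2[w \<le> 3] + 2[w \<le> 1]. This
  is summed over V - Z, where the total weight is below 6n.\<close>

lemma light_count:
  assumes Z: "Z \<subseteq> V"
  shows "real n + 418275 + M + N - 2 * real (card Z)
     \<le> real (card {v\<in>V - Z. wt g V Z v \<le> 3}) + real (card {v\<in>V - Z. wt g V Z v \<le> 1})"
proof -
  have f: "finite (V - Z)" using finV by simp
  have "(\<Sum>v\<in>V - Z. 4 - wt g V Z v) \<le> (\<Sum>v\<in>V - Z. (if wt g V Z v \<le> 3 then 2 else 0) + (if wt g V Z v \<le> 1 then 2 else 0))"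
  proof (rule sum_mono)
    fix v
    have "wt g V Z v \<le> 3 \<or> 4 \<le> wt g V Z v" "wt g V Z v \<le> 1 \<or> 2 \<le> wt g V Z v"
      using wt_int[of g V Z v 3] wt_int[of g V Z v 1] by auto
    moreover have "0 \<le> wt g V Z v" by (simp add: wt_def)
    ultimately show "4 - wt g V Z v \<le> (if wt g V Z v \<le> 3 then 2 else 0) + (if wt g V Z v \<le> 1 then 2 else 0)" by auto
  qed
  also have "\<dots> = 2 * real (card {v\<in>V - Z. wt g V Z v \<le> 3}) + 2 * real (card {v\<in>V - Z. wt g V Z v \<le> 1})"
    unfolding sum.distrib by (simp add: sum.If_cases[OF f] Int_def)
  finally have 1: "(\<Sum>v\<in>V - Z. 4 - wt g V Z v) \<le> \<dots>" .
  have "card (V - Z) = 2 * n - card Z" using card_Diff_subset[of Z V] Z finV finite_subset cardV by fastforce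
  moreover have "card Z \<le> 2 * n" using card_mono[OF finV Z] cardV by simp
  ultimately have "real (card (V - Z)) = 2 * real n - real (card Z)" by (simp add: of_nat_diff)
  then have "(\<Sum>v\<in>V - Z. 4 - wt g V Z v) = 4 * (2 * real n - real (card Z)) - (\<Sum>v\<in>V - Z. wt g V Z v)"
    by (simp add: sum_subtractf)
  then show ?thesis using 1 wt_total[OF Z] by argo
qed

lemma esum6: "esum g V \<le> 6 * real n" using Fle MN0 by linarith

lemma Big_sub: "Big \<subseteq> V" "finite Big" using finV by (auto simp: heavy_def)

lemma card_Big: "real (card Big) \<le> 36000"
proof -
  have "real (card Big) \<le> (6 * real n) / (real n / 6000)"
    using esum6 finV n_pos by (intro markov_card[of V _ D]) (auto simp: heavy_def esum_def)
  also have "\<dots> = 36000" using n_pos by simp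
  finally show ?thesis .
qed

lemma not_Big: "v \<in> V \<Longrightarrow> v \<notin> Big \<Longrightarrow> D v < real n / 6000"
  by (auto simp: heavy_def)

lemma wt_D: "Z \<subseteq> V \<Longrightarrow> D v \<le> wt g V Z v"
  using wt_eq[OF finV, of Z g v] by simp

lemma wt_adj: "Z \<subseteq> V \<Longrightarrow> z \<in> Z \<Longrightarrow> g v z \<Longrightarrow> D v + 1 \<le> wt g V Z v"
  using wt_eq[OF finV, of Z g v] dg_ge_1[of Z z g v] finV finite_subset[of Z V] by auto

lemma exists_giant: "\<exists>c\<in>V. real n / 100 \<le> D c"
proof (rule ccontr)
  assume "\<not> ?thesis"
  then have "D x \<le> real n / 100" if "x \<in> V" for x using that by force
  then have "pk A B g"
    using low_degree_packs[OF gr fin dj, of "real n"] cards n_ge esum6 by simp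
  then show False using npk by simp
qed

end

section \<open>Placing a heavy vertex and the neighbours of its image\<close>

text \<open>Greedy choice: each chosen vertex excludes itself and at most d neighbours, so |X|(d +
  1) candidates never run out.\<close>

lemma choose_independent:
  assumes gr: "graph g" and "finite X" "finite W"
    and "\<And>x. x \<in> X \<Longrightarrow> Ch x \<subseteq> W" "\<And>x z. x \<in> X \<Longrightarrow> z \<in> Ch x \<Longrightarrow> dg g W z \<le> real d"
    and "\<And>x. x \<in> X \<Longrightarrow> card X * (d + 1) \<le> card (Ch x)"
  shows "\<exists>f. inj_on f X \<and> (\<forall>x\<in>X. f x \<in> Ch x) \<and> (\<forall>x\<in>X. \<forall>y\<in>X. \<not> g (f x) (f y))"
  using assms(2,4-)
proof (induction X rule: finite_induct)
  case empty
  then show ?case by simp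
next
  case (insert x X)
  have "\<exists>f. inj_on f X \<and> (\<forall>y\<in>X. f y \<in> Ch y) \<and> (\<forall>y\<in>X. \<forall>z\<in>X. \<not> g (f y) (f z))"
  proof (rule insert.IH)
    fix y assume y: "y \<in> X"
    have "card X * (d + 1) \<le> card (insert x X) * (d + 1)" using insert.hyps by simp
    also have "\<dots> \<le> card (Ch y)" using y by (intro insert.prems(3) insertI2)
    finally show "card X * (d + 1) \<le> card (Ch y)" .
    show "Ch y \<subseteq> W" using y by (intro insert.prems(1) insertI2)
    show "dg g W z \<le> real d" if "z \<in> Ch y" for z using y by (intro insert.prems(2)[OF _ that] insertI2)
  qed
  then obtain f where f0: "inj_on f X" "\<forall>y\<in>X. f y \<in> Ch y" "\<forall>y\<in>X. \<forall>z\<in>X. \<not> g (f y) (f z)"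
    by (elim exE conjE)
  note f = f0(1) bspec[OF f0(2)] bspec[OF bspec[OF f0(3)]]
  let ?F = "\<Union>y\<in>X. insert (f y) (nb g W (f y))"
  have 1: "card (insert (f y) (nb g W (f y))) \<le> d + 1" if "y \<in> X" for y
  proof -
    have "card (nb g W (f y)) \<le> d" using insert.prems(2)[OF insertI2[OF that] f(2)[OF that]] by (simp add: dg_def)
    then show ?thesis using card_insert_le_m1[of "d + 1" "nb g W (f y)" "f y"] by simp
  qed
  have "card ?F \<le> (\<Sum>y\<in>X. card (insert (f y) (nb g W (f y))))" using insert.hyps by (intro card_UN_le)
  also have "\<dots> \<le> (\<Sum>y\<in>X. d + 1)" using 1 by (intro sum_mono)
  also have "\<dots> < card (insert x X) * (d + 1)" using insert.hyps by simp
  also have "\<dots> \<le> card (Ch x)" by (intro insert.prems(3) insertI1)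
  finally have "card ?F < card (Ch x)" .
  moreover have "finite ?F" using insert.hyps assms(3) by simp
  ultimately have "\<not> Ch x \<subseteq> ?F" using card_mono[of ?F "Ch x"] by linarith
  then obtain z where z: "z \<in> Ch x" "z \<notin> ?F" by blast
  have zW: "z \<in> W" using z insert.prems(1)[OF insertI1] by blast
  have fz: "\<not> g (f y) z" "\<not> g z (f y)" "f y \<noteq> z" if "y \<in> X" for y
  proof -
    have "z \<notin> insert (f y) (nb g W (f y))" using z(2) that by blast
    then show "\<not> g (f y) z" "\<not> g z (f y)" "f y \<noteq> z" using zW graph_sym[OF gr, of z "f y"] by auto
  qed
  show ?case
  proof (intro exI[of _ "f(x := z)"] conjI ballI)
    show "inj_on (f(x := z)) (insert x X)" using f(1) fz(3) insert.hyps by (auto simp: inj_on_def)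
    show "(f(x := z)) y \<in> Ch y" if "y \<in> insert x X" for y using that f(2) z by auto
    show "\<not> g ((f(x := z)) y) ((f(x := z)) y')" if "y \<in> insert x X" "y' \<in> insert x X" for y y'
      using that f(3) fz graphD(2)[OF gr] insert.hyps by auto
  qed
qed

context counterexample begin

text \<open>All neighbours of u in B receive preimages, so u keeps no unplaced conflict. The
  preimages and b form an independent set, hence edges among the images cannot conflict.\<close>

lemma valid_star:
  assumes b: "b \<in> A" and u: "u \<in> B" "\<not> g b u" and ij: "inj_on f (nb g B u)"
    and f: "\<And>x. x \<in> nb g B u \<Longrightarrow> f x \<in> A - {b} \<and> \<not> g (f x) b \<and> \<not> g (f x) x"
    and ind: "\<And>x y. x \<in> nb g B u \<Longrightarrow> y \<in> nb g B u \<Longrightarrow> \<not> g (f x) (f y)"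
  shows "\<exists>h. valid A B g (insert b (f ` nb g B u)) h \<and> h b = u \<and> (\<forall>x\<in>nb g B u. h (f x) = x) \<and>
    h ` insert b (f ` nb g B u) = insert u (nb g B u) \<and> dg g (B - insert u (nb g B u)) u = 0"
proof -
  define h where "h a = (if a = b then u else inv_into (nb g B u) f a)" for a
  let ?X = "nb g B u"
  have hb: "h b = u" by (simp add: h_def)
  have hf: "h (f x) = x" if "x \<in> ?X" for x using f[OF that] ij that by (auto simp: h_def)
  have im: "h ` insert b (f ` ?X) = insert u ?X" using hb hf by (force simp: image_iff)
  have uX: "u \<notin> ?X" using gi by auto
  have v1: "inj_on h (insert b (f ` ?X))" using hb hf uX by (auto simp: inj_on_def)
  have v2: "\<not> g a a'" if "a \<in> insert b (f ` ?X)" "a' \<in> insert b (f ` ?X)" for a a'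
  proof -
    have 1: "\<not> g b (f x)" "\<not> g (f x) b" if "x \<in> ?X" for x using f[OF that] gs[of b "f x"] by auto
    show ?thesis using that 1 ind gi[of b] by blast
  qed
  have v3: "\<not> g a (h a)" if a: "a \<in> insert b (f ` ?X)" for a
  proof (cases "a = b")
    case False
    then obtain x where "x \<in> ?X" "a = f x" using a by blast
    then show ?thesis using f[of x] hf[of x] by simp
  qed (use u hb in simp)
  have v4: "insert b (f ` ?X) \<subseteq> A" "h ` insert b (f ` ?X) \<subseteq> B" using b f u unfolding im by auto
  have "valid A B g (insert b (f ` ?X)) h" unfolding valid_def using v1 v2 v3 v4 fin by simp
  moreover have "dg g (B - insert u ?X) u = 0" using fin by (subst dg_zero_iff) auto
  moreover have "\<forall>x\<in>?X. h (f x) = x" using hf by (intro ballI)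
  ultimately show ?thesis using hb im by (intro exI[of _ h] conjI)
qed

text \<open>\<open>P x\<close> and \<open>Q x\<close> bound the inner degrees of the two members of
  the pair f x, x; these pairs are the only ones able to create edges.\<close>

lemma place_star:
  assumes b: "b \<in> A" and u: "u \<in> B" "\<not> g b u" and ij: "inj_on f (nb g B u)"
    and f: "\<And>x. x \<in> nb g B u \<Longrightarrow> f x \<in> A - {b} \<and> \<not> g (f x) b \<and> \<not> g (f x) x"
    and ind: "\<And>x y. x \<in> nb g B u \<Longrightarrow> y \<in> nb g B u \<Longrightarrow> \<not> g (f x) (f y)"
    and P: "\<And>x. x \<in> nb g B u \<Longrightarrow> dg g A (f x) \<le> P x" and Q: "\<And>x. x \<in> nb g B u \<Longrightarrow> dg g B x \<le> Q x"
    and K: "(\<Sum>x\<in>nb g B u. P x * Q x) \<le> K" and GP: "(\<Sum>x\<in>nb g B u. P x) \<le> G" and GQ: "(\<Sum>x\<in>nb g B u. Q x) \<le> G"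
    and k: "card (nb g B u) \<le> 900" and G: "G \<le> real n / 40"
    and sA: "\<And>s. s \<in> A - {b} \<Longrightarrow> 9/10 * real n < dg g B s \<Longrightarrow> (\<Sum>x\<in>{x\<in>nb g B u. g s (f x)}. Q x) \<le> 100000"
    and sB: "\<And>t. t \<in> B \<Longrightarrow> 9/10 * real n < dg g A t \<Longrightarrow> (\<Sum>x\<in>{x\<in>nb g B u. g t x}. P x) \<le> 100000"
    and big: "3 * (real (card (nb g B u)) + 1) + K + G \<le> D b"
  shows False
proof -
  let ?X = "nb g B u"
  let ?S = "insert b (f ` ?X)"
  have fX: "finite ?X" using fin by simp
  have "\<exists>h. valid A B g ?S h \<and> h b = u \<and> (\<forall>x\<in>?X. h (f x) = x) \<and> h ` ?S = insert u ?X \<and> dg g (B - insert u ?X) u = 0"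
    by (rule valid_star[OF b u ij f ind])
  then obtain h where h0: "valid A B g ?S h" "h b = u" "\<forall>x\<in>?X. h (f x) = x"
    "h ` ?S = insert u ?X" "dg g (B - insert u ?X) u = 0"
    by (elim exE conjE)
  note h = h0(1,2) bspec[OF h0(3)] h0(4,5)
  have bX: "b \<notin> f ` ?X"
  proof
    assume "b \<in> f ` ?X"
    then obtain x where "x \<in> ?X" "b = f x" by (rule imageE)
    then show False using f[of x] by simp
  qed
  have sm: "(\<Sum>a\<in>f ` ?X. F (h a)) = (\<Sum>x\<in>?X. F x)" for F :: "'a \<Rightarrow> real"
    using h(3) by (simp add: sum.reindex[OF ij])
  have smf: "(\<Sum>a\<in>{a\<in>f ` ?X. R a}. F (h a)) = (\<Sum>x\<in>{x\<in>?X. R (f x)}. F x)" for F :: "'a \<Rightarrow> real" and R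
  proof -
    have "{a\<in>f ` ?X. R a} = f ` {x\<in>?X. R (f x)}" by auto
    moreover have "inj_on f {x\<in>?X. R (f x)}" using ij by (auto simp: inj_on_def)
    ultimately show ?thesis using h(3) by (simp add: sum.reindex)
  qed
  have cS: "card ?S = card ?X + 1" using bX fX card_image[OF ij] by simp
  show False
  proof (rule reduction_heavy_bounded[OF h(1), where c = b and H = "f ` ?X" and p = "\<lambda>a. P (h a)" and q = "\<lambda>a. Q (h a)" and K = K and G = G], unfold h(4))
    show "b \<in> ?S" by simp
    show "card ?S \<le> 1000" using cS k by simp
    show "f ` ?X \<subseteq> ?S" by blast
    show "b \<notin> f ` ?X" by (rule bX)
    show "dg g (A - ?S) a = 0 \<or> dg g (B - insert u ?X) (h a) = 0" if "a \<in> ?S - f ` ?X" for a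
      using that h(2,5) by auto
    show "dg g (B - insert u ?X) (h b) = 0" using h(2,5) by simp
    show "dg g (A - ?S) a \<le> P (h a)" if a: "a \<in> f ` ?X" for a
    proof -
      obtain x where x: "x \<in> ?X" "a = f x" using a by blast
      have "dg g (A - ?S) a \<le> dg g A a" using fin by (intro dg_mono) auto
      then show ?thesis using P[OF x(1)] h(3)[OF x(1)] x(2) by simp
    qed
    show "dg g (B - insert u ?X) (h a) \<le> Q (h a)" if a: "a \<in> f ` ?X" for a
    proof -
      obtain x where x: "x \<in> ?X" "a = f x" using a by blast
      have "dg g (B - insert u ?X) x \<le> dg g B x" using fin by (intro dg_mono) auto
      then show ?thesis using Q[OF x(1)] h(3)[OF x(1)] x(2) by simp
    qed
    show "(\<Sum>a\<in>f ` ?X. P (h a) * Q (h a)) \<le> K" using sm[of "\<lambda>x. P x * Q x"] K by simp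
    show "(\<Sum>a\<in>f ` ?X. P (h a)) \<le> G" using sm[of P] GP by simp
    show "(\<Sum>a\<in>f ` ?X. Q (h a)) \<le> G" using sm[of Q] GQ by simp
    show "G \<le> real n / 40" by (rule G)
    show "3 * real (card ?S) + K + G \<le> D b" using big cS by simp
    show "(\<Sum>a\<in>{a\<in>f ` ?X. g x a}. Q (h a)) \<le> 100000" if "x \<in> A - ?S" "9/10 * real n < dg g B x" for x
    proof -
      have "x \<in> A - {b}" using that(1) by blast
      then show ?thesis unfolding smf[of Q "g x"] by (rule sA[OF _ that(2)])
    qed
    show "(\<Sum>a\<in>{a\<in>f ` ?X. g x (h a)}. P (h a)) \<le> 100000" if "x \<in> B - insert u ?X" "9/10 * real n < dg g A x" for x
    proof -
      have "(\<Sum>a\<in>{a\<in>f ` ?X. g x (h a)}. P (h a)) = (\<Sum>y\<in>{y\<in>?X. g x (h (f y))}. P y)" by (rule smf)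
      also have "{y\<in>?X. g x (h (f y))} = {y\<in>?X. g x y}" using h(3) by auto
      finally show ?thesis using sB[OF _ that(2)] that(1) by (simp only: Diff_iff)
    qed
  qed
qed

text \<open>A vertex of \<open>S3\<close> forces \<open>N > 9n/10\<close> and uses up \<open>9n/10\<close> edges between the sides, so only \<open>6n/5 - 418275 - M\<close>
  edges are left inside \<open>A\<close>.\<close>

lemma giants_leave_room:
  assumes S3: "S3 = {s\<in>A - {b}. 9/10 * real n < dg g B s}" "S3 \<noteq> {}" and b: "b \<in> A"
  shows "real (card {z\<in>A - insert b S3. \<not> (\<forall>s\<in>insert b S3. \<not> g z s) \<or> 3 < dg g A z}) \<le> 9/10 * real n - 3/4 * 418275"
    and "card S3 \<le> 2"
proof -
  let ?Z = "insert b S3"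
  have fS: "finite S3" "S3 \<subseteq> A" using fin by (auto simp: S3(1))
  have Z: "finite ?Z" "?Z \<subseteq> A" using fS b by auto
  obtain s where s: "s \<in> S3" using S3(2) by blast
  have Nb: "9/10 * real n < N" using s dA(3)[of s] by (auto simp: S3(1))
  have "real (card S3) * (9/10 * real n) = (\<Sum>s\<in>S3. 9/10 * real n)" by simp
  also have "\<dots> \<le> (\<Sum>s\<in>S3. dg g B s)" by (rule sum_mono) (auto simp: S3(1))
  also have "\<dots> \<le> (\<Sum>s\<in>A. dg g B s)" using fin fS by (intro sum_mono2) auto
  finally have e3: "real (card S3) * (9/10 * real n) \<le> (\<Sum>s\<in>A. dg g B s)" .
  have eU: "esum g V = esum g A + esum g B + 2 * (\<Sum>x\<in>A. dg g B x)" by (rule esum_Un[OF gr fin dj])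
  have "1 \<le> card S3" using s fS by (simp add: Suc_le_eq card_gt_0_iff) blast
  then have "1 * (9/10 * real n) \<le> real (card S3) * (9/10 * real n)" by (intro mult_right_mono) auto
  then have eA: "esum g A + 2 * M \<le> 24/10 * real n - 2 * 418275"
    using e3 Nb Fle eU esum_nonneg[of g B] by argo
  \<comment> \<open>Three such vertices would need 2 * 27n/10 + 2 * 9n/10 > 6n.\<close>
  have "real (card S3) * (9/10 * real n) < 3 * (9/10 * real n)"
    using e3 Nb Fle eU esum_nonneg[of g B] esum_nonneg[of g A] MN0 n_big by argo
  then have c3: "real (card S3) < 3" using n_pos by (simp add: mult_less_cancel_right)
  then show c2: "card S3 \<le> 2" by simp
  have cZ: "real (card ?Z) \<le> 3" using c2 card_insert_le_m1[of 3 S3 b] by simp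
  let ?Y = "{z\<in>A - ?Z. \<not> (\<forall>s\<in>?Z. \<not> g z s) \<or> 3 < dg g A z}"
  let ?s = "\<Sum>v\<in>A - ?Z. dg g ?Z v" and ?t = "\<Sum>v\<in>A - ?Z. dg g (A - ?Z) v"
  have "2 * ?s + ?t \<le> esum g A"
    using weight_sum[OF gr fin(1) Z(2)] by (simp add: sum.distrib sum_distrib_left[symmetric])
  moreover have "?s \<le> 3 * M"
  proof -
    have "?s = (\<Sum>z\<in>?Z. dg g (A - ?Z) z)" using fin Z by (intro dg_double_count[OF gr]) auto
    also have "\<dots> \<le> (\<Sum>z\<in>?Z. M)"
    proof (rule sum_mono)
      fix z assume "z \<in> ?Z"
      then show "dg g (A - ?Z) z \<le> M" using dA(1)[of z] Z dg_mono[of A "A - ?Z" g z] fin by force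
    qed
    also have "\<dots> = real (card ?Z) * M" by simp
    also have "\<dots> \<le> 3 * M" using cZ MN0 by (intro mult_right_mono)
    finally show ?thesis .
  qed
  \<comment> \<open>A vertex adjacent to \<open>?Z\<close> is charged 1 for that adjacency; any
    other member of \<open>?Y\<close> has at least four neighbours in A outside \<open>?Z\<close>,
    each charged 1/4.\<close>
  moreover have "real (card ?Y) \<le> ?s + ?t / 4"
  proof -
    define P where "P v \<longleftrightarrow> \<not> (\<forall>s\<in>?Z. \<not> g v s) \<or> 3 < dg g A v" for v
    have "?Y = {v\<in>A - ?Z. P v}" by (simp only: P_def)
    then have "real (card ?Y) = (\<Sum>v\<in>{v\<in>A - ?Z. P v}. 1)" by simp
    also have "\<dots> = (\<Sum>v\<in>A - ?Z. if P v then 1 else 0)" using fin by (intro sum.inter_filter) simp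
    also have "\<dots> \<le> (\<Sum>v\<in>A - ?Z. dg g ?Z v + dg g (A - ?Z) v / 4)"
    proof (rule sum_mono)
      fix v
      show "(if P v then 1 else 0) \<le> dg g ?Z v + dg g (A - ?Z) v / 4"
      proof (cases "dg g ?Z v = 0")
        case True
        then have 1: "\<forall>s\<in>?Z. \<not> g v s" using Z(1) dg_zero_iff[of ?Z g v] by blast
        have "dg g A v = dg g (A - ?Z) v" using dg_Diff[OF fin(1) Z(2), of g v] True by simp
        moreover have "3 < dg g A v \<Longrightarrow> 4 \<le> dg g A v" by (simp add: dg_def)
        moreover have "P v \<Longrightarrow> 3 < dg g A v" using 1 unfolding P_def by blast
        ultimately show ?thesis using True dg_nonneg[of g "A - ?Z" v] by force
      next
        case False
        then have "1 \<le> dg g ?Z v" by (rule dg_pos_ge_1)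
        then have "1 \<le> dg g ?Z v + dg g (A - ?Z) v / 4" using dg_nonneg[of g "A - ?Z" v] by linarith
        then show ?thesis by auto
      qed
    qed
    also have "\<dots> = ?s + ?t / 4" by (simp add: sum.distrib sum_divide_distrib)
    finally show ?thesis .
  qed
  moreover have "0 \<le> ?t" by (simp add: sum_nonneg)
  \<comment> \<open>s + t/4 equals (2s + t)/4 + s/4 + s/4. One s/4 is bounded by 3M/4, the other by
    (2s + t)/8, and all terms in \<open>M\<close> cancel.\<close>
  ultimately show "real (card ?Y) \<le> 9/10 * real n - 3/4 * 418275" using eA by linarith
qed

lemma dg_le_D: "dg g A x \<le> D x" "dg g B x \<le> D x"
  using dg_V[of x] dg_nonneg[of g A x] dg_nonneg[of g B x] by linarith+

lemma not_Big_dg: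
  assumes "x \<in> V" "x \<notin> Big" shows "dg g A x \<le> real n / 6000" "dg g B x \<le> real n / 6000"
  using not_Big[OF assms] dg_le_D[of x] by linarith+

text \<open>Three neighbours need 3 * 4 = 12 candidates. Candidates avoid the neighbours of
  \<open>S3\<close>, so vertices of cross degree above 9n/10 in A gain nothing.\<close>

lemma leaf_room:
  assumes b: "b \<in> A" "13 * real n / 6000 \<le> D b" and u: "u \<in> B" "\<not> g b u" "dg g B u \<le> 3"
    and nB: "\<And>x. x \<in> nb g B u \<Longrightarrow> x \<notin> Big"
    and S3: "S3 = {s\<in>A - {b}. 9/10 * real n < dg g B s}"
    and room: "\<And>x. x \<in> nb g B u \<Longrightarrow>
      20 \<le> card {z\<in>A - Big. \<not> g z b \<and> \<not> g z x \<and> (\<forall>s\<in>S3. \<not> g z s) \<and> dg g A z \<le> 3}"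
  shows False
proof -
  let ?X = "nb g B u" and ?T = "real n / 6000"
  let ?Ch = "\<lambda>x. {z\<in>A - Big. \<not> g z b \<and> \<not> g z x \<and> (\<forall>s\<in>S3. \<not> g z s) \<and> dg g A z \<le> 3}"
  have c3: "card ?X \<le> 3" using u(3) by (simp add: dg_def)
  have n1: "209136 \<le> real n" using n_big by simp
  have "\<exists>f. inj_on f ?X \<and> (\<forall>x\<in>?X. f x \<in> ?Ch x) \<and> (\<forall>x\<in>?X. \<forall>y\<in>?X. \<not> g (f x) (f y))"
  proof (rule choose_independent[OF gr _ fin(1), where d = 3])
    show "finite ?X" using fin by simp
    show "?Ch x \<subseteq> A" for x by blast
    show "dg g A z \<le> real 3" if "z \<in> ?Ch x" for x z using that by simp
    show "card ?X * (3 + 1) \<le> card (?Ch x)" if "x \<in> ?X" for x using room[OF that] c3 by simp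
  qed
  then obtain f where f: "inj_on f ?X" "\<forall>x\<in>?X. f x \<in> ?Ch x" "\<forall>x\<in>?X. \<forall>y\<in>?X. \<not> g (f x) (f y)"
    by (elim exE conjE)
  have fx: "f x \<in> A" "f x \<notin> Big" "\<not> g (f x) b" "\<not> g (f x) x" "\<forall>s\<in>S3. \<not> g (f x) s" "dg g A (f x) \<le> 3" if "x \<in> ?X" for x
    using bspec[OF f(2) that] by simp_all
  have bB: "b \<in> Big" using b by (simp add: heavy_def)
  have cK: "real (card ?X) * c \<le> 3 * c" if "0 \<le> c" for c :: real using c3 that by (intro mult_right_mono) auto
  have Q: "dg g B x \<le> ?T" if "x \<in> ?X" for x
    using not_Big_dg(2)[OF _ nB[OF that]] that by simp
  show False
  proof (rule place_star[OF b(1) u(1,2) f(1), where P = "\<lambda>_. 3" and Q = "\<lambda>_. ?T" and K = "9 * ?T" and G = "3 * ?T + 9"])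
    fix x assume x: "x \<in> ?X"
    show "f x \<in> A - {b} \<and> \<not> g (f x) b \<and> \<not> g (f x) x" using fx(1-4)[OF x] bB by auto
    show "dg g A (f x) \<le> 3" by (rule fx(6)[OF x])
    show "dg g B x \<le> ?T" by (rule Q[OF x])
    show "\<not> g (f x) (f y)" if "y \<in> ?X" for y using f(3) x that by simp
  next
    show "(\<Sum>x\<in>?X. 3 * ?T) \<le> 9 * ?T" using cK[of "3 * ?T"] by simp
    show "(\<Sum>x\<in>?X. 3) \<le> 3 * ?T + 9" using cK[of 3] by simp
    show "(\<Sum>x\<in>?X. ?T) \<le> 3 * ?T + 9"
    proof -
      have "real (card ?X) * ?T \<le> 3 * ?T" by (rule cK) simp
      then show ?thesis unfolding sum_constant by linarith
    qed
    show "card ?X \<le> 900" using c3 by simp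
    show "3 * ?T + 9 \<le> real n / 40" using n1 by simp
    show "3 * (real (card ?X) + 1) + 9 * ?T + (3 * ?T + 9) \<le> D b" using c3 b(2) n1 by simp
    fix s
    show "(\<Sum>x\<in>{x\<in>?X. g s (f x)}. ?T) \<le> 100000" if s: "s \<in> A - {b}" "9/10 * real n < dg g B s"
    proof -
      have "s \<in> S3" using s S3 by simp
      then have "\<not> g s (f x)" if "x \<in> ?X" for x using fx(5)[OF that] gs[of s "f x"] by blast
      then have "{x\<in>?X. g s (f x)} = {}" by auto
      then show ?thesis by (simp only: sum.empty)
    qed
    show "(\<Sum>x\<in>{x\<in>?X. g s x}. 3) \<le> (100000::real)"
    proof -
      have "card {x\<in>?X. g s x} \<le> card ?X" using fin by (intro card_mono) auto
      then show ?thesis using c3 by simp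
    qed
  qed
qed

text \<open>Nearly all vertices of \<open>R\<close> have weight at least 4, so little weight is left for \<open>B\<close>, which therefore contains
  leaves with many different neighbours. For a suitable neighbour \<open>x'\<close> of a leaf \<open>u\<close> and some \<open>z\<close> in \<open>R\<close> of small weight,
  \<open>b\<close> is placed on \<open>u\<close> and \<open>z\<close> on \<open>x'\<close>.\<close>

lemma leaf_no_room:
  assumes b: "b \<in> A" "13 * real n / 6000 \<le> D b" and x: "x \<in> B" "x \<notin> Big"
    and S3: "\<And>s. s \<in> A - {b} \<Longrightarrow> dg g B s \<le> 9/10 * real n"
    and room: "card {z\<in>A - Big. \<not> g z b \<and> \<not> g z x \<and> dg g A z \<le> 3} < 20"
  shows False
proof -
  define Z where "Z = insert x Big"
  define R where "R = A - Big - nb g A b"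
  define w where "w = wt g V Z"
  define \<rho> where "\<rho> = real (card R)"
  define WR where "WR = (\<Sum>r\<in>R. w r)"
  let ?Ch = "{z\<in>A - Big. \<not> g z b \<and> \<not> g z x \<and> dg g A z \<le> 3}"
  have n1: "209136 \<le> real n" using n_big by simp
  have bB: "b \<in> Big" using b by (simp add: heavy_def)
  have ZV: "Z \<subseteq> V" using Big_sub x by (auto simp: Z_def)
  have xA: "x \<notin> A" using x dj by blast
  have AZ: "A - Z = A - Big" using xA by (auto simp: Z_def)
  have fR: "finite R" "R \<subseteq> A" "R \<subseteq> V" using fin by (auto simp: R_def)
  have bZ: "b \<in> Z" using bB by (simp add: Z_def)
  have w0: "0 \<le> w v" for v by (simp add: w_def wt_def)
  have wD: "D v \<le> w v" for v unfolding w_def by (rule wt_D[OF ZV])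
  have w2: "2 \<le> w v" if "z \<in> Z" "g v z" for v z
    using wt_adj[OF ZV that] dg_ge_1[OF finV, of z g v] that ZV unfolding w_def by force
  have cA: "real n \<le> \<rho> + 36000 + real (card (nb g A b - Big))"
  proof -
    have "A \<subseteq> R \<union> Big \<union> (nb g A b - Big)" by (auto simp: R_def)
    then have "card A \<le> card (R \<union> Big \<union> (nb g A b - Big))" using fR Big_sub fin by (intro card_mono) auto
    also have "\<dots> \<le> card R + card Big + card (nb g A b - Big)"
      by (meson card_Un_le order_trans add_le_mono order_refl)
    finally show ?thesis using card_Big cards by (simp add: \<rho>_def)
  qed
  have "real (card (nb g A b - Big)) \<le> dg g A b" unfolding dg_def using fin by (intro of_nat_mono card_mono) auto
  then have db: "real n - \<rho> - 36000 \<le> dg g A b" using cA by simp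
  then have r0: "173132 \<le> \<rho>" using inner_bound(1)[OF b(1)] by simp
  have Mb: "real n - \<rho> - 36000 \<le> M" using db dA(1)[OF b(1)] by simp
  \<comment> \<open>On \<open>R\<close> the weight is at least 4, except for neighbours of x, where
    it is at least 2 because x lies in \<open>Z\<close>, and for fewer than 20 candidates.\<close>
  have WRl: "4 * \<rho> - 2 * N - 80 \<le> WR"
  proof -
    have "(\<Sum>r\<in>R. 4 - 2 * (if g x r then 1 else 0) - (if r \<in> ?Ch then 4 else 0)) \<le> WR"
      unfolding WR_def
    proof (rule sum_mono)
      fix r assume r: "r \<in> R"
      show "4 - 2 * (if g x r then 1 else 0) - (if r \<in> ?Ch then 4 else 0) \<le> w r"
      proof (cases "g x r")
        case True
        then have "2 \<le> w r" using w2[of x r] gs[of r x] by (simp add: Z_def)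
        then show ?thesis using True by simp
      next
        case False
        show ?thesis
        proof (cases "r \<in> ?Ch")
          case True
          then show ?thesis using False w0[of r] by simp
        next
          case nC: False
          have "r \<in> A - Big" "\<not> g r b" "\<not> g r x" using r False gs[of b r] gs[of r x] by (auto simp: R_def)
          then have "3 < dg g A r" using nC by auto
          then have "4 \<le> dg g A r" by (simp add: dg_def)
          then have "4 \<le> w r" using wD[of r] dg_V[of r] dg_nonneg[of g B r] by linarith
          then show ?thesis using False nC by simp
        qed
      qed
    qed
    moreover have "(\<Sum>r\<in>R. 4 - 2 * (if g x r then 1 else 0) - (if r \<in> ?Ch then 4 else 0)) =
      4 * \<rho> - 2 * dg g R x - (\<Sum>r\<in>R. if r \<in> ?Ch then 4 else 0)"
      using dg_sum[OF fR(1), of g x] by (simp add: sum_subtractf sum_distrib_left[symmetric] \<rho>_def)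
    moreover have "(\<Sum>r\<in>R. if r \<in> ?Ch then 4 else 0) \<le> (80::real)"
    proof -
      have "(\<Sum>r\<in>R. if r \<in> ?Ch then 4 else (0::real)) = (\<Sum>r\<in>{r\<in>R. r \<in> ?Ch}. 4)"
        using fR by (intro sum.inter_filter[symmetric])
      also have "\<dots> = real (card {r\<in>R. r \<in> ?Ch}) * 4" by (rule sum_constant)
      finally have 1: "(\<Sum>r\<in>R. if r \<in> ?Ch then 4 else (0::real)) = real (card {r\<in>R. r \<in> ?Ch}) * 4" .
      have "card {r\<in>R. r \<in> ?Ch} \<le> card ?Ch" using fin by (intro card_mono) auto
      then have "real (card {r\<in>R. r \<in> ?Ch}) \<le> 20" using room by linarith
      then show ?thesis unfolding 1 by linarith
    qed
    moreover have "dg g R x \<le> N" using dB(3)[OF x(1)] dg_mono[OF fin(1) fR(2), of g x] by linarith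
    ultimately show ?thesis by linarith
  qed
  let ?SB = "\<Sum>v\<in>B - Z. w v"
  have tot: "(\<Sum>v\<in>V - Z. w v) \<le> 6 * real n - 2 * 418275 - 2 * M - 2 * N" unfolding w_def by (rule wt_total[OF ZV])
  have split: "(\<Sum>v\<in>V - Z. w v) = ?SB + (WR + (\<Sum>v\<in>nb g A b - Big. w v))"
  proof -
    have 1: "A - Big = R \<union> (nb g A b - Big)" by (auto simp: R_def)
    have e: "V - Z = (R \<union> (nb g A b - Big)) \<union> (B - Z)" by (simp only: Un_Diff AZ 1)
    have d: "(R \<union> (nb g A b - Big)) \<inter> (B - Z) = {}" "R \<inter> (nb g A b - Big) = {}" using dj by (auto simp: R_def)
    have f: "finite R" "finite (nb g A b - Big)" "finite (B - Z)" using fin fR by simp_all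
    have "(\<Sum>v\<in>V - Z. w v) = (\<Sum>v\<in>R \<union> (nb g A b - Big). w v) + ?SB"
      unfolding e using f d(1) by (intro sum.union_disjoint) simp_all
    also have "(\<Sum>v\<in>R \<union> (nb g A b - Big). w v) = WR + (\<Sum>v\<in>nb g A b - Big. w v)"
      unfolding WR_def by (intro sum.union_disjoint f d(2))
    finally show ?thesis by linarith
  qed
  have "2 * real (card (nb g A b - Big)) = (\<Sum>v\<in>nb g A b - Big. 2)" by simp
  also have "\<dots> \<le> (\<Sum>v\<in>nb g A b - Big. w v)"
  proof (rule sum_mono)
    fix v assume "v \<in> nb g A b - Big"
    then show "2 \<le> w v" using w2[OF bZ, of v] gs[of v b] by simp
  qed
  finally have nbw: "2 * real (card (nb g A b - Big)) \<le> (\<Sum>v\<in>nb g A b - Big. w v)" .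
  have SB: "?SB \<le> 6 * real n - 2 * 418275 - 2 * M - 2 * N - WR - 2 * (real n - 36000 - \<rho>)"
    using tot split nbw cA by argo
  have SB0: "0 \<le> ?SB" "0 \<le> WR" using w0 by (auto simp: WR_def sum_nonneg)
  \<comment> \<open>These are leaves inside B: weight at most 1 rules out neighbours in
    \<open>Z\<close>, and being isolated in B would contradict \<open>isolated_pair_B\<close> for
    b.\<close>
  define Uf where "Uf = {v\<in>B - Z. w v \<le> 1}"
  define X where "X = (\<Union>u\<in>Uf. nb g B u)"
  have fU: "finite Uf" "Uf \<subseteq> B" "finite X" "X \<subseteq> B" using fin by (auto simp: Uf_def X_def)
  have Uz: "\<not> g u z" if u: "u \<in> Uf" and z: "z \<in> Z" for u z
  proof
    assume "g u z"
    then have "2 \<le> w u" by (rule w2[OF z])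
    then show False using u by (simp add: Uf_def)
  qed
  have U1: "dg g B u = 1" if u: "u \<in> Uf" for u
  proof -
    have uB: "u \<in> B" using u fU by blast
    have "w u \<le> 1" using u by (simp add: Uf_def)
    then have "dg g B u \<le> 1" using wD[of u] dg_le_D(2)[of u] by linarith
    moreover have "dg g B u \<noteq> 0"
    proof
      assume "dg g B u = 0"
      then have "D b + D u < 3" using isolated_pair_B[OF uB _ b(1)] Uz[OF u bZ] by blast
      then show False using b(2) n1 dg_nonneg[of g V u] by linarith
    qed
    ultimately show ?thesis using dg_pos_ge_1[of g B u] by linarith
  qed
  have XZ: "X \<subseteq> B - Z"
  proof
    fix y assume "y \<in> X"
    then obtain u where u: "u \<in> Uf" "y \<in> B" "g u y" by (auto simp: X_def)
    then show "y \<in> B - Z" using Uz[OF u(1), of y] by blast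
  qed
  have Xc: "2 * real (card (B - Z)) - ?SB \<le> 2 * real (card X)"
  proof -
    have fBZ: "finite (B - Z)" using fin by simp
    \<comment> \<open>Each leaf has exactly one neighbour in B, and it lies in \<open>X\<close>.
      After summation the leaves cancel against the degrees into \<open>Uf\<close>, leaving
      2|X|.\<close>
    have "(\<Sum>v\<in>B - Z. 2 - w v) \<le> (\<Sum>v\<in>B - Z. (if v \<in> Uf then 1 else 0) + (if v \<in> X then 2 else 0) - dg g Uf v)"
    proof (rule sum_mono)
      fix v assume v: "v \<in> B - Z"
      have i: "w v \<le> 1 \<or> 2 \<le> w v" using wt_int[of g V Z v 1] by (auto simp: w_def)
      have dU: "dg g Uf v \<le> w v"
        using dg_mono[OF finV le_supI2[OF fU(2)], of g v] wD[of v] by linarith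
      show "2 - w v \<le> (if v \<in> Uf then 1 else 0) + (if v \<in> X then 2 else 0) - dg g Uf v"
      proof (cases "v \<in> X")
        case True
        then show ?thesis using dU by auto
      next
        case False
        then have "\<not> g v y" if "y \<in> Uf" for y using that v gs[of v y] by (auto simp: X_def)
        then have z: "dg g Uf v = 0" using fU(1) by (simp add: dg_zero_iff)
        show ?thesis
        proof (cases "v \<in> Uf")
          case True
          then have "1 \<le> w v" using U1[OF True] wD[of v] dg_V[of v] dg_nonneg[of g A v] by linarith
          then show ?thesis using True False z by simp
        next
          case nU: False
          then have "2 \<le> w v" using i v by (auto simp: Uf_def)
          then show ?thesis using False z nU by simp
        qed
      qed
    qed
    also have "\<dots> = (\<Sum>v\<in>B - Z. if v \<in> Uf then 1 else 0) + (\<Sum>v\<in>B - Z. if v \<in> X then 2 else 0) - (\<Sum>v\<in>B - Z. dg g Uf v)"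
      by (simp add: sum.distrib sum_subtractf)
    also have "(\<Sum>v\<in>B - Z. if v \<in> Uf then 1 else 0) = (\<Sum>v\<in>{v\<in>B - Z. v \<in> Uf}. (1::real))"
      using fBZ by (intro sum.inter_filter[symmetric])
    also have "{v\<in>B - Z. v \<in> Uf} = Uf" by (auto simp: Uf_def)
    also have "(\<Sum>v\<in>B - Z. if v \<in> X then 2 else 0) = (\<Sum>v\<in>{v\<in>B - Z. v \<in> X}. (2::real))"
      using fBZ by (intro sum.inter_filter[symmetric])
    also have "{v\<in>B - Z. v \<in> X} = X" using XZ by auto
    also have "(\<Sum>v\<in>B - Z. dg g Uf v) = (\<Sum>u\<in>Uf. dg g (B - Z) u)" by (rule dg_double_count[OF gr fBZ fU(1)])
    also have "\<dots> = (\<Sum>u\<in>Uf. 1)"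
    proof (rule sum.cong[OF refl])
      fix u assume u: "u \<in> Uf"
      have "nb g (B - Z) u = nb g B u" using Uz[OF u] by auto
      then show "dg g (B - Z) u = 1" using U1[OF u] by (simp add: dg_def)
    qed
    finally show ?thesis by (simp add: sum_subtractf)
  qed
  have cB: "real n - 36001 \<le> real (card (B - Z))"
  proof -
    have "B \<subseteq> (B - Z) \<union> Z" by blast
    then have "card B \<le> card ((B - Z) \<union> Z)" using fin ZV finV finite_subset[OF ZV] by (intro card_mono) auto
    also have "\<dots> \<le> card (B - Z) + card Z" by (rule card_Un_le)
    finally have 1: "real n \<le> real (card (B - Z)) + real (card Z)" using cards by simp
    have "card Z \<le> card Big + 1" unfolding Z_def using card_insert_le_m1[of "card Big + 1" Big x] by simp
    then have "real (card Z) \<le> real (card Big) + 1" by simp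
    then show ?thesis using card_Big 1 by linarith
  qed
  define \<xi> where "\<xi> = real (card X)"
  \<comment> \<open>\<open>Mb\<close> eliminates \<open>M\<close> and n. Inserting
    \<open>WRl\<close> then cancels \<open>N\<close> and \<open>\<rho>\<close>, so the size of
    \<open>X\<close> has an absolute lower bound.\<close>
  have X1: "620548 + WR + 2 * N - 4 * \<rho> \<le> 2 * \<xi>" using Xc cB SB Mb unfolding \<xi>_def by argo
  then have X2: "310234 \<le> \<xi>" using WRl by argo
  have X3: "WR - 4 * \<rho> \<le> 2 * \<xi>" using X1 MN0 by argo
  have WRX: "WR < \<rho> * \<xi> / 4"
  proof (rule ccontr)
    assume "\<not> ?thesis"
    then have "\<rho> * (\<xi> - 16) \<le> 8 * \<xi>" using X3 by (simp add: algebra_simps)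
    moreover have "173132 * (\<xi> - 16) \<le> \<rho> * (\<xi> - 16)" using r0 X2 by (intro mult_right_mono) auto
    ultimately show False using X2 by argo
  qed
  \<comment> \<open>Two Markov bounds: less than half of \<open>X\<close> sees more than half of
    \<open>R\<close>, and at most a quarter of \<open>X\<close> exceeds 24n/|X| inside B.\<close>
  have "\<exists>x'\<in>X. dg g R x' \<le> \<rho> / 2 \<and> dg g B x' \<le> 24 * real n / \<xi>"
  proof (rule ccontr)
    assume no: "\<not> ?thesis"
    let ?b1 = "{y\<in>X. \<rho> / 2 < dg g R y}" and ?b2 = "{y\<in>X. 24 * real n / \<xi> < dg g B y}"
    have "(\<Sum>y\<in>X. dg g R y) = (\<Sum>r\<in>R. dg g X r)" by (rule dg_double_count[OF gr fU(3) fR(1)])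
    also have "\<dots> \<le> WR" unfolding WR_def
    proof (rule sum_mono)
      fix r
      show "dg g X r \<le> w r" using dg_mono[OF finV le_supI2[OF fU(4)], of g r] wD[of r] by linarith
    qed
    finally have "real (card ?b1) \<le> WR / (\<rho> / 2)" using fU r0 by (intro markov_card[of X _ "dg g R"]) auto
    also have "\<dots> < \<xi> / 2" using WRX r0 by (simp add: field_simps)
    finally have 1: "real (card ?b1) < \<xi> / 2" .
    have "(\<Sum>y\<in>X. dg g B y) \<le> (\<Sum>y\<in>V. D y)"
    proof -
      have "(\<Sum>y\<in>X. dg g B y) \<le> (\<Sum>y\<in>X. D y)" using dg_V by (intro sum_mono) simp
      also have "\<dots> \<le> (\<Sum>y\<in>V. D y)" using fU finV by (intro sum_mono2) auto
      finally show ?thesis .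
    qed
    then have "(\<Sum>y\<in>X. dg g B y) \<le> 6 * real n" using esum6 by (simp add: esum_def)
    then have "real (card ?b2) \<le> 6 * real n / (24 * real n / \<xi>)"
      using fU n1 X2 by (intro markov_card[of X _ "dg g B"]) auto
    also have "\<dots> = \<xi> / 4" using n1 X2 by (simp add: field_simps)
    finally have 2: "real (card ?b2) \<le> \<xi> / 4" .
    have "X \<subseteq> ?b1 \<union> ?b2" using no by force
    then have "card X \<le> card (?b1 \<union> ?b2)" using fU by (intro card_mono) auto
    also have "\<dots> \<le> card ?b1 + card ?b2" by (rule card_Un_le)
    finally have "\<xi> \<le> real (card ?b1) + real (card ?b2)" unfolding \<xi>_def by linarith
    then show False using 1 2 X2 by linarith
  qed
  then obtain x' where x': "x' \<in> X" "dg g R x' \<le> \<rho> / 2" "dg g B x' \<le> 24 * real n / \<xi>" by blast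
  obtain u where u: "u \<in> Uf" "x' \<in> nb g B u" using x'(1) by (auto simp: X_def)
  have "card (nb g B u) = 1" using U1[OF u(1)] by (simp add: dg_def)
  then have nbu: "nb g B u = {x'}" using u(2) by (metis card_1_singletonE singletonD)
  \<comment> \<open>At least half of \<open>R\<close> is nonadjacent to x', so some vertex there has
    at most twice the average weight \<open>WR / \<rho>\<close>.\<close>
  have "\<exists>z\<in>R - nb g R x'. w z \<le> 2 * WR / \<rho>"
  proof (rule ccontr)
    assume no: "\<not> ?thesis"
    let ?Q = "R - nb g R x'"
    have cQ: "real (card ?Q) = \<rho> - dg g R x'"
      using card_Diff_subset[of "nb g R x'" R] card_mono[of R "nb g R x'"] fR by (simp add: dg_def \<rho>_def nb_subset of_nat_diff)
    then have q: "\<rho> / 2 \<le> real (card ?Q)" using x'(2) by simp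
    then have "real (card ?Q) \<noteq> 0" using r0 by linarith
    then have "?Q \<noteq> {}" by (metis card.empty of_nat_0)
    have "finite ?Q" using fR by simp
    have "(\<Sum>z\<in>?Q. 2 * WR / \<rho>) < (\<Sum>z\<in>?Q. w z)"
    proof (rule sum_strict_mono[OF \<open>finite ?Q\<close> \<open>?Q \<noteq> {}\<close>])
      fix z assume "z \<in> ?Q"
      then have "\<not> w z \<le> 2 * WR / \<rho>" using no by (simp only: bex_simps) blast
      then show "2 * WR / \<rho> < w z" by linarith
    qed
    also have "\<dots> \<le> WR" unfolding WR_def using fR w0 by (intro sum_mono2) auto
    finally have "real (card ?Q) * (2 * WR / \<rho>) < WR" unfolding sum_constant .
    moreover have "\<rho> / 2 * (2 * WR / \<rho>) \<le> real (card ?Q) * (2 * WR / \<rho>)"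
      using q SB0 r0 by (intro mult_right_mono) auto
    moreover have "\<rho> / 2 * (2 * WR / \<rho>) = WR" using r0 by simp
    ultimately show False by linarith
  qed
  then obtain z where z: "z \<in> R" "\<not> g x' z" "w z \<le> 2 * WR / \<rho>" by auto
  have zA: "z \<in> A" "z \<notin> Big" "\<not> g b z" using z(1) by (auto simp: R_def)
  have pz: "dg g A z \<le> 2 * WR / \<rho>" "dg g A z \<le> real n / 6000"
    using wD[of z] z(3) not_Big_dg(1)[of z] zA dg_le_D(1)[of z] by auto
  have x'B: "x' \<in> B" "x' \<notin> Big" using XZ x'(1) by (auto simp: Z_def)
  have qx: "dg g B x' \<le> real n / 6000"
    using not_Big_dg(2)[of x'] x'B by simp
  have prod: "dg g A z * dg g B x' \<le> real n / 800"
  proof -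
    have "38400 * WR \<le> \<rho> * \<xi>"
    proof (cases "WR \<le> 8 * \<rho>")
      case True
      have "\<rho> * 310234 \<le> \<rho> * \<xi>" using X2 r0 by (intro mult_left_mono) auto
      then show ?thesis using True r0 by linarith
    next
      case False
      then have "WR / 4 \<le> \<xi>" using X3 by argo
      then have "173132 * (WR / 4) \<le> \<rho> * \<xi>" using r0 SB0 by (intro mult_mono) auto
      then show ?thesis using SB0 by simp
    qed
    then have "38400 * WR * real n \<le> \<rho> * \<xi> * real n" by (intro mult_right_mono) auto
    then have "2 * WR / \<rho> * (24 * real n / \<xi>) \<le> real n / 800" using r0 X2 by (simp add: field_simps)
    moreover have "dg g A z * dg g B x' \<le> 2 * WR / \<rho> * (24 * real n / \<xi>)"
      using pz(1) x'(3) SB0 r0 by (intro mult_mono) auto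
    ultimately show ?thesis by simp
  qed
  \<comment> \<open>Such a t forces N > 9n/10, hence the degree of b inside A is at most 6n/10. Then
    \<open>R\<close> is a positive fraction of A, and z has bounded degree.\<close>
  have gz: "dg g A z \<le> 100000" if t: "t \<in> B" "9/10 * real n < dg g A t" for t
  proof -
    have "dg g A b \<le> 6/10 * real n"
    proof -
      have "(\<Sum>y\<in>A. dg g B y) = (\<Sum>y\<in>B. dg g A y)" by (rule dg_double_count[OF gr fin])
      then have "dg g A t \<le> (\<Sum>y\<in>A. dg g B y)" using member_le_sum[OF t(1), of "dg g A"] fin by simp
      moreover have "2 * dg g A b \<le> esum g A"
        using esum_remove[OF gr fin(1) b(1)] esum_nonneg[of g "A - {b}"] by simp
      ultimately show ?thesis
        using esum_Un[OF gr fin dj] Fle dA(1)[OF b(1)] dB(3)[OF t(1)] t(2) esum_nonneg[of g B] by argo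
    qed
    then have "2/10 * real n \<le> \<rho>" using db n1 by argo
    moreover have "WR \<le> 6 * real n"
    proof -
      have "0 \<le> (\<Sum>v\<in>nb g A b - Big. w v)" using w0 by (simp add: sum_nonneg)
      then show ?thesis using tot split SB0 MN0 by argo
    qed
    ultimately have "2 * WR \<le> 100000 * \<rho>" using n1 by linarith
    then have "2 * WR / \<rho> \<le> 100000" using r0 by (simp add: field_simps)
    then show ?thesis using pz by simp
  qed
  show False
  proof (rule place_star[OF b(1), where u = u and f = "\<lambda>_. z" and P = "\<lambda>_. dg g A z" and Q = "\<lambda>_. dg g B x'"
        and K = "real n / 800" and G = "real n / 6000"], unfold nbu)
    show "u \<in> B" using u fU by blast
    show "\<not> g b u" using Uz[OF u(1) bZ] gs[of b u] by simp
    show "inj_on (\<lambda>_. z) {x'}" by simp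
    have "z \<noteq> b" using zA bB by blast
    then show "z \<in> A - {b} \<and> \<not> g z b \<and> \<not> g z y" if "y \<in> {x'}" for y
      using that zA z gs[of z b] gs[of z x'] by simp
    show "\<not> g z z" by (rule gi)
    show "(\<Sum>y\<in>{x'}. dg g A z * dg g B x') \<le> real n / 800" using prod by simp
    show "(\<Sum>y\<in>{x'}. dg g A z) \<le> real n / 6000" "(\<Sum>y\<in>{x'}. dg g B x') \<le> real n / 6000" using pz qx by simp_all
    show "dg g B y \<le> dg g B x'" if "y \<in> {x'}" for y using that by simp
    show "3 * (real (card {x'}) + 1) + real n / 800 + real n / 6000 \<le> D b" using b(2) n1 by simp
    show "(\<Sum>y\<in>{y\<in>{x'}. g s z}. dg g B x') \<le> 100000" if "s \<in> A - {b}" "9/10 * real n < dg g B s" for s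
      using S3[OF that(1)] that(2) by simp
    show "(\<Sum>y\<in>{y\<in>{x'}. g t y}. dg g A z) \<le> 100000" if t: "t \<in> B" "9/10 * real n < dg g A t" for t
    proof -
      have "{y\<in>{x'}. g t y} = {x'} \<or> {y\<in>{x'}. g t y} = {}" by blast
      then show ?thesis using gz[OF t] by (elim disjE) (simp_all only: sum.empty, simp)
    qed
  qed (use n1 in simp_all)
qed

text \<open>Suppose some neighbour x of u lacks candidates. Without further vertices of cross degree
  above 9n/10 in A, \<open>leaf_no_room\<close> applies; with them, \<open>giants_leave_room\<close>
  provides the candidates after all.\<close>

lemma leaf_A:
  assumes b: "b \<in> A" "13 * real n / 6000 \<le> D b" and u: "u \<in> B" "\<not> g b u" "dg g B u \<le> 3"
    and nB: "\<And>x. x \<in> nb g B u \<Longrightarrow> x \<notin> Big"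
  shows False
proof -
  define S3 where "S3 = {s\<in>A - {b}. 9/10 * real n < dg g B s}"
  let ?Ch = "\<lambda>x. {z\<in>A - Big. \<not> g z b \<and> \<not> g z x \<and> (\<forall>s\<in>S3. \<not> g z s) \<and> dg g A z \<le> 3}"
  have n1: "209136 \<le> real n" using n_big by simp
  have "\<exists>x\<in>nb g B u. card (?Ch x) < 20"
  proof (rule ccontr)
    assume "\<not> ?thesis"
    then have "20 \<le> card (?Ch x)" if "x \<in> nb g B u" for x using that by (simp add: not_less)
    then show False using leaf_room[OF b u nB S3_def] by blast
  qed
  then obtain x where x: "x \<in> nb g B u" "card (?Ch x) < 20" by (elim bexE)
  have xB: "x \<in> B" "x \<notin> Big" using x(1) nB[OF x(1)] by simp_all
  show False
  proof (cases "S3 = {}")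
    case True
    show False
    proof (rule leaf_no_room[OF b xB])
      show "dg g B s \<le> 9/10 * real n" if "s \<in> A - {b}" for s using True that by (auto simp: S3_def not_less)
      show "card {z\<in>A - Big. \<not> g z b \<and> \<not> g z x \<and> dg g A z \<le> 3} < 20" using x(2) True by simp
    qed
  next
    case False
    let ?Z = "insert b S3"
    let ?Y = "{z\<in>A - ?Z. \<not> (\<forall>s\<in>?Z. \<not> g z s) \<or> 3 < dg g A z}"
    have Y: "real (card ?Y) \<le> 9/10 * real n - 3/4 * 418275" "card S3 \<le> 2"
      using giants_leave_room[OF S3_def False b(1)] by auto
    have fS: "finite S3" using fin by (simp add: S3_def)
    have cZ: "card ?Z \<le> 3" using Y(2) card_insert_le_m1[of 3 S3 b] by simp
    have sub: "A \<subseteq> ?Z \<union> ?Y \<union> Big \<union> nb g A x \<union> ?Ch x"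
    proof
      fix z assume zA: "z \<in> A"
      show "z \<in> ?Z \<union> ?Y \<union> Big \<union> nb g A x \<union> ?Ch x"
      proof (rule ccontr)
        assume no: "\<not> ?thesis"
        then have 1: "z \<notin> ?Z" "z \<notin> ?Y" "z \<notin> Big" "\<not> g x z" using zA by auto
        then have 2: "\<forall>s\<in>?Z. \<not> g z s" "dg g A z \<le> 3" using zA by auto
        then have "z \<in> ?Ch x" using zA 1 gs[of z x] by simp
        then show False using no by blast
      qed
    qed
    have fCh: "finite (?Ch x)" "finite ?Y" using fin by auto
    have "card A \<le> card (?Z \<union> ?Y \<union> Big \<union> nb g A x \<union> ?Ch x)"
      using sub fS fCh Big_sub(2) fin by (intro card_mono) auto
    also have "\<dots> \<le> card ?Z + card ?Y + card Big + card (nb g A x) + card (?Ch x)"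
      by (meson card_Un_le order_trans add_le_mono order_refl)
    finally have "card A \<le> card ?Z + card ?Y + card Big + card (nb g A x) + card (?Ch x)" .
    then have "real n \<le> real (card ?Z) + real (card ?Y) + real (card Big) + dg g A x + real (card (?Ch x))"
      using cards unfolding dg_def by linarith
    moreover have "dg g A x \<le> real n / 6000" using not_Big_dg(1)[of x] xB by simp
    moreover have "real (card (?Ch x)) < 20" using x(2) by linarith
    moreover have "real (card ?Z) \<le> 3" using cZ by linarith
    ultimately show False using Y(1) card_Big n1 by linarith
  qed
qed

end

section \<open>All vertices of one side have small degree\<close>

definition light :: "('a \<Rightarrow> 'a \<Rightarrow> bool) \<Rightarrow> 'a set \<Rightarrow> 'a set \<Rightarrow> real \<Rightarrow> 'a set \<Rightarrow> 'a set" where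
  "light g V Z t S = {v\<in>S - Z. wt g V Z v \<le> t}"

lemma light_sub: "light g V Z t S \<subseteq> S" "light g V Z t S \<inter> Z = {}"
  by (auto simp: light_def)

lemma card_Un3_le: "card (X \<union> Y \<union> W) \<le> card X + card Y + card W"
  by (meson card_Un_le order_trans add_le_mono order_refl)

context counterexample begin

lemma wt_mono: "Z \<subseteq> Z' \<Longrightarrow> Z' \<subseteq> V \<Longrightarrow> wt g V Z v \<le> wt g V Z' v"
  using wt_eq[OF finV, of Z g v] wt_eq[OF finV, of Z' g v] dg_mono[of Z' Z g v] finV finite_subset[of Z' V] by auto

text \<open>A few bad vertices may therefore be added to \<open>Z\<close>: this only destroys
  lightness and costs 2 per vertex in the count.\<close>

lemma light_mono: "Z \<subseteq> Z' \<Longrightarrow> Z' \<subseteq> V \<Longrightarrow> light g V Z' t S \<subseteq> light g V Z t S"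
proof
  fix v assume Z: "Z \<subseteq> Z'" "Z' \<subseteq> V" and "v \<in> light g V Z' t S"
  then have "v \<in> S" "v \<notin> Z'" "wt g V Z' v \<le> t" by (simp_all add: light_def)
  then show "v \<in> light g V Z t S" using Z(1) wt_mono[OF Z, of v] by (auto simp: light_def)
qed

lemma light_count_sides:
  assumes Z: "Z \<subseteq> V"
  shows "real n + 418275 + M + N - 2 * real (card Z)
     \<le> real (card (light g V Z 3 A)) + real (card (light g V Z 3 B)) + real (card (light g V Z 1 A)) + real (card (light g V Z 1 B))"
proof -
  have s: "card {v\<in>V - Z. wt g V Z v \<le> t} \<le> card (light g V Z t A) + card (light g V Z t B)" for t
  proof -
    have "{v\<in>V - Z. wt g V Z v \<le> t} = light g V Z t A \<union> light g V Z t B" by (auto simp: light_def)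
    then show ?thesis by (simp only: card_Un_le)
  qed
  show ?thesis using light_count[OF Z] s[of 3] s[of 1] by linarith
qed

text \<open>The weight count before rounding, split by sides. It is needed where vertices of weight
  above 4 must be credited.\<close>

lemma deficit:
  assumes Z: "Z \<subseteq> V"
  shows "2 * real n + 2 * 418275 + 2 * M + 2 * N - 4 * real (card Z)
     \<le> (\<Sum>v\<in>A - Z. 4 - wt g V Z v) + (\<Sum>v\<in>B - Z. 4 - wt g V Z v)"
proof -
  have "card (V - Z) = 2 * n - card Z" using card_Diff_subset[of Z V] Z finV finite_subset cardV by fastforce
  moreover have "card Z \<le> 2 * n" using card_mono[OF finV Z] cardV by simp
  ultimately have 1: "real (card (V - Z)) = 2 * real n - real (card Z)" by (simp add: of_nat_diff)
  have "(\<Sum>v\<in>V - Z. 4 - wt g V Z v) = (\<Sum>v\<in>A - Z. 4 - wt g V Z v) + (\<Sum>v\<in>B - Z. 4 - wt g V Z v)"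
    unfolding Un_Diff using fin dj by (intro sum.union_disjoint) auto
  moreover have "(\<Sum>v\<in>V - Z. 4 - wt g V Z v) = 4 * (2 * real n - real (card Z)) - (\<Sum>v\<in>V - Z. wt g V Z v)"
    using 1 by (simp add: sum_subtractf)
  ultimately show ?thesis using wt_total[OF Z] by argo
qed

lemma lightD:
  assumes Z: "Z \<subseteq> V" and v: "v \<in> light g V Z t S"
  shows "v \<in> S" "v \<notin> Z" "D v + dg g Z v \<le> t" "D v \<le> t" "dg g A v \<le> t" "dg g B v \<le> t"
proof -
  show "v \<in> S" "v \<notin> Z" using v by (auto simp: light_def)
  show 1: "D v + dg g Z v \<le> t" using v wt_eq[OF finV Z, of g v] by (simp add: light_def)
  then show "D v \<le> t" using dg_nonneg[of g Z v] by linarith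
  then show "dg g A v \<le> t" "dg g B v \<le> t" using dg_le_D[of v] by linarith+
qed

lemma dg_two: "finite S \<Longrightarrow> x \<in> S \<Longrightarrow> y \<in> S \<Longrightarrow> x \<noteq> y \<Longrightarrow> g v x \<Longrightarrow> g v y \<Longrightarrow> 2 \<le> dg g S v"
  using dg_ge_card[of S "{x, y}" g v] by auto

text \<open>Two neighbours in \<open>Z\<close> already weigh 4.\<close>

lemma light3_unique:
  assumes Z: "Z \<subseteq> V" and v: "v \<in> light g V Z 3 S" and xy: "x \<in> Z" "y \<in> Z" "g v x" "g v y" shows "x = y"
proof (rule ccontr)
  assume ne: "x \<noteq> y"
  have fZ: "finite Z" using Z finV finite_subset by blast
  have "2 \<le> dg g Z v" using dg_two[OF fZ xy(1,2) ne xy(3,4)] .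
  moreover have "dg g Z v \<le> D v" using dg_mono[OF finV Z] .
  ultimately show False using lightD(3)[OF Z v] by linarith
qed

lemma light1_none:
  assumes Z: "Z \<subseteq> V" and v: "v \<in> light g V Z 1 S" and x: "x \<in> Z" shows "\<not> g v x"
proof
  assume "g v x"
  then have "D v + 1 \<le> wt g V Z v" "1 \<le> D v" using wt_adj[OF Z x, of v] dg_ge_1[OF finV, of x g v] Z x by auto
  then show False using v by (simp add: light_def)
qed

lemma light3_D2:
  assumes Z: "Z \<subseteq> V" and v: "v \<in> light g V Z 3 S" and x: "x \<in> Z" "g v x" shows "D v \<le> 2"
  using wt_adj[OF Z x] v by (simp add: light_def)

lemma light_fin: "finite (light g V Z t A)" "finite (light g V Z t B)"
  using fin by (auto simp: light_def)

lemma card_light_le: "real (card (light g V Z t A)) \<le> real n" "real (card (light g V Z t B)) \<le> real n"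
  using card_mono[OF fin(1) light_sub(1)[of g V Z t A]] card_mono[OF fin(2) light_sub(1)[of g V Z t B]] cards by auto

lemma leaf_light:
  assumes b: "b \<in> A" "13 * real n / 6000 \<le> D b" and Z: "Big \<subseteq> Z" "Z \<subseteq> V" and w: "w \<in> light g V Z 3 B" "\<not> g b w"
  shows "\<exists>y\<in>B \<inter> Big. g w y"
proof (rule ccontr)
  assume "\<not> ?thesis"
  then have "x \<notin> Big" if "x \<in> nb g B w" for x using that by auto
  then show False using leaf_A[OF b lightD(1)[OF Z(2) w(1)] w(2) lightD(6)[OF Z(2) w(1)]] by blast
qed

text \<open>Weight at most 1 excludes every neighbour in \<open>Z\<close>, so neither adjacency to b
  nor the heavy neighbour demanded by \<open>leaf_light\<close> is possible.\<close>

lemma light1_empty_if_heavy: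
  assumes b: "b \<in> A" "13 * real n / 6000 \<le> D b" and Z: "Big \<subseteq> Z" "Z \<subseteq> V"
  shows "light g V Z 1 B = {}"
proof (rule ccontr)
  have bBig: "b \<in> Big" using b by (simp add: heavy_def)
  assume "\<not> ?thesis"
  then obtain w where w: "w \<in> light g V Z 1 B" by blast
  then have w3: "w \<in> light g V Z 3 B" by (auto simp: light_def)
  have "\<not> g b w" using light1_none[OF Z(2) w, of b] bBig Z gs[of b w] by blast
  then obtain y where "y \<in> Big" "g w y" using leaf_light[OF b Z w3] by blast
  then show False using light1_none[OF Z(2) w, of y] Z by blast
qed

end

locale counterexample_giant = counterexample +
  fixes c :: 'a
  assumes c: "c \<in> A" "real n / 100 \<le> D c"
begin

lemma c13: "13 * real n / 6000 \<le> D c" and cBig: "c \<in> Big"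
  using c by (auto simp: heavy_def)

lemma n_large: "209136 \<le> real n" using n_big by simp

lemmas light1_B_empty = light1_empty_if_heavy[OF c(1) c13]

text \<open>w has at most two neighbours in B: a heavy one, of degree below 13n/6000, and possibly a
  nonheavy one. Their preimages come from \<open>P\<close>; \<open>choose_independent\<close> asks
  for 2 * 4 = 8 candidates.\<close>

lemma one_heavy_side_place:
  assumes beta: "\<And>y. y \<in> B \<Longrightarrow> D y < 13 * real n / 6000"
    and w: "w \<in> light g V Big 3 B" "\<not> g c w"
    and P: "P \<subseteq> light g V Big 3 A" "\<And>u. u \<in> P \<Longrightarrow> \<not> g u c"
    and giants: "\<And>s u. s \<in> A - {c} \<Longrightarrow> 9/10 * real n < dg g B s \<Longrightarrow> u \<in> P \<Longrightarrow> \<not> g s u"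
    and room: "\<And>x. x \<in> nb g B w \<Longrightarrow> 12 \<le> card {u\<in>P. \<not> g x u}"
  shows False
proof -
  let ?X = "nb g B w" and ?T = "real n / 6000"
  obtain y where y: "y \<in> B" "y \<in> Big" "g w y" using leaf_light[OF c(1) c13 order_refl Big_sub(1) w] by auto
  have wB: "w \<in> B" using lightD(1)[OF Big_sub(1) w(1)] .
  have "dg g B w \<le> 2" using light3_D2[OF Big_sub(1) w(1) y(2,3)] dg_le_D(2)[of w] by linarith
  then have cX: "card ?X \<le> 2" by (simp add: dg_def)
  have fX: "finite ?X" using fin by simp
  have Q: "D x \<le> (if x = y then 13 * ?T else ?T)" if x: "x \<in> ?X" for x
  proof (cases "x = y")
    case False
    then have "x \<notin> Big" using light3_unique[OF Big_sub(1) w(1) _ y(2)] x y(3) by auto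
    then show ?thesis using not_Big[of x] x False by simp
  next
    case True
    then show ?thesis using beta[OF y(1)] by simp
  qed
  have yX: "y \<in> ?X" using y by simp
  then have "card (?X - {y}) \<le> 1" using cX fX by simp
  then have 1: "real (card (?X - {y})) * ?T \<le> 1 * ?T" by (intro mult_right_mono) auto
  have "(\<Sum>x\<in>?X. D x) \<le> (\<Sum>x\<in>?X. if x = y then 13 * ?T else ?T)" by (intro sum_mono Q)
  also have "\<dots> = 13 * ?T + (\<Sum>x\<in>?X - {y}. ?T)"
    unfolding sum.remove[OF fX yX] by (simp add: sum.cong)
  also have "\<dots> \<le> 14 * ?T" using 1 unfolding sum_constant by linarith
  finally have sQ: "(\<Sum>x\<in>?X. D x) \<le> 14 * ?T" .
  have PA: "P \<subseteq> A" using P(1) light_sub(1)[of g V Big 3 A] by blast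
  have fP: "finite P" using finite_subset[OF PA fin(1)] .
  have P3: "dg g A u \<le> 3" "u \<notin> Big" if "u \<in> P" for u using lightD[OF Big_sub(1), of u 3 A] P(1) that by auto
  have "\<exists>f. inj_on f ?X \<and> (\<forall>x\<in>?X. f x \<in> {u\<in>P. \<not> g x u}) \<and> (\<forall>x\<in>?X. \<forall>y\<in>?X. \<not> g (f x) (f y))"
  proof (rule choose_independent[OF gr fX fin(1), where d = 3])
    show "{u\<in>P. \<not> g x u} \<subseteq> A" for x using PA by blast
    show "dg g A z \<le> real 3" if "z \<in> {u\<in>P. \<not> g x u}" for x z using that P3 by simp
    show "card ?X * (3 + 1) \<le> card {u\<in>P. \<not> g x u}" if "x \<in> ?X" for x using room[OF that] cX by simp
  qed
  then obtain f where f: "inj_on f ?X" "\<forall>x\<in>?X. f x \<in> {u\<in>P. \<not> g x u}" "\<forall>x\<in>?X. \<forall>y\<in>?X. \<not> g (f x) (f y)"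
    by (elim exE conjE)
  have fP: "f x \<in> P" "\<not> g x (f x)" if "x \<in> ?X" for x using bspec[OF f(2) that] by simp_all
  show False
  proof (rule place_star[OF c(1) wB w(2) f(1), where P = "\<lambda>_. 3" and Q = D and K = "42 * ?T" and G = "14 * ?T + 6"])
    fix x assume x: "x \<in> ?X"
    have "f x \<in> A" "f x \<noteq> c" using fP[OF x] PA P3(2) cBig by auto
    then show "f x \<in> A - {c} \<and> \<not> g (f x) c \<and> \<not> g (f x) x" using fP[OF x] P(2)[of "f x"] gs[of x "f x"] by simp
    show "dg g A (f x) \<le> 3" by (rule P3(1)[OF fP(1)[OF x]])
    show "dg g B x \<le> D x" by (rule dg_le_D)
    show "\<not> g (f x) (f y)" if "y \<in> ?X" for y using f(3) x that by simp
  next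
    have "(\<Sum>x\<in>?X. 3 * D x) = 3 * (\<Sum>x\<in>?X. D x)" by (rule sum_distrib_left[symmetric])
    then show "(\<Sum>x\<in>?X. 3 * D x) \<le> 42 * ?T" using sQ by linarith
    have c2: "real (card ?X) \<le> 2" using cX by simp
    then show "(\<Sum>x\<in>?X. 3) \<le> 14 * ?T + 6" using n_large by simp
    show "(\<Sum>x\<in>?X. D x) \<le> 14 * ?T + 6" using sQ by simp
    show "card ?X \<le> 900" using cX by simp
    show "14 * ?T + 6 \<le> real n / 40" using n_large by simp
    show "3 * (real (card ?X) + 1) + 42 * ?T + (14 * ?T + 6) \<le> D c" using c2 c(2) n_large by argo
    fix s
    show "(\<Sum>x\<in>{x\<in>?X. g s (f x)}. D x) \<le> 100000" if s: "s \<in> A - {c}" "9/10 * real n < dg g B s"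
    proof -
      have "\<not> g s (f x)" if "x \<in> ?X" for x using giants[OF s fP(1)[OF that]] .
      then have "{x\<in>?X. g s (f x)} = {}" by auto
      then show ?thesis by (simp only: sum.empty)
    qed
    show "(\<Sum>x\<in>{x\<in>?X. g s x}. 3) \<le> (100000::real)"
    proof -
      have "card {x\<in>?X. g s x} \<le> card ?X" using fin by (intro card_mono) auto
      then show ?thesis using cX by simp
    qed
  qed
qed

text \<open>A light vertex of B adjacent to c' is not adjacent to c, so it would have a heavy
  neighbour in B besides c'. Hence the light vertices of B avoid the neighbourhood of c', and the
  vertices of weight at most 1 must make up the loss in the count.\<close>

lemma giant_light:
  assumes R: "\<And>w. w \<in> light g V Big 3 B \<Longrightarrow> g c w \<Longrightarrow> g c' w \<Longrightarrow> False"
    and c': "c' \<in> A" "9/10 * real n < dg g B c'" "13 * real n / 6000 \<le> D c'"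
  shows "8/10 * real n \<le> real (card (light g V Big 1 A))"
proof -
  have c'B: "c' \<in> Big" using c' by (simp add: heavy_def)
  have "\<not> g c' w" if w: "w \<in> light g V Big 3 B" for w
  proof
    assume gw: "g c' w"
    then have "\<not> g c w" using R[OF w] by blast
    then obtain y where y: "y \<in> B" "y \<in> Big" "g w y" using leaf_light[OF c(1) c13 order_refl Big_sub(1) w] by auto
    have "c' = y" using light3_unique[OF Big_sub(1) w c'B y(2) _ y(3)] gw gs[of c' w] by blast
    then show False using c'(1) y(1) dj by blast
  qed
  then have "light g V Big 3 B \<inter> nb g B c' = {}" by auto
  moreover have "light g V Big 3 B \<union> nb g B c' \<subseteq> B" using light_sub(1)[of g V Big 3 B] by auto
  ultimately have "card (light g V Big 3 B) + card (nb g B c') \<le> n"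
    using card_Un_disjoint[OF light_fin(2) finite_nb[OF fin(2)], of Big 3 g c'] card_mono[OF fin(2)] cards by metis
  then have "real (card (light g V Big 3 B)) + dg g B c' \<le> real n" unfolding dg_def by linarith
  moreover have "9/10 * real n < N" using c'(2) dA(3)[OF c'(1)] by linarith
  ultimately show ?thesis
    using light_count_sides[OF Big_sub(1)] light1_B_empty[OF order_refl Big_sub(1)] card_light_le(1)[of Big 3] card_Big c'(2) MN0 by simp
qed

lemma one_heavy_side_light_adjacent:
  assumes beta: "\<And>y. y \<in> B \<Longrightarrow> D y < 13 * real n / 6000" and w: "w \<in> light g V Big 3 B"
  shows "g c w"
proof (rule ccontr)
  assume nw: "\<not> g c w"
  define P where "P = {u\<in>light g V Big 3 A. \<not> g u c}"
  have F1P: "light g V Z 1 A \<subseteq> P" if Z: "Big \<subseteq> Z" "Z \<subseteq> V" for Z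
  proof
    fix u assume u: "u \<in> light g V Z 1 A"
    then have "u \<in> light g V Z 3 A" by (auto simp: light_def)
    then have "u \<in> light g V Big 3 A" using light_mono[OF Z] by blast
    moreover have "\<not> g u c" using light1_none[OF Z(2) u] cBig Z(1) by blast
    ultimately show "u \<in> P" by (simp add: P_def)
  qed
  have PA: "P \<subseteq> A" "finite P" using light_sub(1)[of g V Big 3 A] light_fin(1) by (auto simp: P_def)
  show False
  proof (cases "\<exists>s\<in>A - {c}. 9/10 * real n < dg g B s")
    case True
    then obtain c' where c': "c' \<in> A" "c' \<noteq> c" "9/10 * real n < dg g B c'" by auto
    have "13 * real n / 6000 \<le> D c'" using c'(3) dg_le_D(2)[of c'] by linarith
    note c'D = this
    then have c'B: "c' \<in> Big" using c'(1) by (simp add: heavy_def)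
    let ?F = "light g V Big 1 A"
    have F: "8/10 * real n \<le> real (card ?F)"
    proof (rule giant_light[OF _ c'(1,3) c'D])
      fix v assume v: "v \<in> light g V Big 3 B" "g c v" "g c' v"
      then have "g v c" "g v c'" using gs[of c v] gs[of c' v] by auto
      then show False using light3_unique[OF Big_sub(1) v(1) c'B cBig] c'(2) by blast
    qed
    show False
    proof (rule one_heavy_side_place[OF beta w nw, of ?F])
      show "?F \<subseteq> light g V Big 3 A" by (auto simp: light_def)
      show "\<not> g u c" if "u \<in> ?F" for u using light1_none[OF Big_sub(1) that cBig] .
      show "\<not> g s u" if s: "s \<in> A - {c}" "9/10 * real n < dg g B s" "u \<in> ?F" for s u
      proof -
        have "s \<in> Big" using s dg_le_D(2)[of s] by (simp add: heavy_def)
        then show ?thesis using light1_none[OF Big_sub(1) s(3)] gs[of s u] by blast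
      qed
      show "12 \<le> card {u\<in>?F. \<not> g x u}" if x: "x \<in> nb g B w" for x
      proof -
        have "?F \<subseteq> {u\<in>?F. \<not> g x u} \<union> nb g A x" using light_sub(1)[of g V Big 1 A] by auto
        then have "card ?F \<le> card ({u\<in>?F. \<not> g x u} \<union> nb g A x)" using light_fin(1) fin by (intro card_mono) auto
        also have "\<dots> \<le> card {u\<in>?F. \<not> g x u} + card (nb g A x)" by (rule card_Un_le)
        finally have "real (card ?F) \<le> real (card {u\<in>?F. \<not> g x u}) + dg g A x" unfolding dg_def by linarith
        moreover have "dg g A x \<le> 13 * real n / 6000" using beta[of x] x dg_le_D(1)[of x] by simp
        ultimately have "12 \<le> real (card {u\<in>?F. \<not> g x u})" using F n_large by linarith
        then show ?thesis by linarith
      qed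
    qed
  next
    case False
    \<comment> \<open>Vertices of B adjacent to nearly all of \<open>P\<close> are the only
      obstruction to placing c. Members of \<open>P\<close> have degree at most 3, so there are at
      most three such vertices.\<close>
    define K where "K = {t\<in>B. card {u\<in>P. \<not> g t u} < 12}"
    have fK: "finite K" "K \<subseteq> B" using fin by (auto simp: K_def)
    have cov: "\<exists>t\<in>K. g v t" if v: "v \<in> light g V Big 3 B" "\<not> g c v" for v
    proof (rule ccontr)
      assume no: "\<not> ?thesis"
      show False
      proof (rule one_heavy_side_place[OF beta v, of P])
        show "P \<subseteq> light g V Big 3 A" by (auto simp: P_def)
        show "\<not> g u c" if "u \<in> P" for u using that by (simp add: P_def)
        show "\<not> g s u" if "s \<in> A - {c}" "9/10 * real n < dg g B s" "u \<in> P" for s u using False that(1,2) by blast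
        show "12 \<le> card {u\<in>P. \<not> g x u}" if "x \<in> nb g B v" for x using no that by (auto simp: K_def not_less)
      qed
    qed
    have star': "real n + 418275 + M + N - 2 * real (card Z) \<le>
        real (card (light g V Z 3 A)) + real (card (light g V Z 3 B)) + real (card (light g V Z 1 A))"
      if Z: "Big \<subseteq> Z" "Z \<subseteq> V" for Z
      using light_count_sides[OF Z(2)] light1_B_empty[OF Z] by simp
    \<comment> \<open>If almost nothing of \<open>P\<close> stays light for an enlarged
      \<open>Z\<close>, the light vertices of A are essentially neighbours of c, about M of them,
      and the count fails.\<close>
    have few: False if Z: "Big \<subseteq> Z" "Z \<subseteq> V" "real (card Z) \<le> 36010" and f: "real (card (P \<inter> light g V Z 3 A)) \<le> 60" for Z
    proof -
      have "light g V Z 3 A \<subseteq> nb g A c \<union> (P \<inter> light g V Z 3 A)"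
        using light_mono[OF Z(1,2), of 3 A] light_sub(1)[of g V Z 3 A] gs by (auto simp: P_def)
      then have "card (light g V Z 3 A) \<le> card (nb g A c \<union> (P \<inter> light g V Z 3 A))" using fin PA by (intro card_mono) auto
      also have "\<dots> \<le> card (nb g A c) + card (P \<inter> light g V Z 3 A)" by (rule card_Un_le)
      finally have 1: "real (card (light g V Z 3 A)) \<le> dg g A c + real (card (P \<inter> light g V Z 3 A))" unfolding dg_def by linarith
      have "light g V Z 1 A \<subseteq> P \<inter> light g V Z 3 A" using F1P[OF Z(1,2)] by (auto simp: light_def)
      then have "card (light g V Z 1 A) \<le> card (P \<inter> light g V Z 3 A)" using PA by (intro card_mono) auto
      then have 2: "real (card (light g V Z 1 A)) \<le> real (card (P \<inter> light g V Z 3 A))" by simp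
      show False using star'[OF Z(1,2)] 1 2 f Z(3) card_light_le(2)[of Z 3] dA(1)[OF c(1)] MN0 by linarith
    qed
    have P60: "60 < card P"
    proof (rule ccontr)
      assume "\<not> ?thesis"
      moreover have "card (P \<inter> light g V Big 3 A) \<le> card P" using PA by (intro card_mono) auto
      ultimately show False using few[OF order_refl Big_sub(1)] card_Big by simp
    qed
    have K3: "card K \<le> 3"
    proof -
      have 1: "real (card P) - 11 \<le> dg g P t" if "t \<in> K" for t
      proof -
        have "P \<subseteq> {u\<in>P. \<not> g t u} \<union> nb g P t" by auto
        then have "card P \<le> card ({u\<in>P. \<not> g t u} \<union> nb g P t)" using PA by (intro card_mono) auto
        also have "\<dots> \<le> card {u\<in>P. \<not> g t u} + card (nb g P t)" by (rule card_Un_le)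
        finally show ?thesis using that unfolding dg_def K_def by auto
      qed
      have "real (card K) * (real (card P) - 11) = (\<Sum>t\<in>K. real (card P) - 11)" by (simp only: sum_constant)
      also have "\<dots> \<le> (\<Sum>t\<in>K. dg g P t)" by (intro sum_mono 1)
      also have "\<dots> = (\<Sum>u\<in>P. dg g K u)" by (rule dg_double_count[OF gr fK(1) PA(2)])
      also have "\<dots> \<le> (\<Sum>u\<in>P. 3)"
      proof (rule sum_mono)
        fix u assume "u \<in> P"
        then have "dg g B u \<le> 3" using lightD(6)[OF Big_sub(1), of u 3 A] by (simp add: P_def)
        then show "dg g K u \<le> 3" using dg_mono[OF fin(2) fK(2), of g u] by linarith
      qed
      finally have s: "real (card K) * (real (card P) - 11) \<le> 3 * real (card P)" by simp
      show ?thesis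
      proof (rule ccontr)
        assume "\<not> ?thesis"
        then have "4 \<le> real (card K)" by simp
        then have "4 * (real (card P) - 11) \<le> real (card K) * (real (card P) - 11)" using P60 by (intro mult_right_mono) auto
        moreover have "60 < real (card P)" using P60 by simp
        ultimately show False using s by argo
      qed
    qed
    define Z where "Z = Big \<union> K"
    have Z: "Big \<subseteq> Z" "Z \<subseteq> V" using Big_sub fK by (auto simp: Z_def)
    have "card Z \<le> card Big + card K" unfolding Z_def by (rule card_Un_le)
    then have cZ: "real (card Z) \<le> 36010" using card_Big K3 by linarith
    obtain t where t: "t \<in> K" using cov[OF w nw] by blast
    have small: "real (card {u\<in>P. \<not> g t u}) \<le> 11" if "t \<in> K" for t using that by (auto simp: K_def)
    show False
    proof (cases "\<exists>t'\<in>K. t' \<noteq> t")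
      case True
      then obtain t' where t': "t' \<in> K" "t' \<noteq> t" by blast
      have "P \<inter> light g V Z 3 A \<subseteq> {u\<in>P. \<not> g t u} \<union> {u\<in>P. \<not> g t' u}"
      proof
        fix u assume u: "u \<in> P \<inter> light g V Z 3 A"
        have "\<not> (g u t \<and> g u t')" using light3_unique[OF Z(2), of u A t t'] u t t' by (auto simp: Z_def)
        then show "u \<in> {u\<in>P. \<not> g t u} \<union> {u\<in>P. \<not> g t' u}" using u gs[of u t] gs[of u t'] by auto
      qed
      then have "card (P \<inter> light g V Z 3 A) \<le> card ({u\<in>P. \<not> g t u} \<union> {u\<in>P. \<not> g t' u})" using PA by (intro card_mono) auto
      also have "\<dots> \<le> card {u\<in>P. \<not> g t u} + card {u\<in>P. \<not> g t' u}" by (rule card_Un_le)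
      finally have "real (card (P \<inter> light g V Z 3 A)) \<le> 60" using small[OF t] small[OF t'(1)] by linarith
      then show False by (rule few[OF Z cZ])
    next
      case Kt: False
      \<comment> \<open>With t in \<open>Z\<close> hardly any vertex of A has weight at most 1, and
        every light vertex of B is adjacent to c or to t, giving at most N + M of them.\<close>
      have "light g V Z 1 A \<subseteq> {u\<in>P. \<not> g t u}"
      proof
        fix u assume u: "u \<in> light g V Z 1 A"
        have "\<not> g u t" using light1_none[OF Z(2) u] t by (auto simp: Z_def)
        then show "u \<in> {u\<in>P. \<not> g t u}" using F1P[OF Z] u gs[of t u] by auto
      qed
      then have "card (light g V Z 1 A) \<le> card {u\<in>P. \<not> g t u}" using PA by (intro card_mono) auto
      then have 1: "real (card (light g V Z 1 A)) \<le> 11" using small[OF t] by linarith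
      have "light g V Z 3 B \<subseteq> nb g B c \<union> nb g B t"
      proof
        fix v assume v: "v \<in> light g V Z 3 B"
        have vL: "v \<in> light g V Big 3 B" using light_mono[OF Z] v by blast
        have "g c v \<or> g t v"
        proof (rule ccontr)
          assume no: "\<not> ?thesis"
          then obtain t' where t': "t' \<in> K" "g v t'" using cov[OF vL] by blast
          then have "t' = t" using Kt by blast
          then show False using no t'(2) gs[of v t] by blast
        qed
        then show "v \<in> nb g B c \<union> nb g B t" using lightD(1)[OF Z(2) v] by auto
      qed
      then have "card (light g V Z 3 B) \<le> card (nb g B c \<union> nb g B t)" using fin by (intro card_mono) auto
      also have "\<dots> \<le> card (nb g B c) + card (nb g B t)" by (rule card_Un_le)
      finally have "real (card (light g V Z 3 B)) \<le> dg g B c + dg g B t" unfolding dg_def by linarith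
      then show False using star'[OF Z] 1 cZ card_light_le(1)[of Z 3] dA(3)[OF c(1)] dB(1)[of t] t fK by force
    qed
  qed
qed

end

section \<open>Absorbing the neighbours of the image of c by leaves\<close>

lemma dg_less: "dg g S x < real (k + 1) \<Longrightarrow> dg g S x \<le> real k"
  unfolding dg_def by (simp only: of_nat_less_iff of_nat_le_iff)

context counterexample_giant begin

text \<open>If u were isolated in A, \<open>isolated_pair\<close> would bound the degree of its
  nonneighbours in B by 2. A nonheavy one that is also nonadjacent to c would be light, against
  \<open>one_heavy_side_light_adjacent\<close>.\<close>

lemma light1_A_leaf:
  assumes beta: "\<And>y. y \<in> B \<Longrightarrow> D y < 13 * real n / 6000" and u: "u \<in> light g V Big 1 A"
  shows "dg g A u = 1" "dg g B u = 0"
proof -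
  have uA: "u \<in> A" and Du: "D u \<le> 1" using lightD(1,4)[OF Big_sub(1) u] .
  have "dg g A u \<noteq> 0"
  proof
    assume 0: "dg g A u = 0"
    have "\<not> B \<subseteq> nb g B c \<union> nb g B u \<union> Big"
    proof
      assume "B \<subseteq> nb g B c \<union> nb g B u \<union> Big"
      then have "card B \<le> card (nb g B c \<union> nb g B u \<union> Big)" using fin Big_sub by (intro card_mono) auto
      also have "\<dots> \<le> card (nb g B c) + card (nb g B u) + card Big" by (rule card_Un3_le)
      finally have "real n \<le> dg g B c + dg g B u + real (card Big)" using cards unfolding dg_def by linarith
      then show False using cross_bound(1)[OF c(1)] dg_le_D(2)[of u] Du card_Big by linarith
    qed
    then obtain w where "w \<in> B" "w \<notin> nb g B c \<union> nb g B u \<union> Big" by blast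
    then have w: "w \<in> B" "\<not> g c w" "\<not> g u w" "w \<notin> Big" by simp_all
    have "D w < 3" using isolated_pair[OF uA 0 w(1,3)] dg_nonneg[of g V u] by linarith
    then have Dw: "D w \<le> 2" using dg_less[of g V w 2] by simp
    have "dg g B w \<noteq> 0"
    proof
      assume "dg g B w = 0"
      then have "D c + D w < 3" using isolated_pair_B[OF w(1) _ c(1)] w(2) gs[of w c] by blast
      then show False using c(2) n_large dg_nonneg[of g V w] by linarith
    qed
    then obtain y where y: "y \<in> B" "g w y" using fin dg_zero_iff[of B g w] by blast
    have yB: "y \<notin> Big"
    proof
      assume yB: "y \<in> Big"
      then have "\<not> g u y" by (rule light1_none[OF Big_sub(1) u])
      then have "D y + D u < 3" by (rule isolated_pair[OF uA 0 y(1)])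
      then show False using yB n_large dg_nonneg[of g V u] by (auto simp: heavy_def)
    qed
    have "1 \<le> dg g (V - Big) w" using y yB finV by (intro dg_ge_1[of _ y]) auto
    then have "dg g Big w \<le> 1" using dg_Diff[OF finV Big_sub(1), of g w] Dw by linarith
    then have "wt g V Big w \<le> 3" using wt_eq[OF finV Big_sub(1), of g w] Dw by linarith
    then have "w \<in> light g V Big 3 B" using w by (simp add: light_def)
    then show False using one_heavy_side_light_adjacent[OF beta] w(2) by blast
  qed
  then have "1 \<le> dg g A u" by (rule dg_pos_ge_1)
  then show "dg g A u = 1" "dg g B u = 0" using Du dg_V[of u] dg_nonneg[of g B u] by linarith+
qed

lemma one_heavy_side_false:
  assumes beta: "\<And>y. y \<in> B \<Longrightarrow> D y < 13 * real n / 6000"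
  shows False
proof -
  let ?F = "light g V Big 1 A" and ?T = "real n / 6000"
  define W where "W = B - nb g B c - Big"
  have fW: "finite W" "W \<subseteq> B" using fin by (auto simp: W_def)
  have "B \<subseteq> W \<union> nb g B c \<union> Big" by (auto simp: W_def)
  then have "card B \<le> card (W \<union> nb g B c \<union> Big)" using fin fW Big_sub by (intro card_mono) auto
  also have "\<dots> \<le> card W + card (nb g B c) + card Big" by (rule card_Un3_le)
  finally have "real n \<le> real (card W) + dg g B c + real (card Big)" using cards unfolding dg_def by linarith
  then have cW: "173136 \<le> real (card W)" using cross_bound(1)[OF c(1)] card_Big by linarith
  then have "W \<noteq> {}" by auto
  \<comment> \<open>With minimal degree, w needs no more preimages than the degree of any vertex of
    \<open>W\<close>. A large minimum makes all of \<open>W\<close> heavy in weight, which leaves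
    more leaves in A.\<close>
  then have "\<exists>w\<in>W. \<forall>v\<in>W. D w \<le> D v"
    using Min_in[of "D ` W"] Min_le[of "D ` W"] fW by fastforce
  then obtain w where w: "w \<in> W" "\<forall>v\<in>W. D w \<le> D v" by blast
  have wB: "w \<in> B" "\<not> g c w" "w \<notin> Big" using w(1) by (auto simp: W_def)
  define \<mu> where "\<mu> = max 4 (D w)"
  have mu: "4 \<le> \<mu>" "D w \<le> \<mu>" by (auto simp: \<mu>_def)
  have muW: "(\<mu> - 4) * 173136 \<le> (\<mu> - 4) * real (card W)" using cW mu by (intro mult_left_mono) auto
  have Wwt: "\<mu> \<le> wt g V Z v" if Z: "Big \<subseteq> Z" "Z \<subseteq> V" and v: "v \<in> W" for Z v
  proof -
    have vv: "v \<in> B" "v \<notin> Big" "\<not> g c v" using v by (auto simp: W_def)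
    have "v \<notin> light g V Big 3 B" using one_heavy_side_light_adjacent[OF beta] vv(3) by blast
    then have "3 < wt g V Big v" using vv by (simp add: light_def)
    then have "4 \<le> wt g V Big v" using wt_int[of g V Big v 3] by force
    then have "4 \<le> wt g V Z v" using wt_mono[OF Z, of v] by linarith
    moreover have "D w \<le> wt g V Z v" using wt_D[OF Z(2), of v] bspec[OF w(2) v] by linarith
    ultimately show ?thesis by (simp add: \<mu>_def)
  qed
  have bside: "(\<Sum>v\<in>B - Z. 4 - wt g V Z v) \<le> e * dg g B c - (\<mu> - 4) * real (card W)"
    if Z: "Big \<subseteq> Z" "Z \<subseteq> V" "Z \<inter> B \<subseteq> Big" and e: "0 \<le> e" "\<And>v. v \<in> B - Z \<Longrightarrow> g c v \<Longrightarrow> 4 - wt g V Z v \<le> e" for Z and e :: real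
  proof -
    have eq: "B - Z = (nb g B c - Z) \<union> W" using Z(1,3) by (auto simp: W_def)
    have d: "(nb g B c - Z) \<inter> W = {}" by (auto simp: W_def)
    have "(\<Sum>v\<in>B - Z. 4 - wt g V Z v) = (\<Sum>v\<in>nb g B c - Z. 4 - wt g V Z v) + (\<Sum>v\<in>W. 4 - wt g V Z v)"
      unfolding eq using fin fW d by (intro sum.union_disjoint) auto
    also have "(\<Sum>v\<in>nb g B c - Z. 4 - wt g V Z v) \<le> (\<Sum>v\<in>nb g B c - Z. e)"
      by (rule sum_mono) (simp add: e(2))
    also have "\<dots> = real (card (nb g B c - Z)) * e" by (rule sum_constant)
    also have "\<dots> \<le> dg g B c * e" unfolding dg_def using fin e(1) by (intro mult_right_mono of_nat_mono card_mono) auto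
    also have "(\<Sum>v\<in>W. 4 - wt g V Z v) \<le> (\<Sum>v\<in>W. 4 - \<mu>)" using Wwt[OF Z(1,2)] by (intro sum_mono) simp
    also have "\<dots> = real (card W) * (4 - \<mu>)" by (rule sum_constant)
    finally show ?thesis by (simp add: algebra_simps)
  qed
  have c2: "4 - wt g V Z v \<le> 2" if "Big \<subseteq> Z" "Z \<subseteq> V" "g c v" for Z v
    using wt_adj[OF that(2), of c v] that cBig gs[of v c] dg_ge_1[OF finV, of c g v] c(1) by auto
  have leaf: "dg g A u = 1" "dg g B u = 0" if "u \<in> ?F" for u by (rule light1_A_leaf[OF _ that], rule beta, assumption)+
  have FA: "?F \<subseteq> A" "finite ?F" using light_sub(1)[of g V Big 1 A] light_fin(1) by auto
  have Fno: "\<not> g u z" "\<not> g z u" if "u \<in> ?F" "z \<in> Big" for u z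
    using light1_none[OF Big_sub(1) that] gs[of z u] by auto
  have aside: "(\<Sum>v\<in>A - Big. 4 - wt g V Big v) \<le> 3 * real n"
  proof -
    have "(\<Sum>v\<in>A - Big. 4 - wt g V Big v) \<le> (\<Sum>v\<in>A - Big. 3)"
    proof (rule sum_mono)
      fix v assume v: "v \<in> A - Big"
      show "4 - wt g V Big v \<le> 3"
      proof (rule ccontr)
        assume "\<not> ?thesis"
        then have "v \<in> ?F" using v by (simp add: light_def)
        then have "1 \<le> wt g V Big v" using leaf(1)[of v] dg_le_D(1)[of v] wt_D[OF Big_sub(1), of v] by linarith
        then show False using \<open>\<not> 4 - wt g V Big v \<le> 3\<close> by linarith
      qed
    qed
    also have "\<dots> = real (card (A - Big)) * 3" by (rule sum_constant)
    also have "\<dots> \<le> real n * 3" using fin card_mono[of A "A - Big"] cards by auto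
    finally show ?thesis by simp
  qed
  \<comment> \<open>The number of pairs placed may grow with n, up to about 13n/6000, so the
    constant slack of \<open>inner_bound\<close> and \<open>cross_bound\<close> is not enough and
    bounds of n/2 take its place.\<close>
  have Mn: "M \<le> real n / 2"
  proof -
    have "(\<Sum>v\<in>B - Big. 4 - wt g V Big v) \<le> 2 * dg g B c - (\<mu> - 4) * real (card W)"
      by (rule bside[OF order_refl Big_sub(1) Int_lower1]) (simp_all add: c2[OF order_refl Big_sub(1)])
    then show ?thesis using deficit[OF Big_sub(1)] aside dA(3)[OF c(1)] card_Big muW mu MN0 by argo
  qed
  have Nn: "N \<le> real n / 2" if x: "x \<in> A" "x \<noteq> c" "13 * real n / 6000 \<le> D x" for x
  proof -
    have xB: "x \<in> Big" using x by (simp add: heavy_def)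
    \<comment> \<open>A light v is adjacent to c, hence to no other heavy vertex. Not being adjacent
      to x, it would still need a heavy neighbour in B.\<close>
    have "v \<notin> light g V Big 3 B" for v
    proof
      assume v: "v \<in> light g V Big 3 B"
      have gv: "g v c" using one_heavy_side_light_adjacent[OF beta v] gs[of v c] by blast
      then have "\<not> g x v" using light3_unique[OF Big_sub(1) v xB cBig] x(2) gs[of x v] by blast
      then obtain y where y: "y \<in> B" "y \<in> Big" "g v y" using leaf_light[OF x(1,3) order_refl Big_sub(1) v] by auto
      have "y = c" using light3_unique[OF Big_sub(1) v y(2) cBig y(3) gv] .
      then show False using y(1) c(1) dj by blast
    qed
    then have "4 - wt g V Big v \<le> 0" if "v \<in> B - Big" for v
      using that wt_int[of g V Big v 3] by (force simp: light_def)
    then have "(\<Sum>v\<in>B - Big. 4 - wt g V Big v) \<le> 0 * dg g B c - (\<mu> - 4) * real (card W)"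
      by (intro bside[OF order_refl Big_sub(1) Int_lower1]) simp_all
    then show ?thesis using deficit[OF Big_sub(1)] aside card_Big muW mu MN0 by argo
  qed
  let ?X = "nb g B w"
  have fX: "finite ?X" using fin by simp
  have cX: "real (card ?X) \<le> D w" using dg_le_D(2)[of w] by (simp add: dg_def)
  \<comment> \<open>Independent leaves with pairwise different neighbours: an unplaced vertex of A
    then gains cross edges from at most one of them.\<close>
  define Gd where "Gd S \<longleftrightarrow> S \<subseteq> ?F \<and> (\<forall>u\<in>S. \<forall>u'\<in>S. \<not> g u u') \<and> (\<forall>u\<in>S. \<forall>u'\<in>S. \<forall>x\<in>A. g u x \<and> g u' x \<longrightarrow> u = u')" for S
  have ext: "\<exists>S. Gd S \<and> card S = k" if "k \<le> card ?X" for k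
    using that
  proof (induction k)
    case 0
    show ?case by (intro exI[of _ "{}"]) (simp add: Gd_def)
  next
    case (Suc k)
    then obtain S where S: "Gd S" "card S = k" by auto
    have SF: "S \<subseteq> ?F" using S(1) by (simp add: Gd_def)
    then have fS: "finite S" using FA finite_subset by blast
    define Y where "Y = (\<Union>s\<in>S. nb g A s)"
    have fY: "finite Y" "Y \<subseteq> A" using fS fin by (auto simp: Y_def)
    have "card Y \<le> (\<Sum>s\<in>S. card (nb g A s))" unfolding Y_def using fS by (rule card_UN_le)
    also have "\<dots> = (\<Sum>s\<in>S. 1)" using leaf(1) SF by (intro sum.cong) (auto simp: dg_def)
    finally have cY: "card Y \<le> k" using S(2) by simp
    \<comment> \<open>A vertex of weight at most 1 for this \<open>Z\<close> is a leaf that misses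
      \<open>S\<close> and has its neighbour outside \<open>Y\<close>. The growth of
      \<open>Z\<close> by at most 2k, with k \<le> \<mu>, is paid for by (\<mu> - 4)|W| and the
      additive constant.\<close>
    define Z where "Z = Big \<union> S \<union> Y"
    have Z: "Big \<subseteq> Z" "Z \<subseteq> V" "Z \<inter> B \<subseteq> Big" using Big_sub SF FA fY dj by (auto simp: Z_def)
    have "card Z \<le> card Big + card S + card Y" unfolding Z_def by (rule card_Un3_le)
    then have cZ: "real (card Z) \<le> 36000 + 2 * real k" using card_Big cY S(2) by linarith
    have "\<exists>v\<in>A - Z. \<not> 4 - wt g V Z v \<le> 2"
    proof (rule ccontr)
      assume no: "\<not> ?thesis"
      have "(\<Sum>v\<in>A - Z. 4 - wt g V Z v) \<le> (\<Sum>v\<in>A - Z. 2)" using no by (intro sum_mono) blast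
      also have "\<dots> = real (card (A - Z)) * 2" by (rule sum_constant)
      also have "\<dots> \<le> real n * 2" using fin card_mono[of A "A - Z"] cards by auto
      finally have "(\<Sum>v\<in>A - Z. 4 - wt g V Z v) \<le> real n * 2" .
      moreover have "(\<Sum>v\<in>B - Z. 4 - wt g V Z v) \<le> 2 * dg g B c - (\<mu> - 4) * real (card W)"
        by (rule bside[OF Z]) (simp_all add: c2[OF Z(1,2)])
      moreover have "real k \<le> \<mu>" using Suc.prems cX mu by linarith
      ultimately show False using deficit[OF Z(2)] cZ dA(3)[OF c(1)] muW mu MN0 by argo
    qed
    then obtain v where v: "v \<in> A - Z" "wt g V Z v < 2" by force
    then have "wt g V Z v \<le> 1" using wt_int[of g V Z v 1] by simp
    then have vl: "v \<in> light g V Z 1 A" using v(1) by (simp add: light_def)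
    have vF: "v \<in> ?F" using light_mono[OF Z(1,2)] vl by blast
    have vn: "\<not> g v z" "\<not> g z v" if "z \<in> Z" for z using light1_none[OF Z(2) vl that] gs[of z v] by auto
    have vS: "v \<notin> S" using v(1) by (simp add: Z_def)
    have "Gd (insert v S)"
      unfolding Gd_def
    proof (intro conjI ballI impI)
      show "insert v S \<subseteq> ?F" using vF SF by simp
      fix u u' assume u: "u \<in> insert v S" "u' \<in> insert v S"
      have vs: "\<not> g v s" "\<not> g s v" if "s \<in> S" for s using vn[of s] that by (simp_all add: Z_def)
      show "\<not> g u u'"
        using u vs gi S(1) unfolding Gd_def by (elim insertE) auto
      fix x assume x: "x \<in> A" "g u x \<and> g u' x"
      have xv: "x \<notin> Z" if "g v x" using vn(1)[of x] that by blast
      have xs: "x \<in> Z" if "s \<in> S" "g s x" for s using that x(1) by (auto simp: Z_def Y_def)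
      show "u = u'"
        using u
      proof (elim insertE)
        assume "u \<in> S" "u' \<in> S"
        then show ?thesis using S(1) x unfolding Gd_def by blast
      next
        assume "u = v" "u' \<in> S"
        then show ?thesis using xv xs x by blast
      next
        assume "u \<in> S" "u' = v"
        then show ?thesis using xv xs x by blast
      qed simp
    qed
    moreover have "card (insert v S) = Suc k" using S(2) vS fS by simp
    ultimately show ?case by blast
  qed
  obtain S0 where S0: "Gd S0" "card S0 = card ?X" using ext[OF order_refl] by blast
  have S0F: "S0 \<subseteq> ?F" using S0(1) by (simp add: Gd_def)
  have fS0: "finite S0" using finite_subset[OF S0F FA(2)] .
  obtain f where f: "bij_betw f ?X S0" using finite_same_card_bij[OF fX fS0] S0(2) by auto
  have ij: "inj_on f ?X" and im: "f ` ?X = S0" using f by (auto simp: bij_betw_def)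
  have fF: "f x \<in> ?F" "f x \<in> S0" if "x \<in> ?X" for x using im S0F that by auto
  define S where "S = insert c S0"
  have "\<exists>h. valid A B g (insert c (f ` ?X)) h \<and> h c = w \<and> (\<forall>x\<in>?X. h (f x) = x) \<and>
    h ` insert c (f ` ?X) = insert w ?X \<and> dg g (B - insert w ?X) w = 0"
  proof (rule valid_star[OF c(1) wB(1,2) ij])
    fix x assume x: "x \<in> ?X"
    have "f x \<in> A" using fF(1)[OF x] FA by blast
    moreover have "f x \<noteq> c" using fF(1)[OF x] light_sub(2)[of g V Big 1 A] cBig by blast
    moreover have "\<not> g (f x) x" using leaf(2)[OF fF(1)[OF x]] fin dg_zero_iff[of B g "f x"] x by auto
    ultimately show "f x \<in> A - {c} \<and> \<not> g (f x) c \<and> \<not> g (f x) x" using Fno(1)[OF fF(1)[OF x] cBig] by simp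
    show "\<not> g (f x) (f y)" if "y \<in> ?X" for y using S0(1) fF(2)[OF x] fF(2)[OF that] unfolding Gd_def by blast
  qed
  then obtain h where h: "valid A B g S h" "h c = w" "\<forall>x\<in>?X. h (f x) = x"
    "h ` S = insert w ?X" "dg g (B - insert w ?X) w = 0"
    unfolding im S_def[symmetric] by (elim exE conjE)
  have hS0: "h a \<in> ?X" if "a \<in> S0" for a using that h(3) im by auto
  have cS0: "c \<notin> S0" using S0F light_sub(2)[of g V Big 1 A] cBig by blast
  have Sc: "S - {c} = S0" using cS0 by (simp add: S_def)
  have cS: "real (card S) = real (card ?X) + 1" using cS0 fS0 S0(2) by (simp add: S_def)
  have cXT: "real (card ?X) \<le> 13 * ?T" using cX beta[OF wB(1)] by linarith
  let ?p = "\<lambda>a. dg g (A - S) a" and ?q = "\<lambda>a. dg g (B - h ` S) (h a)"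
  have p1: "?p a \<le> 1" if "a \<in> S0" for a
    using leaf(1)[of a] S0F that dg_mono[of A "A - S" g a] fin by auto
  have q1: "?q a \<le> 13 * ?T" if "a \<in> S0" for a
    using beta[of "h a"] hS0[OF that] dg_mono[of B "B - h ` S" g "h a"] fin dg_le_D(2)[of "h a"] by auto
  have qc: "?q c = 0" using h by simp
  have T0: "0 \<le> ?T" by simp
  have gA: "(\<Sum>a\<in>{a\<in>S. g x a}. ?q a) = (\<Sum>a\<in>{a\<in>S0. g x a}. ?q a)" for x
    by (rule sum.mono_neutral_right) (use fS0 qc in \<open>auto simp: S_def\<close>)
  have gA2: "(\<Sum>a\<in>{a\<in>S. g x a}. ?q a) \<le> 13 * ?T" if x: "x \<in> A - S" for x
  proof (cases "{a\<in>S0. g x a} = {}")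
    case True
    then show ?thesis unfolding gA True using T0 by simp
  next
    case False
    then obtain a where a: "a \<in> S0" "g x a" by blast
    have uq: "a' = a" if "a' \<in> S0" "g x a'" for a'
    proof -
      have "g a' x" "g a x" using that(2) a(2) gs[of x a] gs[of x a'] by auto
      then show ?thesis using S0(1) that(1) a(1) x unfolding Gd_def by blast
    qed
    have "{a\<in>S0. g x a} = {a}"
    proof (intro equalityI subsetI)
      fix a' assume "a' \<in> {a\<in>S0. g x a}"
      then show "a' \<in> {a}" using uq[of a'] by simp
    qed (use a in simp)
    then show ?thesis unfolding gA using q1[OF a(1)] by simp
  qed
  have gB: "(\<Sum>a\<in>{a\<in>S. g z (h a)}. ?p a) \<le> 13 * ?T" if z: "z \<in> B - h ` S" for z
  proof -
    have "\<not> g z w" using z gs[of z w] h(4) by auto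
    then have "{a\<in>S. g z (h a)} = {a\<in>S0. g z (h a)}" using h(2) by (auto simp: S_def)
    moreover have "(\<Sum>a\<in>{a\<in>S0. g z (h a)}. ?p a) \<le> (\<Sum>a\<in>{a\<in>S0. g z (h a)}. 1)" using p1 by (intro sum_mono) auto
    moreover have "card {a\<in>S0. g z (h a)} \<le> card (nb g V z)"
    proof -
      have "inj_on h {a\<in>S0. g z (h a)}" using h(1) by (auto simp: valid_def S_def inj_on_def)
      moreover have "h ` {a\<in>S0. g z (h a)} \<subseteq> nb g V z" using hS0 by auto
      ultimately show ?thesis using card_inj_on_le[of h] finV by auto
    qed
    moreover have "D z < 13 * real n / 6000" using beta z by blast
    ultimately show ?thesis unfolding dg_def by simp
  qed
  show False
  \<comment> \<open>For a leaf p \<le> 1, so p q - p - q is never positive; this gives K = 0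
    although q may be large.\<close>
  proof (rule reduction_heavy[OF h(1), where c = c and K = 0 and G = "13 * ?T"])
    show "c \<in> S" by (simp add: S_def)
    show "?q c = 0" by (rule qc)
    show "(\<Sum>a\<in>S - {c}. ?p a * ?q a - ?p a - ?q a) \<le> 0"
      unfolding Sc
    proof (rule sum_nonpos)
      fix a assume "a \<in> S0"
      then have "?p a * ?q a \<le> 1 * ?q a" using p1 by (intro mult_right_mono) auto
      then show "?p a * ?q a - ?p a - ?q a \<le> 0" using dg_nonneg[of g "A - S" a] by linarith
    qed
    show "0 \<le> 13 * ?T" by simp
    show "3 * real (card S) + 0 + 13 * ?T \<le> D c" using cS cXT c(2) n_large by argo
    fix x
    show "(\<Sum>a\<in>{a\<in>S. g x a}. ?q a) \<le> 13 * ?T" if "x \<in> A - S" by (rule gA2[OF that])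
    show "(\<Sum>a\<in>{a\<in>S. g x (h a)}. ?p a) \<le> 13 * ?T" if "x \<in> B - h ` S" by (rule gB[OF that])
    show "dg g A x \<le> real n - real (card S) - 2" if "x \<in> A - S"
      using dA(1)[of x] that Mn cS cXT n_large by force
    show "dg g B x \<le> real n - real (card S) - 2" if "x \<in> B - h ` S"
      using beta[of x] that dg_le_D(2)[of x] cS cXT n_large by force
    show "dg g B x + (\<Sum>a\<in>{a\<in>S. g x a}. ?q a) \<le> real n - real (card S) - 1" if x: "x \<in> A - S"
    proof (cases "D x < 13 * real n / 6000")
      case True
      then show ?thesis using gA2[OF x] dg_le_D(2)[of x] cS cXT n_large by linarith
    next
      case False
      then have D: "13 * real n / 6000 \<le> D x" by simp
      then have xB: "x \<in> Big" using x by (simp add: heavy_def)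
      have "{a\<in>S0. g x a} = {}" using Fno(2)[OF _ xB] S0F by blast
      then have "(\<Sum>a\<in>{a\<in>S. g x a}. ?q a) = 0" unfolding gA by (simp only: sum.empty)
      moreover have "N \<le> real n / 2" using Nn[OF _ _ D] x by (simp add: S_def)
      moreover have "dg g B x \<le> N" using dA(3)[of x] x by blast
      ultimately show ?thesis using cS cXT n_large by linarith
    qed
    show "dg g A x + (\<Sum>a\<in>{a\<in>S. g x (h a)}. ?p a) \<le> real n - real (card S) - 1" if x: "x \<in> B - h ` S"
    proof -
      have "D x < 13 * real n / 6000" using beta x by blast
      then show ?thesis using gB[OF x] dg_le_D(1)[of x] cS cXT n_large by linarith
    qed
  qed
qed

end

section \<open>Heavy vertices on both sides\<close>

locale counterexample_two_heavy = counterexample +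
  fixes c b :: 'a
  assumes c: "c \<in> A" "13 * real n / 6000 \<le> D c" and b: "b \<in> B" "13 * real n / 6000 \<le> D b"
begin

lemma swap_two_heavy: "counterexample_two_heavy n B A g M N b c"
proof -
  interpret sw: counterexample n B A g M N by (rule swap)
  show ?thesis using b c by unfold_locales (simp_all add: Un_commute)
qed

lemma cBig: "c \<in> Big" and bBig: "b \<in> Big"
  using c b by (auto simp: heavy_def)

lemma n_large: "209136 \<le> real n" using n_big by simp

lemma light1_empty:
  assumes "Big \<subseteq> Z" "Z \<subseteq> V" shows "light g V Z 1 A = {}" "light g V Z 1 B = {}"
  using light1_empty_if_heavy[OF c assms] counterexample.light1_empty_if_heavy[OF swap b(1), of Z] b(2) assms
  by (simp_all add: Un_commute[of B A])

lemma light_count_two_heavy: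
  assumes "Big \<subseteq> Z" "Z \<subseteq> V"
  shows "real n + 418275 + M + N - 2 * real (card Z) \<le> real (card (light g V Z 3 A)) + real (card (light g V Z 3 B))"
  using light_count_sides[OF assms(2)] light1_empty[OF assms] by simp

lemma leaf_light_A:
  assumes "b' \<in> B" "13 * real n / 6000 \<le> D b'" "Big \<subseteq> Z" "Z \<subseteq> V" "u \<in> light g V Z 3 A" "\<not> g b' u"
  shows "\<exists>x\<in>A \<inter> Big. g u x"
  using counterexample.leaf_light[OF swap, of b' Z u] assms by (simp add: Un_commute[of B A])

text \<open>A light vertex of B adjacent to x would miss c and so have a second heavy neighbour by
  \<open>leaf_light\<close>. Hence fewer than n/10 light vertices remain in B, too few for the count
  since N > 9n/10.\<close>

lemma no_giant_A:
  assumes x: "x \<in> A" "x \<noteq> c" shows "dg g B x \<le> 9/10 * real n"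
proof (rule ccontr)
  assume g: "\<not> ?thesis"
  have D: "13 * real n / 6000 \<le> D x" using g dg_le_D(2)[of x] n_large by linarith
  then have xB: "x \<in> Big" using x by (simp add: heavy_def)
  have "\<not> g x w" if w: "w \<in> light g V Big 3 B" for w
  proof
    assume xw: "g x w"
    then have "g w x" using gs[of x w] by simp
    then have "\<not> g c w" using light3_unique[OF Big_sub(1) w xB cBig] x(2) gs[of c w] by blast
    then obtain y where y: "y \<in> B" "y \<in> Big" "g w y" using leaf_light[OF c order_refl Big_sub(1) w] by auto
    have "x = y" using light3_unique[OF Big_sub(1) w xB y(2) \<open>g w x\<close> y(3)] .
    then show False using x(1) y(1) dj by blast
  qed
  then have "light g V Big 3 B \<inter> nb g B x = {}" by auto
  moreover have "light g V Big 3 B \<union> nb g B x \<subseteq> B" using light_sub(1)[of g V Big 3 B] by auto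
  ultimately have "card (light g V Big 3 B) + card (nb g B x) \<le> n"
    using card_Un_disjoint[OF light_fin(2) finite_nb[OF fin(2)], of Big 3 g x] card_mono[OF fin(2)] cards by metis
  then have "real (card (light g V Big 3 B)) + dg g B x \<le> real n" unfolding dg_def by linarith
  then show False
    using light_count_two_heavy[OF order_refl Big_sub(1)] card_light_le(1)[of Big 3] card_Big g dA(3)[OF x(1)] MN0 by linarith
qed

lemma no_giant_B: "x \<in> B \<Longrightarrow> x \<noteq> b \<Longrightarrow> dg g A x \<le> 9/10 * real n"
  using counterexample_two_heavy.no_giant_A[OF swap_two_heavy] .

end

section \<open>Light vertices away from the heavy vertex b\<close>

locale counterexample_two_heavy_giant = counterexample_two_heavy +
  assumes c100: "real n / 100 \<le> D c"
begin

text \<open>Light neighbours of b are ideal preimages, with inner degree at most 1 and no heavy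
  neighbour except b. Twenty of them would allow c to be placed on a light w nonadjacent to both c
  and b.\<close>

lemma few_light_at_b: "card {u\<in>light g V Big 3 A. g u b} < 20"
proof (rule ccontr)
  let ?T = "real n / 6000"
  define E where "E = {u\<in>light g V Big 3 A. g u b}"
  assume "\<not> ?thesis"
  then have ne: "20 \<le> card E" by (simp add: E_def)
  have EA: "E \<subseteq> A" "finite E" using light_sub(1)[of g V Big 3 A] light_fin(1) by (auto simp: E_def)
  have Eu: "u \<in> A" "u \<notin> Big" "dg g A u \<le> 1" "\<And>x. x \<in> Big \<Longrightarrow> g u x \<Longrightarrow> x = b" if u: "u \<in> E" for u
  proof -
    have uL: "u \<in> light g V Big 3 A" "g u b" using u by (simp_all add: E_def)
    show "u \<in> A" "u \<notin> Big" using lightD(1,2)[OF Big_sub(1) uL(1)] .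
    show "\<And>x. x \<in> Big \<Longrightarrow> g u x \<Longrightarrow> x = b" using light3_unique[OF Big_sub(1) uL(1) _ bBig _ uL(2)] .
    have "1 \<le> dg g B u" using dg_ge_1[of B b g u] fin(2) b(1) uL(2) by blast
    then show "dg g A u \<le> 1" using light3_D2[OF Big_sub(1) uL(1) bBig uL(2)] dg_V[of u] by linarith
  qed
  \<comment> \<open>A nonheavy vertex adjacent to nearly all of \<open>E\<close> would block the
    choice. Vertices of \<open>E\<close> have degree at most 2 and already see b, so at most one
    such vertex exists, and it is put into \<open>Z\<close>.\<close>
  define Cv where "Cv = {v\<in>V - Big. card {u\<in>E. \<not> g v u} < 6}"
  have cov1: "v = v'" if v: "v \<in> Cv" "v' \<in> Cv" for v v'
  proof (rule ccontr)
    assume vv: "v \<noteq> v'"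
    have "E \<subseteq> {u\<in>E. \<not> g v u} \<union> {u\<in>E. \<not> g v' u}"
    proof
      fix u assume u: "u \<in> E"
      show "u \<in> {u\<in>E. \<not> g v u} \<union> {u\<in>E. \<not> g v' u}"
      proof (rule ccontr)
        assume "\<not> ?thesis"
        then have g: "g u v" "g u v'" using u gs[of v u] gs[of v' u] by auto
        have uL: "u \<in> light g V Big 3 A" "g u b" using u by (simp_all add: E_def)
        have "{v, v', b} \<subseteq> nb g V u" using v b(1) g uL(2) by (auto simp: Cv_def)
        then have "card {v, v', b} \<le> card (nb g V u)" using finV by (intro card_mono) auto
        moreover have "v \<noteq> b" "v' \<noteq> b" using v bBig unfolding Cv_def by blast+
        then have "card {v, v', b} = 3" using vv by simp
        moreover have "real (card (nb g V u)) \<le> 2" using light3_D2[OF Big_sub(1) uL(1) bBig uL(2)] by (simp add: dg_def)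
        ultimately show False by simp
      qed
    qed
    then have "card E \<le> card ({u\<in>E. \<not> g v u} \<union> {u\<in>E. \<not> g v' u})" using EA by (intro card_mono) auto
    also have "\<dots> \<le> card {u\<in>E. \<not> g v u} + card {u\<in>E. \<not> g v' u}" by (rule card_Un_le)
    finally show False using v ne unfolding Cv_def by simp
  qed
  have fC: "finite Cv" using finV by (simp add: Cv_def)
  have cC: "card Cv \<le> 1"
    using cov1 by (cases "Cv = {}") (auto simp: card_le_Suc0_iff_eq[OF fC])
  define Z where "Z = Big \<union> Cv"
  have Z: "Big \<subseteq> Z" "Z \<subseteq> V" using Big_sub by (auto simp: Z_def Cv_def)
  have "card Z \<le> card Big + card Cv" unfolding Z_def by (rule card_Un_le)
  then have cZ: "real (card Z) \<le> 36001" using card_Big cC by linarith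
  have "\<exists>w\<in>light g V Z 3 B. \<not> g c w \<and> \<not> g b w"
  proof (rule ccontr)
    assume "\<not> ?thesis"
    then have "light g V Z 3 B \<subseteq> nb g B c \<union> nb g B b" using light_sub(1)[of g V Z 3 B] by auto
    then have "card (light g V Z 3 B) \<le> card (nb g B c \<union> nb g B b)" using fin by (intro card_mono) auto
    also have "\<dots> \<le> card (nb g B c) + card (nb g B b)" by (rule card_Un_le)
    finally have "real (card (light g V Z 3 B)) \<le> dg g B c + dg g B b" unfolding dg_def by linarith
    then show False using light_count_two_heavy[OF Z] cZ card_light_le(1)[of Z 3] dA(3)[OF c(1)] dB(1)[OF b(1)] by linarith
  qed
  then obtain w where w: "w \<in> light g V Z 3 B" "\<not> g c w" "\<not> g b w" by blast
  have wB: "w \<in> B" using lightD(1)[OF Z(2) w(1)] .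
  obtain y where y: "y \<in> B" "y \<in> Big" "g w y" using leaf_light[OF c Z w(1,2)] by auto
  have yb: "y \<noteq> b" using y(3) w(3) gs[of w b] by blast
  have yZ: "y \<in> Z" using y(2) Z(1) by blast
  \<comment> \<open>If y were that large, a member of \<open>E\<close>, being nonadjacent to y,
    would need a heavy neighbour in A; but its only heavy neighbour is b.\<close>
  have Dy: "D y < 13 * real n / 6000"
  proof (rule ccontr)
    assume "\<not> ?thesis"
    then have D: "13 * real n / 6000 \<le> D y" by simp
    have "E \<noteq> {}" using ne by auto
    then obtain u where u: "u \<in> E" by blast
    then have uL: "u \<in> light g V Big 3 A" by (simp add: E_def)
    have "\<not> g y u" using Eu(4)[OF u y(2)] yb gs[of y u] by blast
    then obtain x where x: "x \<in> A" "x \<in> Big" "g u x" using leaf_light_A[OF y(1) D order_refl Big_sub(1) uL] by auto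
    have "x = b" using Eu(4)[OF u x(2,3)] .
    then show False using x(1) b(1) dj by blast
  qed
  let ?X = "nb g B w"
  have fX: "finite ?X" using fin by simp
  have "dg g B w \<le> 2" using light3_D2[OF Z(2) w(1) yZ y(3)] dg_le_D(2)[of w] by linarith
  then have cX: "card ?X \<le> 2" by (simp add: dg_def)
  have oth: "x \<notin> Z" if "x \<in> ?X" "x \<noteq> y" for x
    using light3_unique[OF Z(2) w(1) _ yZ _ y(3), of x] that by auto
  have Q: "D x \<le> (if x = y then 13 * ?T else ?T)" if x: "x \<in> ?X" for x
  proof (cases "x = y")
    case False
    then have "x \<notin> Big" using oth[OF x] Z(1) by blast
    then show ?thesis using not_Big[of x] x False by simp
  qed (use Dy in simp)
  have yX: "y \<in> ?X" using y by simp
  then have "card (?X - {y}) \<le> 1" using cX fX by simp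
  then have 1: "real (card (?X - {y})) * ?T \<le> 1 * ?T" by (intro mult_right_mono) auto
  have "(\<Sum>x\<in>?X. D x) \<le> (\<Sum>x\<in>?X. if x = y then 13 * ?T else ?T)" by (intro sum_mono Q)
  also have "\<dots> = 13 * ?T + (\<Sum>x\<in>?X - {y}. ?T)"
    unfolding sum.remove[OF fX yX] by (simp add: sum.cong)
  also have "\<dots> \<le> 14 * ?T" using 1 unfolding sum_constant by linarith
  finally have sQ: "(\<Sum>x\<in>?X. D x) \<le> 14 * ?T" .
  have room: "6 \<le> card {u\<in>E. \<not> g x u}" if x: "x \<in> ?X" for x
  proof (cases "x = y")
    case True
    have "{u\<in>E. \<not> g x u} = E" using Eu(4)[OF _ y(2)] yb gs[of y] True by auto
    then show ?thesis using ne by simp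
  next
    case False
    then have "x \<notin> Cv" "x \<notin> Big" using oth[OF x] by (auto simp: Z_def)
    then show ?thesis using x by (auto simp: Cv_def)
  qed
  have "\<exists>f. inj_on f ?X \<and> (\<forall>x\<in>?X. f x \<in> {u\<in>E. \<not> g x u}) \<and> (\<forall>x\<in>?X. \<forall>y\<in>?X. \<not> g (f x) (f y))"
  proof (rule choose_independent[OF gr fX fin(1), where d = 1])
    show "{u\<in>E. \<not> g x u} \<subseteq> A" for x using EA by blast
    show "dg g A z \<le> real 1" if "z \<in> {u\<in>E. \<not> g x u}" for x z
    proof -
      have "z \<in> E" using that by blast
      then show ?thesis using Eu(3)[of z] by simp
    qed
    show "card ?X * (1 + 1) \<le> card {u\<in>E. \<not> g x u}" if "x \<in> ?X" for x using room[OF that] cX by simp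
  qed
  then obtain f where f: "inj_on f ?X" "\<forall>x\<in>?X. f x \<in> {u\<in>E. \<not> g x u}" "\<forall>x\<in>?X. \<forall>y\<in>?X. \<not> g (f x) (f y)"
    by (elim exE conjE)
  have fE: "f x \<in> E" "\<not> g x (f x)" if "x \<in> ?X" for x using bspec[OF f(2) that] by simp_all
  have cb: "c \<noteq> b" using c(1) b(1) dj by blast
  show False
  proof (rule place_star[OF c(1) wB w(2) f(1), where P = "\<lambda>_. 1" and Q = D and K = "14 * ?T" and G = "14 * ?T + 2"])
    fix x assume x: "x \<in> ?X"
    have "f x \<in> A" "f x \<noteq> c" using Eu(1,2)[OF fE(1)[OF x]] cBig by auto
    moreover have "\<not> g (f x) c" using Eu(4)[OF fE(1)[OF x] cBig] cb by blast
    ultimately show "f x \<in> A - {c} \<and> \<not> g (f x) c \<and> \<not> g (f x) x" using fE(2)[OF x] gs[of x "f x"] by simp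
    show "dg g A (f x) \<le> 1" by (rule Eu(3)[OF fE(1)[OF x]])
    show "dg g B x \<le> D x" by (rule dg_le_D)
    show "\<not> g (f x) (f y)" if "y \<in> ?X" for y using f(3) x that by simp
  next
    show "(\<Sum>x\<in>?X. 1 * D x) \<le> 14 * ?T" using sQ by simp
    have c2: "real (card ?X) \<le> 2" using cX by simp
    then show "(\<Sum>x\<in>?X. 1) \<le> 14 * ?T + 2" using n_large by simp
    show "(\<Sum>x\<in>?X. D x) \<le> 14 * ?T + 2" using sQ by simp
    show "card ?X \<le> 900" using cX by simp
    show "14 * ?T + 2 \<le> real n / 40" using n_large by simp
    show "3 * (real (card ?X) + 1) + 14 * ?T + (14 * ?T + 2) \<le> D c" using c2 c100 n_large by argo
    fix s
    show "(\<Sum>x\<in>{x\<in>?X. g s (f x)}. D x) \<le> 100000" if s: "s \<in> A - {c}" "9/10 * real n < dg g B s"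
      using no_giant_A[of s] s by simp
    show "(\<Sum>x\<in>{x\<in>?X. g s x}. 1) \<le> (100000::real)"
    proof -
      have "card {x\<in>?X. g s x} \<le> card ?X" using fin by (intro card_mono) auto
      then show ?thesis using cX by simp
    qed
  qed
qed

lemma no_giant_b: "dg g A b \<le> 9/10 * real n"
proof -
  have "light g V Big 3 A \<subseteq> {u\<in>light g V Big 3 A. g u b} \<union> (A - nb g A b)"
    using light_sub(1)[of g V Big 3 A] gs by auto
  then have "card (light g V Big 3 A) \<le> card ({u\<in>light g V Big 3 A. g u b} \<union> (A - nb g A b))"
    using light_fin(1) fin by (intro card_mono) auto
  also have "\<dots> \<le> card {u\<in>light g V Big 3 A. g u b} + card (A - nb g A b)" by (rule card_Un_le)
  finally have "real (card (light g V Big 3 A)) \<le> 20 + real (card (A - nb g A b))" using few_light_at_b by linarith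
  moreover have "real (card (A - nb g A b)) = real n - dg g A b"
    using card_Diff_subset[of "nb g A b" A] card_mono[of A "nb g A b"] fin cards by (simp add: dg_def nb_subset of_nat_diff)
  ultimately show ?thesis
    using light_count_two_heavy[OF order_refl Big_sub(1)] card_light_le(2)[of Big 3] card_Big dB(3)[OF b(1)] MN0 n_large by linarith
qed

text \<open>After 2 * 150000 is taken off, 118275 remains as margin. In A almost no light vertex is
  adjacent to b, and at most M are adjacent to c'; in B at most N + M vertices are adjacent to c or
  b'.\<close>

lemma room:
  assumes Z: "Big \<subseteq> Z" "Z \<subseteq> V" "real (card Z) \<le> 150000"
  shows "c' \<in> A \<Longrightarrow> \<exists>u\<in>light g V Z 3 A. \<not> g u b \<and> \<not> g u c'"
    and "b' \<in> B \<Longrightarrow> \<exists>w\<in>light g V Z 3 B. \<not> g w c \<and> \<not> g w b'"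
proof -
  have s: "real n + 118275 + M + N \<le> real (card (light g V Z 3 A)) + real (card (light g V Z 3 B))"
    using light_count_two_heavy[OF Z(1,2)] Z(3) by linarith
  have "{u\<in>light g V Z 3 A. g u b} \<subseteq> {u\<in>light g V Big 3 A. g u b}"
    using light_mono[OF Z(1,2), of 3 A] by blast
  then have "card {u\<in>light g V Z 3 A. g u b} \<le> card {u\<in>light g V Big 3 A. g u b}" using light_fin by (intro card_mono) auto
  then have 20: "real (card {u\<in>light g V Z 3 A. g u b}) \<le> 20" using few_light_at_b by linarith
  show "\<exists>u\<in>light g V Z 3 A. \<not> g u b \<and> \<not> g u c'" if c': "c' \<in> A"
  proof (rule ccontr)
    assume "\<not> ?thesis"
    then have "light g V Z 3 A \<subseteq> {u\<in>light g V Z 3 A. g u b} \<union> nb g A c'"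
      using light_sub(1)[of g V Z 3 A] gs by auto
    then have "card (light g V Z 3 A) \<le> card ({u\<in>light g V Z 3 A. g u b} \<union> nb g A c')"
      using light_fin(1) fin by (intro card_mono) auto
    also have "\<dots> \<le> card {u\<in>light g V Z 3 A. g u b} + card (nb g A c')" by (rule card_Un_le)
    finally have "real (card (light g V Z 3 A)) \<le> 20 + dg g A c'" using 20 unfolding dg_def by linarith
    then show False using s card_light_le(2)[of Z 3] dA(1)[OF c'] MN0 by linarith
  qed
  show "\<exists>w\<in>light g V Z 3 B. \<not> g w c \<and> \<not> g w b'" if b': "b' \<in> B"
  proof (rule ccontr)
    assume "\<not> ?thesis"
    then have "light g V Z 3 B \<subseteq> nb g B c \<union> nb g B b'"
      using light_sub(1)[of g V Z 3 B] gs by auto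
    then have "card (light g V Z 3 B) \<le> card (nb g B c \<union> nb g B b')"
      using fin by (intro card_mono) auto
    also have "\<dots> \<le> card (nb g B c) + card (nb g B b')" by (rule card_Un_le)
    finally have "real (card (light g V Z 3 B)) \<le> dg g B c + dg g B b'" unfolding dg_def by linarith
    then show False using s card_light_le(1)[of Z 3] dA(3)[OF c(1)] dB(1)[OF b'] by linarith
  qed
qed

end

section \<open>Placing several heavy vertices\<close>

context counterexample begin

text \<open>A set of pairs suits placements in which some vertices are chosen as images and others
  as preimages. Pairs outside \<open>H\<close> create no edge, and the at most five pairs in
  \<open>H\<close> cost at most 2n/6000 each.\<close>

lemma reduction_pairs:
  assumes fR: "finite Rl" and RA: "\<And>p. p \<in> Rl \<Longrightarrow> fst p \<in> A \<and> snd p \<in> B \<and> \<not> g (fst p) (snd p)"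
    and inj: "inj_on fst Rl" "inj_on snd Rl"
    and cf: "\<And>p p'. p \<in> Rl \<Longrightarrow> p' \<in> Rl \<Longrightarrow> g (fst p) (fst p') \<Longrightarrow> \<not> g (snd p) (snd p')"
    and c: "(c, w) \<in> Rl" "dg g (B - snd ` Rl) w = 0" "real n / 100 \<le> D c" and cR: "card Rl \<le> 10"
    and H: "H \<subseteq> Rl" "(c, w) \<notin> H" "card H \<le> 5"
    and nonH: "\<And>p. p \<in> Rl - H \<Longrightarrow> dg g (A - fst ` Rl) (fst p) = 0 \<or> dg g (B - snd ` Rl) (snd p) = 0"
    and Hb: "\<And>p. p \<in> H \<Longrightarrow> dg g A (fst p) \<le> real n / 6000 \<and> dg g B (snd p) \<le> real n / 6000
       \<and> dg g A (fst p) * dg g B (snd p) \<le> 2 * (real n / 6000)"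
    and giants: "\<And>x. x \<in> A \<Longrightarrow> x \<noteq> c \<Longrightarrow> dg g B x \<le> 9/10 * real n" "\<And>x. x \<in> B \<Longrightarrow> dg g A x \<le> 9/10 * real n"
  shows False
proof -
  let ?T = "real n / 6000"
  define h where "h = snd \<circ> inv_into Rl fst"
  have hp: "h (fst p) = snd p" if "p \<in> Rl" for p using inv_into_f_f[OF inj(1) that] by (simp add: h_def)
  have hS: "h ` fst ` Rl = snd ` Rl" using hp by (force simp: image_iff)
  have fH: "finite H" "inj_on fst H" using finite_subset[OF H(1) fR] inj_on_subset[OF inj(1) H(1)] by auto
  have 1: "inj_on h (fst ` Rl)"
  proof (rule inj_onI)
    fix a a' assume a: "a \<in> fst ` Rl" "a' \<in> fst ` Rl" "h a = h a'"
    obtain p where p: "p \<in> Rl" "a = fst p" using a(1) by (elim imageE)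
    obtain p' where p': "p' \<in> Rl" "a' = fst p'" using a(2) by (elim imageE)
    have "snd p = snd p'" using a(3) p p' hp by simp
    then have "p = p'" using inj_onD[OF inj(2) _ p(1) p'(1)] by simp
    then show "a = a'" using p p' by simp
  qed
  have "valid A B g (fst ` Rl) h"
    unfolding valid_def
  proof (intro conjI ballI impI)
    show "finite (fst ` Rl)" using fR by simp
    show "fst ` Rl \<subseteq> A" "h ` fst ` Rl \<subseteq> B" unfolding hS using RA by auto
    show "inj_on h (fst ` Rl)" by (rule 1)
    show "\<not> g a (h a)" if a: "a \<in> fst ` Rl" for a
    proof -
      obtain p where p: "p \<in> Rl" "a = fst p" using a by (elim imageE)
      then show ?thesis using RA[OF p(1)] hp[OF p(1)] by simp
    qed
    show "\<not> g (h a) (h a')" if a: "a \<in> fst ` Rl" "a' \<in> fst ` Rl" "g a a'" for a a'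
    proof -
      obtain p where p: "p \<in> Rl" "a = fst p" using a(1) by (elim imageE)
      obtain p' where p': "p' \<in> Rl" "a' = fst p'" using a(2) by (elim imageE)
      show ?thesis using cf[OF p(1) p'(1)] a(3) p p' hp by simp
    qed
  qed
  note v = this
  have cA: "c \<in> fst ` Rl" using c(1) by force
  have hc: "h c = w" using hp[OF c(1)] by simp
  have cH: "c \<notin> fst ` H"
  proof
    assume "c \<in> fst ` H"
    then obtain p where p: "p \<in> H" "c = fst p" by (elim imageE)
    then have "p = (c, w)" using inj_onD[OF inj(1) _ _ c(1), of p] H(1) by auto
    then show False using p(1) H(2) by simp
  qed
  have cS: "card (fst ` Rl) \<le> 10" using card_image_le[OF fR, of fst] cR by linarith
  have cHH: "card (fst ` H) = card H" using card_image[OF fH(2)] .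
  have c5: "real (card (fst ` H)) * t \<le> 5 * t" if "0 \<le> t" for t using H(3) cHH that by (intro mult_right_mono) auto
  have Hb': "dg g A a \<le> ?T" "dg g B (h a) \<le> ?T" "dg g A a * dg g B (h a) \<le> 2 * ?T" if a: "a \<in> fst ` H" for a
  proof -
    obtain p where p: "p \<in> H" "a = fst p" using a by (elim imageE)
    then have "h a = snd p" using hp[of p] H(1) by auto
    then show "dg g A a \<le> ?T" "dg g B (h a) \<le> ?T" "dg g A a * dg g B (h a) \<le> 2 * ?T" using Hb[OF p(1)] p(2) by simp_all
  qed
  show False
  proof (rule reduction_heavy_bounded[OF v cA, where H = "fst ` H" and p = "dg g A" and q = "\<lambda>a. dg g B (h a)" and K = "10 * ?T" and G = "5 * ?T"],
      unfold hS)
    show "card (fst ` Rl) \<le> 1000" using cS by simp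
    show "dg g (B - snd ` Rl) (h c) = 0" using c(2) hc by simp
    show "fst ` H \<subseteq> fst ` Rl" using H(1) by auto
    show "c \<notin> fst ` H" by (rule cH)
    show "dg g (A - fst ` Rl) a = 0 \<or> dg g (B - snd ` Rl) (h a) = 0" if a: "a \<in> fst ` Rl - fst ` H" for a
    proof -
      obtain p where p: "p \<in> Rl" "a = fst p" using a by auto
      have "p \<in> Rl - H" using p a by auto
      then show ?thesis using nonH[of p] p hp[OF p(1)] by simp
    qed
    show "dg g (A - fst ` Rl) a \<le> dg g A a" for a using fin by (intro dg_mono) auto
    show "dg g (B - snd ` Rl) (h a) \<le> dg g B (h a)" for a using fin by (intro dg_mono) auto
    have "(\<Sum>a\<in>fst ` H. dg g A a * dg g B (h a)) \<le> (\<Sum>a\<in>fst ` H. 2 * ?T)" by (intro sum_mono Hb')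
    also have "\<dots> \<le> 5 * (2 * ?T)" unfolding sum_constant by (rule c5) simp
    finally show "(\<Sum>a\<in>fst ` H. dg g A a * dg g B (h a)) \<le> 10 * ?T" by linarith
    have "(\<Sum>a\<in>fst ` H. dg g A a) \<le> (\<Sum>a\<in>fst ` H. ?T)" by (intro sum_mono Hb')
    also have "\<dots> \<le> 5 * ?T" unfolding sum_constant by (rule c5) simp
    finally show "(\<Sum>a\<in>fst ` H. dg g A a) \<le> 5 * ?T" .
    have "(\<Sum>a\<in>fst ` H. dg g B (h a)) \<le> (\<Sum>a\<in>fst ` H. ?T)" by (intro sum_mono Hb')
    also have "\<dots> \<le> 5 * ?T" unfolding sum_constant by (rule c5) simp
    finally show "(\<Sum>a\<in>fst ` H. dg g B (h a)) \<le> 5 * ?T" .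
    show "5 * ?T \<le> real n / 40" by simp
    have "real (card (fst ` Rl)) \<le> 10" using cS by simp
    moreover have "209136 \<le> real n" using n_big by simp
    ultimately show "3 * real (card (fst ` Rl)) + 10 * ?T + 5 * ?T \<le> D c" using c(3) by linarith
    fix x
    show "(\<Sum>a\<in>{a\<in>fst ` H. g x a}. dg g B (h a)) \<le> 100000" if "x \<in> A - fst ` Rl" "9/10 * real n < dg g B x"
      using giants(1)[of x] that cA by force
    show "(\<Sum>a\<in>{a\<in>fst ` H. g x (h a)}. dg g A a) \<le> 100000" if "x \<in> B - snd ` Rl" "9/10 * real n < dg g A x"
      using giants(2)[of x] that by force
  qed
qed

text \<open>l stands for a light vertex with unique heavy neighbour k. Degree at most 2 leaves at
  most one further neighbour, which lies outside \<open>Z\<close>.\<close>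

definition fresh :: "'a set \<Rightarrow> 'a set \<Rightarrow> 'a \<Rightarrow> 'a \<Rightarrow> bool" where
  "fresh S Z l k \<longleftrightarrow> l \<in> S \<and> l \<notin> Z \<and> k \<in> S \<and> k \<in> Big \<and> g l k \<and> (\<forall>z\<in>Z. g l z \<longrightarrow> z = k) \<and> D l \<le> 2"

lemma fresh_facts:
  assumes "fresh S Z l k" "Big \<subseteq> Z" "S \<subseteq> V"
  shows "l \<in> S" "l \<notin> Z" "k \<in> S" "k \<in> Big" "g l k" "l \<notin> Big" "D l \<le> 2"
    and "\<And>z. z \<in> Z \<Longrightarrow> g l z \<Longrightarrow> z = k"
    and "\<And>x. x \<in> nb g S l - {k} \<Longrightarrow> x \<in> S \<and> x \<notin> Z \<and> x \<notin> Big \<and> g l x"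
    and "finite (nb g S l - {k})" "card (nb g S l - {k}) \<le> 1"
proof -
  show f: "l \<in> S" "l \<notin> Z" "k \<in> S" "k \<in> Big" "g l k" "l \<notin> Big" "D l \<le> 2" using assms unfolding fresh_def by auto
  show z: "\<And>z. z \<in> Z \<Longrightarrow> g l z \<Longrightarrow> z = k" using assms(1) unfolding fresh_def by blast
  show "\<And>x. x \<in> nb g S l - {k} \<Longrightarrow> x \<in> S \<and> x \<notin> Z \<and> x \<notin> Big \<and> g l x"
  proof -
    fix x assume "x \<in> nb g S l - {k}"
    then have x: "x \<in> S" "g l x" "x \<noteq> k" by simp_all
    then have "x \<notin> Z" using z[of x] by blast
    then show "x \<in> S \<and> x \<notin> Z \<and> x \<notin> Big \<and> g l x" using x assms(2) by blast
  qed
  have fS: "finite S" using finite_subset[OF assms(3) finV] .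
  show "finite (nb g S l - {k})" using fS by simp
  have "dg g S l \<le> 2" using dg_mono[OF finV assms(3), of g l] f(7) by linarith
  then have "card (nb g S l) \<le> 2" by (simp add: dg_def)
  moreover have "k \<in> nb g S l" using f(3,5) by simp
  ultimately show "card (nb g S l - {k}) \<le> 1" using fS by simp
qed

end

section \<open>The cyclic placement\<close>

context counterexample_two_heavy_giant begin

text \<open>The cycle: c goes to \<open>w1\<close>, a neighbour of \<open>ys\<close>;
  \<open>ys\<close> is the image of \<open>u0\<close>, a neighbour of \<open>c0\<close>;
  \<open>c0\<close> goes to \<open>w0\<close>, a neighbour of \<open>y0\<close>; \<open>y0\<close>
  is the image of \<open>us\<close>, a neighbour of \<open>cs\<close>; and \<open>cs\<close> goes to
  \<open>ws\<close>, again a neighbour of \<open>ys\<close>. If \<open>cs = c\<close>, the last pair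
  is dropped. Thus the heavy neighbours of \<open>w1\<close>, \<open>w0\<close>, \<open>ws\<close>,
  \<open>u0\<close>, \<open>us\<close> are all placed, and their at most one further neighbour each
  is matched with one of \<open>a1\<close>, \<open>a0\<close>, \<open>a2\<close>, \<open>z0\<close>,
  \<open>zs\<close>. Each light vertex is fresh for a set containing the earlier ones with their
  neighbours, which gives independence.\<close>

lemma core_config:
  assumes Z0: "Big \<subseteq> Z0" "Z0 \<subseteq> V" "w1 \<in> Z0" "nb g V w1 \<subseteq> Z0"
    and w1: "fresh B Big w1 ys" "\<not> g w1 c"
    and ws: "fresh B Z0 ws ys" and Z1: "Z0 \<subseteq> Z1" "ws \<in> Z1" "nb g V ws \<subseteq> Z1"
    and w0: "fresh B Z1 w0 y0" "y0 \<noteq> ys" and Z2: "Z1 \<subseteq> Z2" "w0 \<in> Z2" "nb g V w0 \<subseteq> Z2"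
    and u0: "fresh A Z2 u0 c0" "c0 \<noteq> c" and Z3: "Z2 \<subseteq> Z3" "u0 \<in> Z3" "nb g V u0 \<subseteq> Z3"
    and us: "fresh A Z3 us cs" "cs \<noteq> c0" and Z4: "Z3 \<subseteq> Z4" "us \<in> Z4" "nb g V us \<subseteq> Z4"
    and a1: "fresh A Z4 a1 k1" "\<not> g a1 c" and Z5: "Z4 \<subseteq> Z5" "a1 \<in> Z5" "nb g V a1 \<subseteq> Z5"
    and a2: "fresh A Z5 a2 k2" "\<not> g a2 cs" and Z6: "Z5 \<subseteq> Z6" "a2 \<in> Z6" "nb g V a2 \<subseteq> Z6"
    and a0: "fresh A Z6 a0 k0" "\<not> g a0 c0" and Z7: "Z6 \<subseteq> Z7" "a0 \<in> Z7" "nb g V a0 \<subseteq> Z7"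
    and z0: "fresh B Z7 z0 j0" "\<not> g z0 ys" and Z8: "Z7 \<subseteq> Z8" "z0 \<in> Z8" "nb g V z0 \<subseteq> Z8"
    and zs: "fresh B Z8 zs js" "\<not> g zs y0"
  shows False
proof -
  let ?T = "real n / 6000"
  have ch: "Z0 \<subseteq> Z1" "Z1 \<subseteq> Z2" "Z2 \<subseteq> Z3" "Z3 \<subseteq> Z4" "Z4 \<subseteq> Z5" "Z5 \<subseteq> Z6" "Z6 \<subseteq> Z7" "Z7 \<subseteq> Z8"
    using Z1 Z2 Z3 Z4 Z5 Z6 Z7 Z8 by simp_all
  have BZ: "Big \<subseteq> Z1" "Big \<subseteq> Z2" "Big \<subseteq> Z3" "Big \<subseteq> Z4" "Big \<subseteq> Z5" "Big \<subseteq> Z6" "Big \<subseteq> Z7" "Big \<subseteq> Z8"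
    using Z0(1) ch by (meson order_trans)+
  note fw1 = fresh_facts[OF w1(1) order_refl Un_upper2] and fws = fresh_facts[OF ws Z0(1) Un_upper2]
    and fw0 = fresh_facts[OF w0(1) BZ(1) Un_upper2] and fu0 = fresh_facts[OF u0(1) BZ(2) Un_upper1]
    and fus = fresh_facts[OF us(1) BZ(3) Un_upper1] and fa1 = fresh_facts[OF a1(1) BZ(4) Un_upper1]
    and fa2 = fresh_facts[OF a2(1) BZ(5) Un_upper1] and fa0 = fresh_facts[OF a0(1) BZ(6) Un_upper1]
    and fz0 = fresh_facts[OF z0(1) BZ(7) Un_upper2] and fzs = fresh_facts[OF zs(1) BZ(8) Un_upper2]
  note up = subsetD[OF ch(1)] subsetD[OF ch(2)] subsetD[OF ch(3)] subsetD[OF ch(4)] subsetD[OF ch(5)] subsetD[OF ch(6)]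
    subsetD[OF ch(7)] subsetD[OF ch(8)]
  note upB = BZ[THEN subsetD] subsetD[OF Z0(1)]
  \<comment> \<open>The level tells at which stage of the chain a vertex first appears. Different
    levels mean different vertices, which replaces many separate inequalities.\<close>
  define lv where "lv x = (if x \<in> Big then 0 else if x \<in> Z0 then 1 else if x \<in> Z1 then 2 else if x \<in> Z2 then 3
    else if x \<in> Z3 then 4 else if x \<in> Z4 then 5 else if x \<in> Z5 then 6 else if x \<in> Z6 then 7 else if x \<in> Z7 then 8
    else if x \<in> Z8 then 9 else (10::nat))" for x
  have l0: "x \<in> Big \<Longrightarrow> lv x = 0" for x by (simp add: lv_def)
  have l1: "x \<notin> Big \<Longrightarrow> x \<in> Z0 \<Longrightarrow> lv x = 1" for x by (simp add: lv_def)
  have l2: "x \<notin> Z0 \<Longrightarrow> x \<in> Z1 \<Longrightarrow> lv x = 2" for x using Z0(1) by (auto simp: lv_def)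
  have l3: "x \<notin> Z1 \<Longrightarrow> x \<in> Z2 \<Longrightarrow> lv x = 3" for x using BZ ch by (auto simp: lv_def)
  have l4: "x \<notin> Z2 \<Longrightarrow> x \<in> Z3 \<Longrightarrow> lv x = 4" for x using BZ ch by (auto simp: lv_def)
  have l5: "x \<notin> Z3 \<Longrightarrow> x \<in> Z4 \<Longrightarrow> lv x = 5" for x using BZ ch by (auto simp: lv_def)
  have l6: "x \<notin> Z4 \<Longrightarrow> x \<in> Z5 \<Longrightarrow> lv x = 6" for x using BZ ch by (auto simp: lv_def)
  have l7: "x \<notin> Z5 \<Longrightarrow> x \<in> Z6 \<Longrightarrow> lv x = 7" for x using BZ ch by (auto simp: lv_def)
  have l8: "x \<notin> Z6 \<Longrightarrow> x \<in> Z7 \<Longrightarrow> lv x = 8" for x using BZ ch by (auto simp: lv_def)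
  have l9: "x \<notin> Z7 \<Longrightarrow> x \<in> Z8 \<Longrightarrow> lv x = 9" for x using BZ ch by (auto simp: lv_def)
  have l10: "x \<notin> Z8 \<Longrightarrow> lv x = 10" for x using BZ ch by (auto simp: lv_def)
  define V1 where "V1 = nb g B w1 - {ys}"
  define Vs where "Vs = nb g B ws - {ys}"
  define V0 where "V0 = nb g B w0 - {y0}"
  define X0 where "X0 = nb g A u0 - {c0}"
  define Xs where "Xs = nb g A us - {cs}"
  note fV1 = fw1(9-11)[folded V1_def] and fVs = fws(9-11)[folded Vs_def] and fV0 = fw0(9-11)[folded V0_def]
    and fX0 = fu0(9-11)[folded X0_def] and fXs = fus(9-11)[folded Xs_def]
  have sV1: "V1 \<subseteq> Z0" using Z0(4) by (auto simp: V1_def)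
  have sVs: "Vs \<subseteq> Z1" using Z1(3) by (auto simp: Vs_def)
  have sV0: "V0 \<subseteq> Z2" using Z2(3) by (auto simp: V0_def)
  have sX0: "X0 \<subseteq> Z3" using Z3(3) by (auto simp: X0_def)
  have sXs: "Xs \<subseteq> Z4" using Z4(3) by (auto simp: Xs_def)
  have iZ: "ws \<in> Z1" "w0 \<in> Z2" "u0 \<in> Z3" "us \<in> Z4" "a1 \<in> Z5" "a2 \<in> Z6" "a0 \<in> Z7" "z0 \<in> Z8"
    using Z1 Z2 Z3 Z4 Z5 Z6 Z7 Z8 by simp_all
  have lB: "lv w1 = 1" "lv ws = 2" "lv w0 = 3" "lv z0 = 9" "lv zs = 10" "lv ys = 0" "lv y0 = 0"
    using l1[OF fw1(6) Z0(3)] l2[OF fws(2) iZ(1)] l3[OF fw0(2) iZ(2)] l9[OF fz0(2) iZ(8)] l10[OF fzs(2)] l0[OF fw1(4)] l0[OF fw0(4)] by blast+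
  have lA: "lv u0 = 4" "lv us = 5" "lv a1 = 6" "lv a2 = 7" "lv a0 = 8" "lv c = 0" "lv c0 = 0" "lv cs = 0"
    using l4[OF fu0(2) iZ(3)] l5[OF fus(2) iZ(4)] l6[OF fa1(2) iZ(5)] l7[OF fa2(2) iZ(6)] l8[OF fa0(2) iZ(7)]
      l0[OF cBig] l0[OF fu0(4)] l0[OF fus(4)] by blast+
  have lV1: "lv v = 1" if "v \<in> V1" for v using l1[of v] fV1(1)[OF that] sV1 that by blast
  have lVs: "lv v = 2" if "v \<in> Vs" for v using l2[of v] fVs(1)[OF that] sVs that by blast
  have lV0: "lv v = 3" if "v \<in> V0" for v using l3[of v] fV0(1)[OF that] sV0 that by blast
  have lX0: "lv v = 4" if "v \<in> X0" for v using l4[of v] fX0(1)[OF that] sX0 that by blast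
  have lXs: "lv v = 5" if "v \<in> Xs" for v using l5[of v] fXs(1)[OF that] sXs that by blast
  have self: "w1 \<notin> V1" "ws \<notin> Vs" "w0 \<notin> V0" "u0 \<notin> X0" "us \<notin> Xs"
    using gi by (simp_all add: V1_def Vs_def V0_def X0_def Xs_def)
  have one: "x = y" if "card S \<le> 1" "finite S" "x \<in> S" "y \<in> S" for S :: "'a set" and x y
    using that card_le_Suc0_iff_eq[of S] by auto
  have u1: "x = y" if "x \<in> V1" "y \<in> V1" for x y using one[OF fV1(3,2) that] .
  have u2: "x = y" if "x \<in> Vs" "y \<in> Vs" for x y using one[OF fVs(3,2) that] .
  have u3: "x = y" if "x \<in> V0" "y \<in> V0" for x y using one[OF fV0(3,2) that] .
  have u4: "x = y" if "x \<in> X0" "y \<in> X0" for x y using one[OF fX0(3,2) that] .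
  have u5: "x = y" if "x \<in> Xs" "y \<in> Xs" for x y using one[OF fXs(3,2) that] .
  have nf: "\<not> g l x" if "fresh S Z l k" "x \<in> Z" "x \<notin> Big" for S Z l k x
    using that unfolding fresh_def by blast
  have LB: "\<not> g l l'" if "l \<in> {w1, ws, w0, z0, zs}" "l' \<in> {w1, ws, w0, z0, zs}" for l l'
  proof -
    have m: "w1 \<in> Z1" "w1 \<in> Z7" "w1 \<in> Z8" "ws \<in> Z7" "ws \<in> Z8" "w0 \<in> Z7" "w0 \<in> Z8"
      using Z0(3) iZ by (simp_all add: up)
    have n: "\<not> g ws w1" "\<not> g w0 w1" "\<not> g w0 ws" "\<not> g z0 w1" "\<not> g z0 ws" "\<not> g z0 w0"
      "\<not> g zs w1" "\<not> g zs ws" "\<not> g zs w0" "\<not> g zs z0"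
      using nf[OF ws Z0(3) fw1(6)] nf[OF w0(1) m(1) fw1(6)] nf[OF w0(1) iZ(1) fws(6)] nf[OF z0(1) m(2) fw1(6)]
        nf[OF z0(1) m(4) fws(6)] nf[OF z0(1) m(6) fw0(6)] nf[OF zs(1) m(3) fw1(6)] nf[OF zs(1) m(5) fws(6)]
        nf[OF zs(1) m(7) fw0(6)] nf[OF zs(1) iZ(8) fz0(6)] by blast+
    have n': "\<not> g w1 ws" "\<not> g w1 w0" "\<not> g ws w0" "\<not> g w1 z0" "\<not> g ws z0" "\<not> g w0 z0"
      "\<not> g w1 zs" "\<not> g ws zs" "\<not> g w0 zs" "\<not> g z0 zs"
      using n gs by blast+
    show ?thesis using that n n' gi[of l] by (elim insertE emptyE) (simp_all add: gi)
  qed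
  have LA: "\<not> g l l'" if "l \<in> {u0, us, a1, a2, a0}" "l' \<in> {u0, us, a1, a2, a0}" for l l'
  proof -
    have m: "u0 \<in> Z4" "u0 \<in> Z5" "u0 \<in> Z6" "us \<in> Z5" "us \<in> Z6" "a1 \<in> Z6"
      using iZ by (simp_all add: up)
    have n: "\<not> g us u0" "\<not> g a1 u0" "\<not> g a1 us" "\<not> g a2 u0" "\<not> g a2 us" "\<not> g a2 a1"
      "\<not> g a0 u0" "\<not> g a0 us" "\<not> g a0 a1" "\<not> g a0 a2"
      using nf[OF us(1) iZ(3) fu0(6)] nf[OF a1(1) m(1) fu0(6)] nf[OF a1(1) iZ(4) fus(6)] nf[OF a2(1) m(2) fu0(6)]
        nf[OF a2(1) m(4) fus(6)] nf[OF a2(1) iZ(5) fa1(6)] nf[OF a0(1) m(3) fu0(6)] nf[OF a0(1) m(5) fus(6)]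
        nf[OF a0(1) m(6) fa1(6)] nf[OF a0(1) iZ(6) fa2(6)] by blast+
    have n': "\<not> g u0 us" "\<not> g u0 a1" "\<not> g us a1" "\<not> g u0 a2" "\<not> g us a2" "\<not> g a1 a2"
      "\<not> g u0 a0" "\<not> g us a0" "\<not> g a1 a0" "\<not> g a2 a0"
      using n gs by blast+
    show ?thesis using that n n' gi[of l] by (elim insertE emptyE) (simp_all add: gi)
  qed
  \<comment> \<open>In \<open>RI\<close> the image is a fresh vertex of B, in \<open>RII\<close> the
    preimage is a fresh vertex of A. Within each class independence excludes conflicts, so only
    mixed pairs need an argument.\<close>
  define RI where "RI = {(c, w1), (c0, w0)} \<union> (if cs = c then {} else {(cs, ws)}) \<union> X0 \<times> {z0} \<union> Xs \<times> {zs}"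
  define RII where "RII = {(u0, ys), (us, y0)} \<union> {a1} \<times> V1 \<union> {a2} \<times> Vs \<union> {a0} \<times> V0"
  define H where "H = {a1} \<times> V1 \<union> {a2} \<times> Vs \<union> {a0} \<times> V0 \<union> X0 \<times> {z0} \<union> Xs \<times> {zs}"
  let ?R = "RI \<union> RII"
  have cI: "fst p = c \<and> snd p = w1 \<and> lv (fst p) = 0 \<and> lv (snd p) = 1 \<or> fst p = c0 \<and> snd p = w0 \<and> lv (fst p) = 0 \<and> lv (snd p) = 3 \<or>
      cs \<noteq> c \<and> fst p = cs \<and> snd p = ws \<and> lv (fst p) = 0 \<and> lv (snd p) = 2 \<or>
      fst p \<in> X0 \<and> snd p = z0 \<and> lv (fst p) = 4 \<and> lv (snd p) = 9 \<or> fst p \<in> Xs \<and> snd p = zs \<and> lv (fst p) = 5 \<and> lv (snd p) = 10"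
    if "p \<in> RI" for p
  proof -
    have "p = (c, w1) \<or> p = (c0, w0) \<or> cs \<noteq> c \<and> p = (cs, ws) \<or> fst p \<in> X0 \<and> snd p = z0 \<or> fst p \<in> Xs \<and> snd p = zs"
      using that unfolding RI_def by (auto split: if_splits)
    then show ?thesis by (elim disjE conjE) (simp_all add: lA lB lX0 lXs)
  qed
  have cII: "fst p = u0 \<and> snd p = ys \<and> lv (fst p) = 4 \<and> lv (snd p) = 0 \<or> fst p = us \<and> snd p = y0 \<and> lv (fst p) = 5 \<and> lv (snd p) = 0 \<or>
      fst p = a1 \<and> snd p \<in> V1 \<and> lv (fst p) = 6 \<and> lv (snd p) = 1 \<or> fst p = a2 \<and> snd p \<in> Vs \<and> lv (fst p) = 7 \<and> lv (snd p) = 2 \<or>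
      fst p = a0 \<and> snd p \<in> V0 \<and> lv (fst p) = 8 \<and> lv (snd p) = 3"
    if "p \<in> RII" for p
  proof -
    have "p = (u0, ys) \<or> p = (us, y0) \<or> fst p = a1 \<and> snd p \<in> V1 \<or> fst p = a2 \<and> snd p \<in> Vs \<or> fst p = a0 \<and> snd p \<in> V0"
      using that unfolding RII_def by auto
    then show ?thesis by (elim disjE conjE) (simp_all add: lA lB lV1 lVs lV0)
  qed
  have I1e: "fst p = fst p' \<and> snd p = snd p'" if "p \<in> RI" "p' \<in> RI" "lv (snd p) = lv (snd p')" for p p'
    using that(3) cI[OF that(1)] cI[OF that(2)] u4[of "fst p" "fst p'"] u5[of "fst p" "fst p'"] by (elim disjE conjE) simp_all
  \<comment> \<open>\<open>F\<close> recovers the level of the image from the preimage, so equal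
    first components give equal second ones. \<open>G\<close> does the converse for
    \<open>RII\<close>.\<close>
  define F where "F x = (if x = c then 1 else if x = c0 then 3 else if lv x = 0 then 2 else if lv x = 4 then 9 else (10::nat))" for x
  have lF: "lv (snd p) = F (fst p)" if "p \<in> RI" for p
    using cI[OF that] u0(2) us(2) lA lX0 lXs unfolding F_def by (elim disjE conjE) auto
  have I1: "fst p = fst p' \<longleftrightarrow> snd p = snd p'" if "p \<in> RI" "p' \<in> RI" for p p'
  proof
    assume "fst p = fst p'"
    then have "lv (snd p) = lv (snd p')" using lF[OF that(1)] lF[OF that(2)] by simp
    then show "snd p = snd p'" using I1e[OF that] by blast
  next
    assume "snd p = snd p'"
    then have "lv (snd p) = lv (snd p')" by simp
    then show "fst p = fst p'" using I1e[OF that] by blast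
  qed
  have I2e: "fst p = fst p' \<and> snd p = snd p'" if "p \<in> RII" "p' \<in> RII" "lv (fst p) = lv (fst p')" for p p'
    using that(3) cII[OF that(1)] cII[OF that(2)] u1[of "snd p" "snd p'"] u2[of "snd p" "snd p'"] u3[of "snd p" "snd p'"]
    by (elim disjE conjE) simp_all
  define G where "G x = (if x = ys then 4 else if x = y0 then 5 else if lv x = 1 then 6 else if lv x = 2 then 7 else (8::nat))" for x
  have lG: "lv (fst p) = G (snd p)" if "p \<in> RII" for p
    using cII[OF that] w0(2) lB lV1 lVs lV0 unfolding G_def by (elim disjE conjE) auto
  have I2: "fst p = fst p' \<longleftrightarrow> snd p = snd p'" if "p \<in> RII" "p' \<in> RII" for p p'
  proof
    assume "snd p = snd p'"
    then have "lv (fst p) = lv (fst p')" using lG[OF that(1)] lG[OF that(2)] by simp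
    then show "fst p = fst p'" using I2e[OF that] by blast
  next
    assume "fst p = fst p'"
    then have "lv (fst p) = lv (fst p')" by simp
    then show "snd p = snd p'" using I2e[OF that] by blast
  qed
  have k1: "lv (fst p) = 0 \<or> fst p \<in> X0 \<or> fst p \<in> Xs" "snd p \<in> {w1, ws, w0, z0, zs}" if "p \<in> RI" for p
    using cI[OF that] by blast+
  have k2: "lv (fst p) \<noteq> 0" "fst p \<notin> X0" "fst p \<notin> Xs" if "p \<in> RII" for p
  proof -
    show "lv (fst p) \<noteq> 0" using cII[OF that] by (elim disjE conjE) simp_all
    show "fst p \<notin> X0"
    proof
      assume x: "fst p \<in> X0"
      then show False using lX0[OF x] cII[OF that] self(4) by (elim disjE conjE) simp_all
    qed
    show "fst p \<notin> Xs"
    proof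
      assume x: "fst p \<in> Xs"
      then show False using lXs[OF x] cII[OF that] self(5) by (elim disjE conjE) simp_all
    qed
  qed
  have k3: "snd p \<noteq> w1" "snd p \<noteq> ws" "snd p \<noteq> w0" "snd p \<noteq> z0" "snd p \<noteq> zs" if "p \<in> RII" for p
  proof -
    show "snd p \<noteq> w1" using cII[OF that] self(1) lB by (elim disjE conjE) auto
    show "snd p \<noteq> ws" using cII[OF that] self(2) lB by (elim disjE conjE) auto
    show "snd p \<noteq> w0" using cII[OF that] self(3) lB by (elim disjE conjE) auto
    show "snd p \<noteq> z0" using cII[OF that] lB by (elim disjE conjE) auto
    show "snd p \<noteq> zs" using cII[OF that] lB by (elim disjE conjE) auto
  qed
  have I3: "fst p \<noteq> fst p'" "snd p \<noteq> snd p'" if "p \<in> RI" "p' \<in> RII" for p p'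
  proof -
    show "fst p \<noteq> fst p'" using k1(1)[OF that(1)] k2[OF that(2)] by auto
    show "snd p \<noteq> snd p'" using k1(2)[OF that(1)] k3[OF that(2)] by auto
  qed
  have II: "fst p = fst p' \<longleftrightarrow> snd p = snd p'" if "p \<in> ?R" "p' \<in> ?R" for p p'
    using that I1[of p p'] I2[of p p'] I3[of p p'] I3[of p' p] by (elim UnE) auto
  have inj: "inj_on fst ?R" "inj_on snd ?R" using II by (auto simp: inj_on_def prod_eq_iff)
  have S1: "fst p = u0" if "p \<in> RII" "snd p = ys" for p using cII[OF that(1)] that(2) w0(2) lB by (elim disjE conjE) simp_all
  have S2: "fst p = us" if "p \<in> RII" "snd p = y0" for p using cII[OF that(1)] that(2) w0(2) lB by (elim disjE conjE) simp_all
  have S3: "fst p = a1" if "p \<in> RII" "snd p \<in> V1" for p using cII[OF that(1)] lV1[OF that(2)] by (elim disjE conjE) simp_all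
  have S4: "fst p = a2" if "p \<in> RII" "snd p \<in> Vs" for p using cII[OF that(1)] lVs[OF that(2)] by (elim disjE conjE) simp_all
  have S5: "fst p = a0" if "p \<in> RII" "snd p \<in> V0" for p using cII[OF that(1)] lV0[OF that(2)] by (elim disjE conjE) simp_all
  have S6: "snd p = ys" if "p \<in> RII" "fst p = u0" for p using cII[OF that(1)] that(2) lA by (elim disjE conjE) simp_all
  have S7: "snd p = y0" if "p \<in> RII" "fst p = us" for p using cII[OF that(1)] that(2) lA by (elim disjE conjE) simp_all
  have RIIB: "snd p \<in> B" "fst p \<in> {u0, us, a1, a2, a0}" if "p \<in> RII" for p
    using cII[OF that] fw1(3) fw0(3) fV1(1) fVs(1) fV0(1) by (elim disjE conjE; simp)+
  have RIA: "fst p \<in> A" "snd p \<in> {w1, ws, w0, z0, zs}" if "p \<in> RI" for p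
    using cI[OF that] c(1) fu0(3) fus(3) fX0(1) fXs(1) by (elim disjE conjE; simp)+
  have RIB: "snd p \<in> B" if "p \<in> RI" for p
    using RIA(2)[OF that] fw1(1) fws(1) fw0(1) fz0(1) fzs(1) by auto
  have RIIA: "fst p \<in> A" if "p \<in> RII" for p
    using RIIB(2)[OF that] fu0(1) fus(1) fa1(1) fa2(1) fa0(1) by auto
  \<comment> \<open>A nonheavy neighbour of \<open>u0\<close> in A lies in all later sets, so no
    later fresh vertex of A sees it.\<close>
  have F1: "fst p = u0" if p: "p \<in> RII" and x: "x \<in> X0" "g x (fst p)" for p x
  proof (rule ccontr)
    assume ne: "fst p \<noteq> u0"
    have xB: "x \<notin> Big" using fX0(1)[OF x(1)] by blast
    have "x \<in> Z3" using x(1) sX0 by blast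
    then have "x \<in> Z3" "x \<in> Z4" "x \<in> Z5" "x \<in> Z6" by (simp_all add: up)
    then have "\<not> g us x" "\<not> g a1 x" "\<not> g a2 x" "\<not> g a0 x"
      using nf[OF us(1) _ xB] nf[OF a1(1) _ xB] nf[OF a2(1) _ xB] nf[OF a0(1) _ xB] by blast+
    then show False using ne RIIB(2)[OF p] x(2) gs[of x "fst p"] by auto
  qed
  have F2: "fst p = us" if p: "p \<in> RII" and x: "x \<in> Xs" "g x (fst p)" for p x
  proof (rule ccontr)
    assume ne: "fst p \<noteq> us"
    have xf: "x \<notin> Big" "x \<notin> Z3" "x \<in> A" using fXs(1)[OF x(1)] by blast+
    have "x \<in> Z4" using x(1) sXs by blast
    then have "x \<in> Z4" "x \<in> Z5" "x \<in> Z6" by (simp_all add: up)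
    then have "\<not> g a1 x" "\<not> g a2 x" "\<not> g a0 x"
      using nf[OF a1(1) _ xf(1)] nf[OF a2(1) _ xf(1)] nf[OF a0(1) _ xf(1)] by blast+
    moreover have "\<not> g u0 x" using xf(2,3) Z3(3) by auto
    ultimately show False using ne RIIB(2)[OF p] x(2) gs[of x "fst p"] by auto
  qed
  have cu: "\<not> g u0 c" "\<not> g u0 cs" "\<not> g us c0"
    using fu0(8)[OF upB(2)[OF cBig]] fu0(8)[OF upB(2)[OF fus(4)]] fus(8)[OF upB(3)[OF fu0(4)]] u0(2) us(2) by auto
  \<comment> \<open>For c, \<open>c0\<close>, \<open>cs\<close> the neighbours of the image in B are
    known, and their preimages miss the heavy vertex. A vertex of \<open>X0\<close> or
    \<open>Xs\<close> is adjacent to no preimage but \<open>u0\<close> or \<open>us\<close>, and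
    \<open>z0\<close>, \<open>zs\<close> miss the images \<open>ys\<close>, \<open>y0\<close> of
    these.\<close>
  have cf12: "\<not> g (snd p) (snd q)" if p: "p \<in> RI" and q: "q \<in> RII" and e: "g (fst p) (fst q)" for p q
  proof
    assume e': "g (snd p) (snd q)"
    have qB: "snd q \<in> B" using RIIB(1)[OF q] .
    have e2: "g (fst q) (fst p)" using e gs[of "fst p" "fst q"] by simp
    consider "fst p = c" "snd p = w1" | "fst p = c0" "snd p = w0" | "fst p = cs" "snd p = ws"
      | "fst p \<in> X0" "snd p = z0" | "fst p \<in> Xs" "snd p = zs" using cI[OF p] by blast
    then show False
    proof cases
      case 1
      then have "snd q = ys \<or> snd q \<in> V1" using e' qB by (auto simp: V1_def)
      then show False using S1[OF q] S3[OF q] e2 1(1) cu(1) a1(2) by auto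
    next
      case 2
      then have "snd q = y0 \<or> snd q \<in> V0" using e' qB by (auto simp: V0_def)
      then show False using S2[OF q] S5[OF q] e2 2(1) cu(3) a0(2) by auto
    next
      case 3
      then have "snd q = ys \<or> snd q \<in> Vs" using e' qB by (auto simp: Vs_def)
      then show False using S1[OF q] S4[OF q] e2 3(1) cu(2) a2(2) by auto
    next
      case 4
      then have "snd q = ys" using S6[OF q F1[OF q _ e]] by blast
      then show False using e' 4(2) z0(2) by simp
    next
      case 5
      then have "snd q = y0" using S7[OF q F2[OF q _ e]] by blast
      then show False using e' 5(2) zs(2) by simp
    qed
  qed
  have AB: "x \<notin> B" if "x \<in> A" for x using that dj by blast
  have ne: "\<not> g (fst p) (snd p)" if p: "p \<in> ?R" for p
    using p
  proof
    assume p: "p \<in> RI"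
    have cB: "c \<noteq> ys" "c0 \<noteq> y0" "cs \<noteq> ys" using AB[OF c(1)] AB[OF fu0(3)] AB[OF fus(3)] fw1(3) fw0(3) by blast+
    have "\<not> g w0 c0" "\<not> g ws cs" using fw0(8)[OF upB(1)[OF fu0(4)]] fws(8)[OF upB(9)[OF fus(4)]] cB by auto
    moreover have "\<not> g z0 x" if "x \<in> X0" for x
    proof -
      have "x \<in> Z3" using sX0 that by blast
      then show ?thesis using fX0(1)[OF that] by (intro nf[OF z0(1)]) (simp_all add: up)
    qed
    moreover have "\<not> g zs x" if "x \<in> Xs" for x
    proof -
      have "x \<in> Z4" using sXs that by blast
      then show ?thesis using fXs(1)[OF that] by (intro nf[OF zs(1)]) (simp_all add: up)
    qed
    ultimately have "\<not> g (snd p) (fst p)" using cI[OF p] w1(2) by (elim disjE conjE) simp_all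
    then show ?thesis using gs[of "fst p" "snd p"] by simp
  next
    assume p: "p \<in> RII"
    have cB: "c0 \<noteq> ys" "cs \<noteq> y0" using AB[OF fu0(3)] AB[OF fus(3)] fw1(3) fw0(3) by blast+
    have "\<not> g u0 ys" "\<not> g us y0" using fu0(8)[OF upB(2)[OF fw1(4)]] fus(8)[OF upB(3)[OF fw0(4)]] cB by auto
    moreover have "\<not> g a1 x" if "x \<in> V1" for x
    proof -
      have "x \<in> Z0" using sV1 that by blast
      then show ?thesis using fV1(1)[OF that] by (intro nf[OF a1(1)]) (simp_all add: up)
    qed
    moreover have "\<not> g a2 x" if "x \<in> Vs" for x
    proof -
      have "x \<in> Z1" using sVs that by blast
      then show ?thesis using fVs(1)[OF that] by (intro nf[OF a2(1)]) (simp_all add: up)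
    qed
    moreover have "\<not> g a0 x" if "x \<in> V0" for x
    proof -
      have "x \<in> Z2" using sV0 that by blast
      then show ?thesis using fV0(1)[OF that] by (intro nf[OF a0(1)]) (simp_all add: up)
    qed
    ultimately show ?thesis using cII[OF p] by (elim disjE conjE) simp_all
  qed
  have fH: "finite H" unfolding H_def using fV1(2) fVs(2) fV0(2) fX0(2) fXs(2) by simp
  have cH: "card H \<le> 5"
  proof -
    have "card H \<le> card ({a1} \<times> V1) + card ({a2} \<times> Vs) + card ({a0} \<times> V0) + card (X0 \<times> {z0}) + card (Xs \<times> {zs})"
      unfolding H_def by (meson card_Un_le order_trans add_le_mono order_refl)
    also have "\<dots> \<le> 5" using fV1(3) fVs(3) fV0(3) fX0(3) fXs(3) by (simp add: card_cartesian_product)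
    finally show ?thesis .
  qed
  \<comment> \<open>In each of these pairs the light member has all its neighbours on its own side
    placed, so the pair creates no edge.\<close>
  define R5 where "R5 = {(c, w1), (c0, w0), (u0, ys), (us, y0)} \<union> (if cs = c then {} else {(cs, ws)})"
  have R5H: "?R = R5 \<union> H" unfolding RI_def RII_def R5_def H_def by blast
  have fR5: "finite R5" "card R5 \<le> 5"
  proof -
    show "finite R5" by (simp add: R5_def)
    have "R5 \<subseteq> set [(c, w1), (c0, w0), (u0, ys), (us, y0), (cs, ws)]" by (auto simp: R5_def)
    then have "card R5 \<le> card (set [(c, w1), (c0, w0), (u0, ys), (us, y0), (cs, ws)])" by (intro card_mono) auto
    also have "\<dots> \<le> 5" using card_length[of "[(c, w1), (c0, w0), (u0, ys), (us, y0), (cs, ws)]"] by simp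
    finally show "card R5 \<le> 5" .
  qed
  have snd: "ys \<in> snd ` ?R" "y0 \<in> snd ` ?R" "V1 \<subseteq> snd ` ?R" "Vs \<subseteq> snd ` ?R" "V0 \<subseteq> snd ` ?R"
    unfolding RII_def by force+
  have fst: "c0 \<in> fst ` ?R" "cs \<in> fst ` ?R" "X0 \<subseteq> fst ` ?R" "Xs \<subseteq> fst ` ?R"
    unfolding RI_def by (force split: if_splits)+
  have d1: "dg g (B - snd ` ?R) w1 = 0"
    using snd(1,3) fin by (subst dg_zero_iff) (auto simp: V1_def)
  have d2: "dg g (B - snd ` ?R) ws = 0"
    using snd(1,4) fin by (subst dg_zero_iff) (auto simp: Vs_def)
  have d3: "dg g (B - snd ` ?R) w0 = 0"
    using snd(2,5) fin by (subst dg_zero_iff) (auto simp: V0_def)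
  have d4: "dg g (A - fst ` ?R) u0 = 0"
    using fst(1,3) fin by (subst dg_zero_iff) (auto simp: X0_def)
  have d5: "dg g (A - fst ` ?R) us = 0"
    using fst(2,4) fin by (subst dg_zero_iff) (auto simp: Xs_def)
  have T2: "2 \<le> ?T" using n_large by simp
  show False
  proof (rule reduction_pairs[where Rl = ?R and c = c and w = w1 and H = H])
    show "finite ?R" unfolding R5H using fR5 fH by simp
    show "card ?R \<le> 10" unfolding R5H using card_Un_le[of R5 H] fR5(2) cH by linarith
    show "fst p \<in> A \<and> snd p \<in> B \<and> \<not> g (fst p) (snd p)" if "p \<in> ?R" for p
      using that ne[OF that] RIA(1)[of p] RIB[of p] RIIA[of p] RIIB(1)[of p] by blast
    show "inj_on fst ?R" "inj_on snd ?R" by (rule inj)+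
    show "\<not> g (snd p) (snd q)" if p: "p \<in> ?R" and q: "q \<in> ?R" and e: "g (fst p) (fst q)" for p q
      using p
    proof
      assume pI: "p \<in> RI"
      show ?thesis using q
      proof
        assume "q \<in> RI"
        then show ?thesis using LB RIA(2)[OF pI] RIA(2)[of q] by blast
      next
        assume "q \<in> RII"
        then show ?thesis using cf12[OF pI _ e] by blast
      qed
    next
      assume pII: "p \<in> RII"
      show ?thesis using q
      proof
        assume "q \<in> RII"
        then have "\<not> g (fst p) (fst q)" using LA RIIB(2)[OF pII] RIIB(2)[of q] by blast
        then show ?thesis using e by blast
      next
        assume "q \<in> RI"
        then have "\<not> g (snd q) (snd p)" using cf12[OF _ pII] e gs[of "fst p" "fst q"] by blast
        then show ?thesis using gs[of "snd p" "snd q"] by blast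
      qed
    qed
    show "(c, w1) \<in> ?R" by (simp add: RI_def)
    show "dg g (B - snd ` ?R) w1 = 0" by (rule d1)
    show "real n / 100 \<le> D c" by (rule c100)
    show "H \<subseteq> ?R" unfolding R5H by blast
    have "c \<noteq> a1" "c \<noteq> a2" "c \<noteq> a0" "c \<notin> X0" "c \<notin> Xs" using lA lX0 lXs by auto
    then show "(c, w1) \<notin> H" unfolding H_def by blast
    show "card H \<le> 5" by (rule cH)
    show "dg g (A - fst ` ?R) (fst p) = 0 \<or> dg g (B - snd ` ?R) (snd p) = 0" if p: "p \<in> ?R - H" for p
    proof -
      have "p \<in> R5" using p unfolding R5H by blast
      then have "p = (c, w1) \<or> p = (c0, w0) \<or> p = (u0, ys) \<or> p = (us, y0) \<or> p = (cs, ws)" by (auto simp: R5_def split: if_splits)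
      then show ?thesis using d1 d2 d3 d4 d5 by (elim disjE) simp_all
    qed
    show "dg g A (fst p) \<le> ?T \<and> dg g B (snd p) \<le> ?T \<and> dg g A (fst p) * dg g B (snd p) \<le> 2 * ?T" if p: "p \<in> H" for p
    proof -
      have hl: "dg g A l \<le> 2" "dg g B l \<le> 2" if "D l \<le> 2" for l using dg_le_D[of l] that by linarith+
      have "dg g A (fst p) \<le> 2 \<and> dg g B (snd p) \<le> ?T \<or> dg g A (fst p) \<le> ?T \<and> dg g B (snd p) \<le> 2"
      proof -
        consider "fst p \<in> {a1, a2, a0}" "snd p \<in> V1 \<union> Vs \<union> V0" | "fst p \<in> X0 \<union> Xs" "snd p \<in> {z0, zs}"
          using p unfolding H_def by auto
        then show ?thesis
        proof cases
          case 1
          have "dg g A (fst p) \<le> 2" using 1(1) hl(1)[OF fa1(7)] hl(1)[OF fa2(7)] hl(1)[OF fa0(7)] by auto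
          moreover have "snd p \<in> V" "snd p \<notin> Big" using 1(2) fV1(1) fVs(1) fV0(1) by blast+
          ultimately show ?thesis using not_Big_dg(2) by blast
        next
          case 2
          have "dg g B (snd p) \<le> 2" using 2(2) hl(2)[OF fz0(7)] hl(2)[OF fzs(7)] by auto
          moreover have "fst p \<in> V" "fst p \<notin> Big" using 2(1) fX0(1) fXs(1) by blast+
          ultimately show ?thesis using not_Big_dg(1) by blast
        qed
      qed
      then show ?thesis
      proof
        assume h: "dg g A (fst p) \<le> 2 \<and> dg g B (snd p) \<le> ?T"
        then have "dg g A (fst p) * dg g B (snd p) \<le> 2 * ?T" by (intro mult_mono) auto
        then show ?thesis using h T2 by linarith
      next
        assume h: "dg g A (fst p) \<le> ?T \<and> dg g B (snd p) \<le> 2"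
        then have "dg g A (fst p) * dg g B (snd p) \<le> ?T * 2" by (intro mult_mono) auto
        then show ?thesis using h T2 by linarith
      qed
    qed
    show "dg g B x \<le> 9/10 * real n" if "x \<in> A" "x \<noteq> c" for x by (rule no_giant_A[OF that])
    show "dg g A x \<le> 9/10 * real n" if "x \<in> B" for x
      using no_giant_B[OF that] no_giant_b by (cases "x = b") simp_all
  qed
qed

text \<open>A light vertex of A nonadjacent to b, or of B nonadjacent to c, must have a heavy
  neighbour on its own side, and lightness makes it the only neighbour in \<open>Z\<close>.\<close>

lemma pick:
  assumes Z: "Big \<subseteq> Z" "Z \<subseteq> V" "real (card Z) \<le> 150000"
  shows "c' \<in> A \<Longrightarrow> \<exists>u k. fresh A Z u k \<and> \<not> g u c'"
    and "b' \<in> B \<Longrightarrow> \<exists>w k. fresh B Z w k \<and> \<not> g w c \<and> \<not> g w b'"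
proof -
  assume "c' \<in> A"
  then obtain u where u: "u \<in> light g V Z 3 A" "\<not> g u b" "\<not> g u c'" using room(1)[OF Z] by blast
  obtain k where k: "k \<in> A" "k \<in> Big" "g u k"
    using leaf_light_A[OF b Z(1,2) u(1)] u(2) gs[of b u] by blast
  have kZ: "k \<in> Z" using k(2) Z(1) by blast
  have "\<forall>z\<in>Z. g u z \<longrightarrow> z = k" using light3_unique[OF Z(2) u(1) _ kZ _ k(3)] by blast
  then have "fresh A Z u k"
    unfolding fresh_def using lightD(1,2)[OF Z(2) u(1)] k light3_D2[OF Z(2) u(1) kZ k(3)] by blast
  then show "\<exists>u k. fresh A Z u k \<and> \<not> g u c'" using u(3) by blast
next
  assume "b' \<in> B"
  then obtain w where w: "w \<in> light g V Z 3 B" "\<not> g w c" "\<not> g w b'" using room(2)[OF Z] by blast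
  obtain k where k: "k \<in> B" "k \<in> Big" "g w k"
    using leaf_light[OF c Z(1,2) w(1)] w(2) gs[of c w] by blast
  have kZ: "k \<in> Z" using k(2) Z(1) by blast
  have "\<forall>z\<in>Z. g w z \<longrightarrow> z = k" using light3_unique[OF Z(2) w(1) _ kZ _ k(3)] by blast
  then have "fresh B Z w k"
    unfolding fresh_def using lightD(1,2)[OF Z(2) w(1)] k light3_D2[OF Z(2) w(1) kZ k(3)] by blast
  then show "\<exists>w k. fresh B Z w k \<and> \<not> g w c \<and> \<not> g w b'" using w(2,3) by blast
qed

lemma enlarge:
  assumes Z: "Big \<subseteq> Z" "Z \<subseteq> V" "real (card Z) \<le> m" and l: "fresh S Z l k" "S \<subseteq> V"
  obtains Z' where "Z \<subseteq> Z'" "l \<in> Z'" "nb g V l \<subseteq> Z'" "Big \<subseteq> Z'" "Z' \<subseteq> V" "real (card Z') \<le> m + 3"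
proof
  let ?Z = "Z \<union> insert l (nb g V l)"
  show "Z \<subseteq> ?Z" "l \<in> ?Z" "nb g V l \<subseteq> ?Z" "Big \<subseteq> ?Z" using Z by auto
  show "?Z \<subseteq> V" using Z l by (auto simp: fresh_def)
  have "real (card (nb g V l)) \<le> 2" using l by (simp add: fresh_def dg_def)
  moreover have "card ?Z \<le> card Z + card (insert l (nb g V l))" by (rule card_Un_le)
  moreover have "card (insert l (nb g V l)) \<le> card (nb g V l) + 1"
    using card_insert_le_m1[of "card (nb g V l) + 1" "nb g V l" l] by simp
  ultimately show "real (card ?Z) \<le> m + 3" using Z(3) by linarith
qed

text \<open>One representative per heavy vertex of \<open>B\<close> is put into \<open>Z\<^sub>0\<close> together with its neighbours, so that a
  further light vertex of some class is nonadjacent to the representative of its class and shares only the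
  heavy neighbour with it.\<close>

lemma representatives:
  obtains Z0 w1 ws ys where "Big \<subseteq> Z0" "Z0 \<subseteq> V" "real (card Z0) \<le> 108000" "w1 \<in> Z0" "nb g V w1 \<subseteq> Z0"
    "fresh B Big w1 ys" "\<not> g w1 c" "fresh B Z0 ws ys"
proof -
  define P where "P y w \<longleftrightarrow> fresh B Big w y \<and> \<not> g w c" for y w
  \<comment> \<open>\<open>w1\<close> and \<open>ws\<close> must share \<open>ys\<close>, but the
    class of \<open>ws\<close> is not known in advance; so a candidate for \<open>w1\<close> is
    reserved in every class before \<open>ws\<close> is chosen.\<close>
  define rep where "rep y = (SOME w. P y w)" for y
  define Y where "Y = {y\<in>Big. \<exists>w. P y w}"
  have rp: "P y (rep y)" if "y \<in> Y" for y using that someI_ex[of "P y"] by (auto simp: Y_def rep_def)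
  have fY: "finite Y" "card Y \<le> card Big" using Big_sub(2) card_mono[of Big Y] by (auto simp: Y_def)
  define O' where "O' = (\<Union>y\<in>Y. nb g V (rep y) - Big)"
  have "card (nb g V (rep y) - Big) \<le> 1" if y: "y \<in> Y" for y
  proof -
    have f: "fresh B Big (rep y) y" using rp[OF y] by (simp add: P_def)
    note ff = fresh_facts[OF f order_refl Un_upper2]
    have "real (card (nb g V (rep y))) \<le> 2" using ff(7) by (simp add: dg_def)
    moreover have "y \<in> nb g V (rep y)" using ff(3,5) by simp
    moreover have "nb g V (rep y) - Big \<subseteq> nb g V (rep y) - {y}" using ff(4) by blast
    then have "card (nb g V (rep y) - Big) \<le> card (nb g V (rep y) - {y})" using finV by (intro card_mono) auto
    ultimately show ?thesis using finV by simp
  qed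
  then have "(\<Sum>y\<in>Y. card (nb g V (rep y) - Big)) \<le> (\<Sum>y\<in>Y. 1)" by (intro sum_mono)
  moreover have "card O' \<le> (\<Sum>y\<in>Y. card (nb g V (rep y) - Big))" unfolding O'_def using fY(1) by (rule card_UN_le)
  ultimately have cO: "card O' \<le> card Y" by simp
  define Z0 where "Z0 = Big \<union> rep ` Y \<union> O'"
  have "rep y \<in> V" if "y \<in> Y" for y using rp[OF that] by (simp add: P_def fresh_def)
  then have Z0: "Big \<subseteq> Z0" "Z0 \<subseteq> V" using Big_sub(1) by (auto simp: Z0_def O'_def)
  have "card Z0 \<le> card Big + card (rep ` Y) + card O'" unfolding Z0_def by (rule card_Un3_le)
  \<comment> \<open>Each heavy vertex accounts for itself, a representative and one further
    neighbour: 3 * 36000.\<close>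
  then have cZ: "real (card Z0) \<le> 108000" using card_image_le[OF fY(1), of rep] fY(2) cO card_Big by linarith
  obtain ws ys where w: "fresh B Z0 ws ys" "\<not> g ws c"
    using pick(2)[OF Z0 _ b(1)] cZ by auto
  have "P ys ws" using w Z0(1) unfolding P_def fresh_def by blast
  then have yY: "ys \<in> Y" using w(1) by (auto simp: Y_def fresh_def)
  have "rep ys \<in> Z0" using yY by (simp add: Z0_def)
  moreover have "nb g V (rep ys) \<subseteq> Z0" using yY by (auto simp: Z0_def O'_def)
  moreover have "fresh B Big (rep ys) ys" "\<not> g (rep ys) c" using rp[OF yY] by (simp_all add: P_def)
  ultimately show thesis using that[OF Z0 cZ _ _ _ _ w(1)] by blast
qed

text \<open>Eight enlargements by at most three vertices stay far below 150000. Asking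
  \<open>w0\<close> to miss \<open>ys\<close>, \<open>u0\<close> to miss c and \<open>us\<close> to
  miss \<open>c0\<close> makes consecutive heavy vertices on each side of the cycle
  distinct.\<close>

lemma two_heavy_sides_false: False
proof -
  have AV: "A \<subseteq> V" and BV: "B \<subseteq> V" by auto
  obtain Z0 w1 ws ys where Z0: "Big \<subseteq> Z0" "Z0 \<subseteq> V" "real (card Z0) \<le> 108000" "w1 \<in> Z0" "nb g V w1 \<subseteq> Z0"
    and w1: "fresh B Big w1 ys" "\<not> g w1 c" and ws: "fresh B Z0 ws ys"
    by (rule representatives)
  have ysB: "ys \<in> B" using w1(1) by (simp add: fresh_def)
  obtain Z1 where Z1: "Z0 \<subseteq> Z1" "ws \<in> Z1" "nb g V ws \<subseteq> Z1" "Big \<subseteq> Z1" "Z1 \<subseteq> V" "real (card Z1) \<le> 108000 + 3"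
    by (rule enlarge[OF Z0(1-3) ws BV])
  obtain w0 y0 where w0: "fresh B Z1 w0 y0" "\<not> g w0 ys" using pick(2)[OF Z1(4,5) _ ysB] Z1(6) by auto
  have y0: "y0 \<in> B" "y0 \<noteq> ys" using w0 by (auto simp: fresh_def)
  obtain Z2 where Z2: "Z1 \<subseteq> Z2" "w0 \<in> Z2" "nb g V w0 \<subseteq> Z2" "Big \<subseteq> Z2" "Z2 \<subseteq> V" "real (card Z2) \<le> 108000 + 3 + 3"
    by (rule enlarge[OF Z1(4-6) w0(1) BV])
  obtain u0 c0 where u0: "fresh A Z2 u0 c0" "\<not> g u0 c" using pick(1)[OF Z2(4,5) _ c(1)] Z2(6) by auto
  have c0: "c0 \<in> A" "c0 \<noteq> c" using u0 by (auto simp: fresh_def)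
  obtain Z3 where Z3: "Z2 \<subseteq> Z3" "u0 \<in> Z3" "nb g V u0 \<subseteq> Z3" "Big \<subseteq> Z3" "Z3 \<subseteq> V" "real (card Z3) \<le> 108000 + 3 + 3 + 3"
    by (rule enlarge[OF Z2(4-6) u0(1) AV])
  obtain us cs where us: "fresh A Z3 us cs" "\<not> g us c0" using pick(1)[OF Z3(4,5) _ c0(1)] Z3(6) by auto
  have cs: "cs \<in> A" "cs \<noteq> c0" using us by (auto simp: fresh_def)
  obtain Z4 where Z4: "Z3 \<subseteq> Z4" "us \<in> Z4" "nb g V us \<subseteq> Z4" "Big \<subseteq> Z4" "Z4 \<subseteq> V" "real (card Z4) \<le> 108000 + 3 + 3 + 3 + 3"
    by (rule enlarge[OF Z3(4-6) us(1) AV])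
  obtain a1 k1 where a1: "fresh A Z4 a1 k1" "\<not> g a1 c" using pick(1)[OF Z4(4,5) _ c(1)] Z4(6) by auto
  obtain Z5 where Z5: "Z4 \<subseteq> Z5" "a1 \<in> Z5" "nb g V a1 \<subseteq> Z5" "Big \<subseteq> Z5" "Z5 \<subseteq> V" "real (card Z5) \<le> 108000 + 3 + 3 + 3 + 3 + 3"
    by (rule enlarge[OF Z4(4-6) a1(1) AV])
  obtain a2 k2 where a2: "fresh A Z5 a2 k2" "\<not> g a2 cs" using pick(1)[OF Z5(4,5) _ cs(1)] Z5(6) by auto
  obtain Z6 where Z6: "Z5 \<subseteq> Z6" "a2 \<in> Z6" "nb g V a2 \<subseteq> Z6" "Big \<subseteq> Z6" "Z6 \<subseteq> V" "real (card Z6) \<le> 108000 + 3 + 3 + 3 + 3 + 3 + 3"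
    by (rule enlarge[OF Z5(4-6) a2(1) AV])
  obtain a0 k0 where a0: "fresh A Z6 a0 k0" "\<not> g a0 c0" using pick(1)[OF Z6(4,5) _ c0(1)] Z6(6) by auto
  obtain Z7 where Z7: "Z6 \<subseteq> Z7" "a0 \<in> Z7" "nb g V a0 \<subseteq> Z7" "Big \<subseteq> Z7" "Z7 \<subseteq> V" "real (card Z7) \<le> 108000 + 3 + 3 + 3 + 3 + 3 + 3 + 3"
    by (rule enlarge[OF Z6(4-6) a0(1) AV])
  obtain z0 j0 where z0: "fresh B Z7 z0 j0" "\<not> g z0 ys" using pick(2)[OF Z7(4,5) _ ysB] Z7(6) by auto
  obtain Z8 where Z8: "Z7 \<subseteq> Z8" "z0 \<in> Z8" "nb g V z0 \<subseteq> Z8" "Big \<subseteq> Z8" "Z8 \<subseteq> V" "real (card Z8) \<le> 108000 + 3 + 3 + 3 + 3 + 3 + 3 + 3 + 3"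
    by (rule enlarge[OF Z7(4-6) z0(1) BV])
  obtain zs js where zs: "fresh B Z8 zs js" "\<not> g zs y0" using pick(2)[OF Z8(4,5) _ y0(1)] Z8(6) by auto
  show False
    by (rule core_config[OF Z0(1,2,4,5) w1 ws Z1(1-3) w0(1) y0(2) Z2(1-3) u0(1) c0(2) Z3(1-3) us(1) cs(2) Z4(1-3)
        a1 Z5(1-3) a2 Z6(1-3) a0 Z7(1-3) z0 Z8(1-3) zs])
qed

end

section \<open>The theorem\<close>

lemma no_counterexample_giant_A:
  assumes "counterexample n A B g M N" "c \<in> A" "real n / 100 \<le> dg g (A \<union> B) c" shows False
proof -
  interpret counterexample n A B g M N by fact
  show False
  proof (cases "\<exists>b\<in>B. 13 * real n / 6000 \<le> D b")
    case True
    then obtain b where b: "b \<in> B" "13 * real n / 6000 \<le> D b" by blast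
    interpret counterexample_two_heavy_giant n A B g M N c b
      using assms(2,3) b by unfold_locales auto
    show False by (rule two_heavy_sides_false)
  next
    case False
    interpret counterexample_giant n A B g M N c
      using assms(2,3) by unfold_locales
    show False using one_heavy_side_false False by (meson not_le)
  qed
qed

lemma no_counterexample:
  assumes "counterexample n A B g M N" shows False
proof -
  interpret counterexample n A B g M N by fact
  obtain c where c: "c \<in> A \<union> B" "real n / 100 \<le> D c" using exists_giant by blast
  show False
  proof (cases "c \<in> A")
    case True
    then show False using no_counterexample_giant_A[OF assms _ c(2)] by blast
  next
    case False
    then have "c \<in> B" using c(1) by blast
    then show False using no_counterexample_giant_A[OF swap, of c] c(2) by (simp add: Un_commute)
  qed
qed

lemma good_packs: "good n A B g M N \<Longrightarrow> pk A B g"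
proof (induction n arbitrary: A B g M N rule: less_induct)
  case (less n)
  show ?case
  proof (rule ccontr)
    assume "\<not> pk A B g"
    then have "counterexample n A B g M N" using less.prems less.IH by unfold_locales blast+
    then show False by (rule no_counterexample)
  qed
qed

section \<open>Translation between edge sets and the relation\<close>

lemma degree_dg:
  assumes "finite S" "\<And>e. e \<in> E \<Longrightarrow> x \<in> e \<Longrightarrow> \<exists>y\<in>S. e = {x, y}"
    and "\<And>y. y \<in> S \<Longrightarrow> g x y \<longleftrightarrow> {x, y} \<in> E"
  shows "real (degree E x) = dg g S x"
proof -
  have "bij_betw (\<lambda>y. {x, y}) (nb g S x) {e \<in> E. x \<in> e}"
    unfolding bij_betw_def
  proof
    show "inj_on (\<lambda>y. {x, y}) (nb g S x)" by (auto simp: inj_on_def doubleton_eq_iff)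
    show "(\<lambda>y. {x, y}) ` nb g S x = {e \<in> E. x \<in> e}"
    proof (intro equalityI subsetI)
      fix e assume "e \<in> {e \<in> E. x \<in> e}"
      then obtain y where "y \<in> S" "e = {x, y}" "e \<in> E" using assms(2) by blast
      then show "e \<in> (\<lambda>y. {x, y}) ` nb g S x" using assms(3) by auto
    qed (use assms(3) in auto)
  qed
  then show ?thesis unfolding degree_def dg_def by (simp add: bij_betw_same_card)
qed

lemma degree_le_max_degree: "finite V \<Longrightarrow> v \<in> V \<Longrightarrow> degree E v \<le> max_degree V E"
  unfolding max_degree_def by auto

theorem mainTheorem2:
  fixes n :: nat and V1 V2 :: "'a set" and E1 E2 E3 :: "'a set set"
  assumes "n \<ge> 2"
    and "graph_triple n V1 E1 V2 E2 E3"
    and "max_degree V1 E1 \<le> n - 2" and "max_degree V2 E2 \<le> n - 2"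
    and "max_degree (V1 \<union> V2) E3 \<le> n - 1"
    and "int (card E1) + int (card E2) + int (card E3)
           + int (max (max_degree V1 E1) (max_degree V2 E2)) + int (max_degree (V1 \<union> V2) E3)
         \<le> 3 * int n - 11 * 195^2"
  shows "packs V1 E1 V2 E2 E3"
proof -
  have dj: "V1 \<inter> V2 = {}" and cV: "card V1 = n" "card V2 = n" and fV: "finite V1" "finite V2"
    and E1: "\<And>e. e \<in> E1 \<Longrightarrow> e \<subseteq> V1 \<and> card e = 2" and E2: "\<And>e. e \<in> E2 \<Longrightarrow> e \<subseteq> V2 \<and> card e = 2"
    and E3: "\<And>e. e \<in> E3 \<Longrightarrow> \<exists>u\<in>V1. \<exists>v\<in>V2. e = {u, v}"
    using assms(2) unfolding graph_triple_def simple_graph_def bipartite_graph_def by auto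
  \<comment> \<open>As V1 and V2 are disjoint, each edge set can be recovered from the union by the
    sides on which the two ends lie.\<close>
  define g where "g x y \<longleftrightarrow> x \<noteq> y \<and> {x, y} \<in> E1 \<union> E2 \<union> E3" for x y
  have gr: "graph g" by (auto simp: graph_def g_def insert_commute)
  have e2: "\<exists>y\<in>S. e = {x, y}" if "e \<subseteq> S" "card e = 2" "x \<in> e" for e S and x :: 'a
    using that by (auto simp: card_2_iff)
  have n12: "e \<notin> E2 \<union> E3" if "e \<subseteq> V1" for e
    using that E2[of e] E3[of e] dj by (auto simp: card_2_iff)
  have n21: "e \<notin> E1 \<union> E3" if "e \<subseteq> V2" for e
    using that E1[of e] E3[of e] dj by (auto simp: card_2_iff)
  have g1: "g x y \<longleftrightarrow> {x, y} \<in> E1" if "x \<in> V1" "y \<in> V1" for x y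
    using that n12[of "{x, y}"] E1[of "{x, y}"] by (auto simp: g_def)
  have g2: "g x y \<longleftrightarrow> {x, y} \<in> E2" if "x \<in> V2" "y \<in> V2" for x y
    using that n21[of "{x, y}"] E2[of "{x, y}"] by (auto simp: g_def)
  have g3: "g x y \<longleftrightarrow> {x, y} \<in> E3" "g y x \<longleftrightarrow> {x, y} \<in> E3" if "x \<in> V1" "y \<in> V2" for x y
  proof -
    have "{x, y} \<notin> E1 \<union> E2" "x \<noteq> y" using that E1[of "{x, y}"] E2[of "{x, y}"] dj by auto
    then show "g x y \<longleftrightarrow> {x, y} \<in> E3" "g y x \<longleftrightarrow> {x, y} \<in> E3" by (auto simp: g_def insert_commute)
  qed
  have e3: "\<exists>y\<in>V2. e = {x, y}" if "e \<in> E3" "x \<in> e" "x \<in> V1" for e x using E3[OF that(1)] that dj by auto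
  have e3': "\<exists>y\<in>V1. e = {x, y}" if "e \<in> E3" "x \<in> e" "x \<in> V2" for e x using E3[OF that(1)] that dj by auto
  have d1: "real (degree E1 x) = dg g V1 x" if x: "x \<in> V1" for x
  proof (rule degree_dg[OF fV(1)])
    show "\<exists>y\<in>V1. e = {x, y}" if "e \<in> E1" "x \<in> e" for e using E1[OF that(1)] e2[OF _ _ that(2)] by blast
    show "g x y \<longleftrightarrow> {x, y} \<in> E1" if "y \<in> V1" for y by (rule g1[OF x that])
  qed
  have d2: "real (degree E2 x) = dg g V2 x" if x: "x \<in> V2" for x
  proof (rule degree_dg[OF fV(2)])
    show "\<exists>y\<in>V2. e = {x, y}" if "e \<in> E2" "x \<in> e" for e using E2[OF that(1)] e2[OF _ _ that(2)] by blast
    show "g x y \<longleftrightarrow> {x, y} \<in> E2" if "y \<in> V2" for y by (rule g2[OF x that])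
  qed
  have d3: "real (degree E3 x) = dg g V2 x" if x: "x \<in> V1" for x
  proof (rule degree_dg[OF fV(2)])
    show "\<exists>y\<in>V2. e = {x, y}" if "e \<in> E3" "x \<in> e" for e by (rule e3[OF that x])
    show "g x y \<longleftrightarrow> {x, y} \<in> E3" if "y \<in> V2" for y by (rule g3(1)[OF x that])
  qed
  have d3': "real (degree E3 x) = dg g V1 x" if x: "x \<in> V2" for x
  proof (rule degree_dg[OF fV(1)])
    show "\<exists>y\<in>V1. e = {x, y}" if "e \<in> E3" "x \<in> e" for e by (rule e3'[OF that x])
    show "g x y \<longleftrightarrow> {x, y} \<in> E3" if "y \<in> V1" for y using g3(2)[OF that x] by (simp add: insert_commute)
  qed
  have fE: "finite E1" "finite E2" "finite E3"
    using finite_subset[of E1 "Pow V1"] finite_subset[of E2 "Pow V2"] finite_subset[of E3 "Pow (V1 \<union> V2)"] E1 E2 E3 fV by auto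
  have s1: "(\<Sum>x\<in>V1. degree E1 x) = 2 * card E1"
    unfolding degree_def
  proof (rule sum_multicount[OF fV(1) fE(1)], intro ballI)
    fix e assume "e \<in> E1"
    then have "{x \<in> V1. x \<in> e} = e" "card e = 2" using E1 by auto
    then show "card {x \<in> V1. x \<in> e} = 2" by simp
  qed
  have s2: "(\<Sum>x\<in>V2. degree E2 x) = 2 * card E2"
    unfolding degree_def
  proof (rule sum_multicount[OF fV(2) fE(2)], intro ballI)
    fix e assume "e \<in> E2"
    then have "{x \<in> V2. x \<in> e} = e" "card e = 2" using E2 by auto
    then show "card {x \<in> V2. x \<in> e} = 2" by simp
  qed
  have s3: "(\<Sum>x\<in>V1. degree E3 x) = 1 * card E3"
    unfolding degree_def
  proof (rule sum_multicount[OF fV(1) fE(3)], intro ballI)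
    fix e assume "e \<in> E3"
    then obtain u v where e: "u \<in> V1" "v \<in> V2" "e = {u, v}" using E3 by blast
    then have "{x \<in> V1. x \<in> e} = {u}" using dj by auto
    then show "card {x \<in> V1. x \<in> e} = 1" by simp
  qed
  let ?M = "real (max (max_degree V1 E1) (max_degree V2 E2))" and ?N = "real (max_degree (V1 \<union> V2) E3)"
  have t1: "esum g V1 = 2 * real (card E1)"
  proof -
    have "esum g V1 = real (\<Sum>x\<in>V1. degree E1 x)" unfolding esum_def of_nat_sum using d1 by (intro sum.cong) auto
    then show ?thesis unfolding s1 by simp
  qed
  have t2: "esum g V2 = 2 * real (card E2)"
  proof -
    have "esum g V2 = real (\<Sum>x\<in>V2. degree E2 x)" unfolding esum_def of_nat_sum using d2 by (intro sum.cong) auto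
    then show ?thesis unfolding s2 by simp
  qed
  have t3: "(\<Sum>x\<in>V1. dg g V2 x) = real (card E3)"
  proof -
    have "(\<Sum>x\<in>V1. dg g V2 x) = real (\<Sum>x\<in>V1. degree E3 x)" unfolding of_nat_sum using d3 by (intro sum.cong) auto
    then show ?thesis unfolding s3 by simp
  qed
  have "real_of_int (int (card E1) + int (card E2) + int (card E3)
           + int (max (max_degree V1 E1) (max_degree V2 E2)) + int (max_degree (V1 \<union> V2) E3))
         \<le> real_of_int (3 * int n - 11 * 195^2)"
    using assms(6) by (simp only: of_int_le_iff)
  then have "real (card E1) + real (card E2) + real (card E3) + ?M + ?N \<le> 3 * real n - 418275" by simp
  then have e: "esum g (V1 \<union> V2) + 2 * ?M + 2 * ?N \<le> 6 * real n - 2 * 418275"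
    using esum_Un[OF gr fV dj] t1 t2 t3 by argo
  have b1: "dg g V1 x \<le> ?M" "dg g V1 x \<le> real n - 2" if "x \<in> V1" for x
    using degree_le_max_degree[OF fV(1) that, of E1] d1[OF that] assms(1,3) by (auto simp: of_nat_diff)
  have b2: "dg g V2 x \<le> ?M" "dg g V2 x \<le> real n - 2" if "x \<in> V2" for x
    using degree_le_max_degree[OF fV(2) that, of E2] d2[OF that] assms(1,4) by (auto simp: of_nat_diff)
  have b3: "real (degree E3 x) \<le> ?N" "real (degree E3 x) \<le> real n - 1" if "x \<in> V1 \<union> V2" for x
    using degree_le_max_degree[OF _ that, of E3] fV assms(1,5) by (auto simp: of_nat_diff)
  have "good n V1 V2 g ?M ?N"
    unfolding good_def
  proof (intro conjI ballI)
    fix x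
    show "dg g V1 x \<le> ?M" "dg g V1 x \<le> real n - 2" if "x \<in> V1" using b1[OF that] .
    show "dg g V2 x \<le> ?M" "dg g V2 x \<le> real n - 2" if "x \<in> V2" using b2[OF that] .
    show "dg g V2 x \<le> ?N" "dg g V2 x \<le> real n - 1" if "x \<in> V1" using b3[OF UnI1[OF that]] d3[OF that] by simp_all
    show "dg g V1 x \<le> ?N" "dg g V1 x \<le> real n - 1" if "x \<in> V2" using b3[OF UnI2[OF that]] d3'[OF that] by simp_all
  qed (use gr fV dj cV e in simp_all)
  then have "pk V1 V2 g" by (rule good_packs)
  then obtain f where f: "bij_betw f V1 V2" "\<forall>x\<in>V1. \<not> g x (f x)" "\<forall>x\<in>V1. \<forall>y\<in>V1. g x y \<longrightarrow> \<not> g (f x) (f y)"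
    unfolding pk_def by blast
  have fB: "f x \<in> V2" if "x \<in> V1" for x using f(1) that by (rule bij_betwE[THEN bspec])
  show ?thesis
    unfolding packs_def
  proof (intro exI[of _ f] conjI ballI impI)
    show "bij_betw f V1 V2" by (rule f(1))
    show "{v, f v} \<notin> E3" if v: "v \<in> V1" for v using f(2) g3(1)[OF v fB[OF v]] v by blast
    show "{f u, f v} \<notin> E2" if u: "u \<in> V1" "v \<in> V1" "{u, v} \<in> E1" for u v
      using f(3) g1[OF u(1,2)] g2[OF fB[OF u(1)] fB[OF u(2)]] u by blast
  qed
qed

end
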